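(* Let $p\ge 1$, let $f:\mathbb R^p\to\mathbb R$ be convex and continuously differentiable with $M$-Lipschitz gradient for some $M>0$, i.e. $\|\nabla f(\theta)-\nabla f(\theta')\|_2\le M\|\theta-\theta'\|_2$ for all $\theta,\theta'\in\mathbb R^p$, and suppose $\int_{\mathbb R^p} e^{-f}<\infty$. Let $\pi(\theta)=e^{-f(\theta)}/\int_{\mathbb R^p}e^{-f(v)}dv$ and $\mu_2=\big(\int_{\mathbb R^p}\|\theta\|_2^2\,\pi(\theta)\,d\theta\big)^{1/2}$. Let $q\in[1,2]$. For every $0<\alpha\le M/20$, every $0<h\le 1/(M+\alpha)$ and every $K\in\mathbb N$, the distribution $\nu_K$ of the $K$-th iterate $\vartheta_K$ of the $\alpha$-LMC algorithm (with parameters $\alpha,h$, started at $\vartheta_0=0$) satisfies $$W_q(\nu_K,\pi)\le \mu_2(1-\alpha h)^{K/2}+\Big(\frac{2.1\,hMp}{\alpha}\Big)^{1/2}+\big(C_q\,\alpha\,\mu_2^{q+2}\big)^{1/q},$$ where $C_q$ is the dimension-free constant defined in the context.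
   Context: Wasserstein distance: $W_q(\nu,\nu')=\inf\{\mathbf E[\|\vartheta-\vartheta'\|_2^q]^{1/q}:\vartheta\sim\nu,\ \vartheta'\sim\nu'\}$, the infimum being over all couplings. $\alpha$-LMC algorithm with step-size $h$: $\vartheta_0=0$ and $$\vartheta_{k+1}=(1-\alpha h)\vartheta_k-h\nabla f(\vartheta_k)+\sqrt{2h}\,\xi_{k+1},\qquad k=0,1,2,\dots,$$ where $\xi_1,\xi_2,\dots$ are i.i.d. $\mathcal N(0,I_p)$ vectors. Constant $C_q$: for a log-concave probability density $\pi\propto e^{-f}$ on $\mathbb R^p$ and $\alpha\ge 0$, let $\pi_\alpha(\theta)\propto e^{-f(\theta)-\alpha\|\theta\|_2^2/2}$ be the corresponding probability density, and let $\mu_2(\pi)=(\int\|\theta\|_2^2\pi(\theta)d\theta)^{1/2}$. Then $C_q$ is the infimum of all $C$ such that $W_q^q(\pi,\pi_\alpha)\le C\,\alpha\,\mu_2(\pi)^{q+2}$ for all log-concave $\pi$ (in any dimension $p$) and all $\alpha\ge 0$. *)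

theory Defs
  imports "HOL-Probability.Probability"
begin

(* Only used with r > 0, where \<infinity> to the power r is \<infinity>. *)
definition ennreal_powr :: "ennreal \<Rightarrow> real \<Rightarrow> ennreal" where
  "ennreal_powr x r = (if x = \<infinity> then \<infinity> else ennreal (enn2real x powr r))"


definition couplings :: "'a measure \<Rightarrow> 'a measure \<Rightarrow> ('a \<times> 'a) measure set" where
  "couplings M N =
     {Q. sets Q = sets (M \<Otimes>\<^sub>M N) \<and> distr Q M fst = M \<and> distr Q N snd = N}"

(* The distance d is a parameter because the definition is used both on real ^ 'n and
   on the coordinate spaces of variable dimension below. *)
definition wasserstein ::
  "('a \<Rightarrow> 'a \<Rightarrow> real) \<Rightarrow> real \<Rightarrow> 'a measure \<Rightarrow> 'a measure \<Rightarrow> ennreal" where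
  "wasserstein d q M N =
     (INF Q \<in> couplings M N.
        ennreal_powr (\<integral>\<^sup>+ z. ennreal (d (fst z) (snd z) powr q) \<partial>Q) (1 / q))"

definition mu2 :: "('a \<Rightarrow> real) \<Rightarrow> 'a measure \<Rightarrow> ennreal" where
  "mu2 nrm M = ennreal_powr (\<integral>\<^sup>+ x. ennreal ((nrm x)\<^sup>2) \<partial>M) (1 / 2)"


(* The constant C_q is uniform over all dimensions p, and a quantifier cannot range over the
   types real ^ 'n. Inside its definition R^p is therefore the product of p copies of the real
   line, with Lebesgue measure lborel_pow p and Euclidean norm norm_pow p; its points are
   the extensional functions on {..<p}. *)
definition lborel_pow :: "nat \<Rightarrow> (nat \<Rightarrow> real) measure" where
  "lborel_pow p = (\<Pi>\<^sub>M i\<in>{..<p}. lborel)"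

definition norm_pow :: "nat \<Rightarrow> (nat \<Rightarrow> real) \<Rightarrow> real" where
  "norm_pow p x = L2_set x {..<p}"

definition dist_pow :: "nat \<Rightarrow> (nat \<Rightarrow> real) \<Rightarrow> (nat \<Rightarrow> real) \<Rightarrow> real" where
  "dist_pow p x y = L2_set (\<lambda>i. x i - y i) {..<p}"

(* g = exp (- f) with f convex; f may take the value + \<infinity> (where g = 0). *)
definition log_concave_density :: "nat \<Rightarrow> ((nat \<Rightarrow> real) \<Rightarrow> real) \<Rightarrow> bool" where
  "log_concave_density p g \<longleftrightarrow>
     g \<in> borel_measurable (lborel_pow p) \<and>
     (\<forall>x\<in>space (lborel_pow p). 0 \<le> g x) \<and>
     (\<integral>\<^sup>+ x. ennreal (g x) \<partial>lborel_pow p) = 1 \<and>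
     (\<forall>x\<in>space (lborel_pow p). \<forall>y\<in>space (lborel_pow p). \<forall>t\<in>{0<..<1}.
        g x powr (1 - t) * g y powr t \<le> g (\<lambda>i\<in>{..<p}. (1 - t) * x i + t * y i))"

definition tilted_density ::
  "nat \<Rightarrow> real \<Rightarrow> ((nat \<Rightarrow> real) \<Rightarrow> real) \<Rightarrow> (nat \<Rightarrow> real) \<Rightarrow> real" where
  "tilted_density p \<alpha> g x =
     g x * exp (- \<alpha> * (norm_pow p x)\<^sup>2 / 2) /
     (\<integral> v. g v * exp (- \<alpha> * (norm_pow p v)\<^sup>2 / 2) \<partial>lborel_pow p)"

(* The infimum is taken in [0, \<infinity>], so that it is defined (and equal to \<infinity>) even if no C
   is admissible. Negative C are never admissible (take \<alpha> > 0). *)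
definition C_const :: "real \<Rightarrow> ennreal" where
  "C_const q =
     (INF C \<in> {C::real. 0 \<le> C \<and>
        (\<forall>p g \<alpha>. 1 \<le> p \<longrightarrow> log_concave_density p g \<longrightarrow> 0 \<le> \<alpha> \<longrightarrow>
           (let \<pi> = density (lborel_pow p) (\<lambda>x. ennreal (g x));
                \<pi>\<^sub>\<alpha> = density (lborel_pow p) (\<lambda>x. ennreal (tilted_density p \<alpha> g x))
            in ennreal_powr (wasserstein (dist_pow p) q \<pi> \<pi>\<^sub>\<alpha>) q
                 \<le> ennreal C * ennreal \<alpha> * ennreal_powr (mu2 (norm_pow p) \<pi>) (q + 2)))}.
      ennreal C)"


definition std_gaussian :: "(real ^ 'n) measure" where
  "std_gaussian = density lborel (\<lambda>x. ennreal (\<Prod>i\<in>UNIV. std_normal_density (x $ i)))"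

definition gibbs :: "(real ^ 'n \<Rightarrow> real) \<Rightarrow> (real ^ 'n) measure" where
  "gibbs f = density lborel (\<lambda>x. ennreal (exp (- f x) / (\<integral> v. exp (- f v) \<partial>lborel)))"

primrec lmc ::
  "(real ^ 'n \<Rightarrow> real ^ 'n) \<Rightarrow> real \<Rightarrow> real \<Rightarrow> (nat \<Rightarrow> 'w \<Rightarrow> real ^ 'n) \<Rightarrow> nat \<Rightarrow> 'w \<Rightarrow> real ^ 'n"
where
  "lmc G \<alpha> h \<xi> 0 \<omega> = 0"
| "lmc G \<alpha> h \<xi> (Suc k) \<omega> =
     (1 - \<alpha> * h) *\<^sub>R lmc G \<alpha> h \<xi> k \<omega> - h *\<^sub>R G (lmc G \<alpha> h \<xi> k \<omega>)
       + sqrt (2 * h) *\<^sub>R \<xi> (Suc k) \<omega>"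

end

theory Submission
  imports Defs
begin

text \<open>Let \<open>U = f + \<alpha>/2 |x|\<^sup>2\<close> and \<open>L = M + \<alpha>\<close>. One step of the algorithm is a gradient step \<open>x \<mapsto> x\<^sup>+\<close> for \<open>U\<close>
  followed by a heat flow of duration \<open>h\<close>. The gradient step satisfies
  \<open>|x\<^sup>+ - y|\<^sup>2 \<le> (1 - \<alpha> h) |x - y|\<^sup>2 - 2 h (U x\<^sup>+ - U y)\<close>. For the heat flow \<open>X\<^sub>t\<close> started at \<open>x\<^sup>+\<close> and the
  stationary Langevin diffusion \<open>Y\<^sub>t\<close> for \<open>\<pi>\<^sub>\<alpha>\<close> driven by the same Brownian motion, the squared distance has
  derivative \<open>2 (X\<^sub>t - Y\<^sub>t) \<bullet> \<nabla>U(Y\<^sub>t) \<le> 2 (U X\<^sub>t - U Y\<^sub>t)\<close>, while \<open>E (U X\<^sub>t) \<le> U x\<^sup>+ + L t p\<close>. The terms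
  \<open>U x\<^sup>+ - U y\<close> cancel in the mean and leave an error \<open>L h\<^sup>2 p\<close> per step.
  The diffusion is replaced by a Metropolis chain with small Gaussian steps, which is exactly stationary;
  its discretization error is made smaller than another \<open>L h\<^sup>2 p\<close>, whence the constant
  \<open>2.1 M \<ge> 2 (M + \<alpha>)\<close>. Finally \<open>\<mu>\<^sub>2(\<pi>\<^sub>\<alpha>) \<le> \<mu>\<^sub>2(\<pi>)\<close> because \<open>|x|\<^sup>2\<close> and \<open>exp (- \<alpha>/2 |x|\<^sup>2)\<close> are
  negatively correlated, and the bias \<open>W\<^sub>q(\<pi>\<^sub>\<alpha>, \<pi>)\<close> is controlled by the definition of \<open>C\<^sub>q\<close>.\<close>

section \<open>Smooth convex functions\<close>

text \<open>The Metropolis chain suits this argument because its proposals are the plain Gaussian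
  moves of the heat flow. While proposals are accepted, the difference of the two points does not
  change; the drift towards equilibrium comes from rejections alone, at order s^2 for moves of size
  s, and yet \<open>gibbs U\<close> is preserved exactly for every s. An Euler discretization would
  leave the second marginal only approximately stationary, and that defect would have to be followed
  through all iterations. The local error has order s^3 and a flow of duration h takes 2 h / s^2
  moves, so the total error vanishes with s, provided the error constant is uniform along the flow.
  Hence the local error may involve only the second moment of the moving law and the fourth moment
  of the stationary one. The gradient step has to gain the potential at its end point, because the
  heat flow starts there. One iteration then multiplies the squared cost by 1 - \<alpha> h and adds
  2 L h^2 p, which accumulates to at most 2 L h p / \<alpha>. The square root is taken once, at the
  end.\<close>

lemma gderiv_along_line:
  fixes f :: "'a::real_inner \<Rightarrow> real"
  assumes "\<And>x. GDERIV f x :> G x"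
  shows "((\<lambda>t. f (x + t *\<^sub>R v)) has_real_derivative (G (x + t *\<^sub>R v) \<bullet> v)) (at t)"
proof -
  have "(f has_derivative (\<lambda>h. h \<bullet> G (x + t *\<^sub>R v))) (at (x + t *\<^sub>R v))"
    using assms by (simp add: gderiv_def)
  moreover have "((\<lambda>t. x + t *\<^sub>R v) has_derivative (\<lambda>h. h *\<^sub>R v)) (at t)"
    by (auto intro!: derivative_eq_intros)
  ultimately have "((\<lambda>t. f (x + t *\<^sub>R v)) has_derivative (\<lambda>h. (h *\<^sub>R v) \<bullet> G (x + t *\<^sub>R v))) (at t)"
    by (rule has_derivative_compose[rotated])
  moreover have "(\<lambda>h. (h *\<^sub>R v) \<bullet> G (x + t *\<^sub>R v)) = (*) (G (x + t *\<^sub>R v) \<bullet> v)"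
    by (auto simp: inner_commute)
  ultimately show ?thesis by (simp add: has_field_derivative_def)
qed

lemma convex_above_gradient:
  fixes f :: "'a::real_inner \<Rightarrow> real"
  assumes conv: "convex_on UNIV f" and G: "\<And>x. GDERIV f x :> G x"
  shows "f y \<ge> f x + G x \<bullet> (y - x)"
proof -
  let ?\<phi> = "\<lambda>t. f (x + t *\<^sub>R (y - x))"
  have "convex_on UNIV ?\<phi>"
  proof (rule convex_onI)
    fix t a b :: real assume t: "0 < t" "t < 1"
    have "x + ((1 - t) *\<^sub>R a + t *\<^sub>R b) *\<^sub>R (y - x)
        = (1 - t) *\<^sub>R (x + a *\<^sub>R (y - x)) + t *\<^sub>R (x + b *\<^sub>R (y - x))"
      by (simp add: algebra_simps)
    then show "?\<phi> ((1 - t) *\<^sub>R a + t *\<^sub>R b) \<le> (1 - t) * ?\<phi> a + t * ?\<phi> b"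
      using convex_onD[OF conv, of t "x + a *\<^sub>R (y - x)" "x + b *\<^sub>R (y - x)"] t by simp
  qed simp
  moreover have "(?\<phi> has_real_derivative G x \<bullet> (y - x)) (at 0)"
    using gderiv_along_line[of f G x "y - x" 0] G by simp
  ultimately have "?\<phi> 1 - ?\<phi> 0 \<ge> (G x \<bullet> (y - x)) * (1 - 0)"
    by (intro convex_on_imp_above_tangent[where A=UNIV]) auto
  then show ?thesis by simp
qed

text \<open>With the claimed bound subtracted along the segment, \<open>?\<phi>\<close> has
  derivative (G (x + t v) - G x) \<bullet> v - L t |v|^2, which is nonpositive by Cauchy-Schwarz and
  the Lipschitz condition.\<close>

lemma descent_lemma:
  fixes f :: "'a::real_inner \<Rightarrow> real"
  assumes G: "\<And>x. GDERIV f x :> G x"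
    and L: "\<And>x y. norm (G x - G y) \<le> L * norm (x - y)"
  shows "f (x + v) \<le> f x + G x \<bullet> v + L / 2 * (norm v)\<^sup>2"
proof -
  let ?\<phi> = "\<lambda>t. f (x + t *\<^sub>R v) - t * (G x \<bullet> v) - L / 2 * t\<^sup>2 * (norm v)\<^sup>2"
  have "?\<phi> 1 \<le> ?\<phi> 0"
  proof (rule DERIV_nonpos_imp_nonincreasing[of 0 1 ?\<phi>])
    fix t :: real assume t: "0 \<le> t" "t \<le> 1"
    have "(?\<phi> has_real_derivative (G (x + t *\<^sub>R v) \<bullet> v - G x \<bullet> v - L * t * (norm v)\<^sup>2)) (at t)"
      by (rule derivative_eq_intros gderiv_along_line[OF G] refl | simp)+
    moreover have "(G (x + t *\<^sub>R v) - G x) \<bullet> v \<le> norm (G (x + t *\<^sub>R v) - G x) * norm v"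
      by (rule norm_cauchy_schwarz)
    moreover have "\<dots> \<le> (L * (t * norm v)) * norm v"
      using L[of "x + t *\<^sub>R v" x] t by (intro mult_right_mono) auto
    ultimately show "\<exists>y. (?\<phi> has_real_derivative y) (at t) \<and> y \<le> 0"
      by (intro exI[of _ "G (x + t *\<^sub>R v) \<bullet> v - G x \<bullet> v - L * t * (norm v)\<^sup>2"])
         (auto simp: inner_diff_left power2_eq_square algebra_simps)
  qed simp
  then show ?thesis by simp
qed

text \<open>As h L \<le> 1, the descent lemma gains h/2 |G x|^2; multiplied by 2 h this is exactly
  the term h^2 |G x|^2 from expanding the square. Strong convexity at x handles the inner product
  with x - y.\<close>

lemma gradient_step_contraction:
  fixes U :: "'a::real_inner \<Rightarrow> real"
  assumes G: "\<And>x. GDERIV U x :> G x"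
    and L: "\<And>x y. norm (G x - G y) \<le> L * norm (x - y)"
    and strong: "\<And>x y. U y \<ge> U x + G x \<bullet> (y - x) + m / 2 * (norm (y - x))\<^sup>2"
    and h: "0 < h" "h * L \<le> 1"
  shows "(norm (x - h *\<^sub>R G x - y))\<^sup>2
    \<le> (1 - m * h) * (norm (x - y))\<^sup>2 - 2 * h * (U (x - h *\<^sub>R G x) - U y)"
proof -
  let ?g = "G x"
  have "U (x - h *\<^sub>R ?g) \<le> U x - h * (?g \<bullet> ?g) + L / 2 * (h\<^sup>2 * (?g \<bullet> ?g))"
    using descent_lemma[OF G L, of x "- h *\<^sub>R ?g"]
    by (simp add: power_mult_distrib power2_norm_eq_inner)
  also have "L / 2 * (h\<^sup>2 * (?g \<bullet> ?g)) \<le> h / 2 * (?g \<bullet> ?g)"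
  proof -
    have "(h * L) * (h * (?g \<bullet> ?g)) \<le> 1 * (h * (?g \<bullet> ?g))"
      using h by (intro mult_right_mono) auto
    then show ?thesis by (simp add: power2_eq_square algebra_simps)
  qed
  finally have 1: "U (x - h *\<^sub>R ?g) \<le> U x - h / 2 * (?g \<bullet> ?g)" by simp
  have "U (x - h *\<^sub>R ?g) - U y \<le> ?g \<bullet> (x - y) - m / 2 * (norm (x - y))\<^sup>2 - h / 2 * (?g \<bullet> ?g)"
    using 1 strong[where x=x and y=y] by (simp add: inner_diff_right norm_minus_commute)
  then have "2 * h * (U (x - h *\<^sub>R ?g) - U y)
      \<le> 2 * h * (?g \<bullet> (x - y) - m / 2 * (norm (x - y))\<^sup>2 - h / 2 * (?g \<bullet> ?g))"
    using h by (intro mult_left_mono) auto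
  moreover have "(norm (x - h *\<^sub>R ?g - y))\<^sup>2
      = (norm (x - y))\<^sup>2 - 2 * h * (?g \<bullet> (x - y)) + h\<^sup>2 * (?g \<bullet> ?g)"
    unfolding power2_norm_eq_inner
    by (simp add: inner_diff_left inner_diff_right inner_commute algebra_simps power2_eq_square)
  ultimately show ?thesis by (simp add: algebra_simps power2_eq_square)
qed

section \<open>The standard Gaussian measure\<close>

lemma measurable_vec_lambda [measurable (raw)]:
  fixes g :: "'n::finite \<Rightarrow> 'a \<Rightarrow> real"
  assumes [measurable]: "\<And>i. g i \<in> borel_measurable M"
  shows "(\<lambda>x. \<chi> i. g i x) \<in> borel_measurable M"
proof -
  have "(\<chi> i. g i x) = (\<Sum>i\<in>UNIV. g i x *\<^sub>R axis i 1)" for x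
    using basis_expansion[of "\<chi> i. g i x"] by (simp add: scalar_mult_eq_scaleR)
  then show ?thesis by simp
qed

text \<open>The index set is arbitrary because two instances are needed: the identity, for product
  formulas on \<open>real ^ 'n\<close>, and an enumeration by \<open>{..<p}\<close>, for the
  coordinate spaces inside \<open>C_const\<close>.\<close>

lemma lborel_vec_eq:
  fixes e :: "'n::finite \<Rightarrow> 'i"
  assumes e: "bij_betw e UNIV I"
  shows "lborel = distr (\<Pi>\<^sub>M i\<in>I. lborel) borel (\<lambda>x. (\<chi> i. x (e i)) :: real ^ 'n)"
proof (rule lborel_eqI)
  have fin: "finite I" using bij_betw_finite[OF e] by simp
  interpret product_sigma_finite "\<lambda>_::'i. lborel :: real measure" ..
  have eI: "e i \<in> I" for i using e by (auto simp: bij_betw_def)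
  have meas: "(\<lambda>x. \<chi> i. x (e i)) \<in> borel_measurable (\<Pi>\<^sub>M i\<in>I. lborel :: real measure)"
    by (rule measurable_vec_lambda) (use eI in measurable)
  fix l u :: "real ^ 'n" assume le: "\<And>b. b \<in> Basis \<Longrightarrow> l \<bullet> b \<le> u \<bullet> b"
  have le': "l $ i \<le> u $ i" for i
    using le[of "axis i 1"] by (auto simp: inner_axis Basis_vec_def)
  let ?d = "the_inv_into UNIV e"
  have d: "?d (e i) = i" for i using e by (simp add: bij_betw_def the_inv_into_f_f)
  have "(\<lambda>x. \<chi> i. x (e i)) -` box l u \<inter> space (\<Pi>\<^sub>M i\<in>I. lborel)
      = (\<Pi>\<^sub>E j\<in>I. {l $ ?d j <..< u $ ?d j})"
    using e by (auto simp: mem_box_cart space_PiM PiE_iff bij_betw_def d)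
  then have "emeasure (distr (\<Pi>\<^sub>M i\<in>I. lborel) borel (\<lambda>x. \<chi> i. x (e i))) (box l u)
      = (\<Prod>j\<in>I. emeasure lborel {l $ ?d j <..< u $ ?d j})"
    using fin by (subst emeasure_distr[OF meas]) (simp_all add: emeasure_PiM)
  also have "\<dots> = (\<Prod>i\<in>UNIV. emeasure lborel {l $ i <..< u $ i})"
    by (subst prod.reindex_bij_betw[OF e, symmetric]) (simp add: d)
  also have "\<dots> = ennreal (\<Prod>i\<in>UNIV. u $ i - l $ i)"
    using le' by (simp add: prod_ennreal)
  also have "(\<Prod>i\<in>UNIV. u $ i - l $ i) = (\<Prod>b\<in>Basis. (u - l) \<bullet> b)"
  proof -
    have "bij_betw (\<lambda>i::'n. axis i (1::real)) UNIV Basis"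
      by (auto simp: bij_betw_def inj_on_def axis_eq_axis Basis_vec_def)
    then show ?thesis
      by (subst prod.reindex_bij_betw[symmetric]) (auto simp: inner_axis)
  qed
  finally show "emeasure (distr (\<Pi>\<^sub>M i\<in>I. lborel) borel (\<lambda>x. \<chi> i. x (e i))) (box l u)
      = ennreal (\<Prod>b\<in>Basis. (u - l) \<bullet> b)" .
qed simp

lemma nn_integral_lborel_vec_prod:
  fixes g :: "'n::finite \<Rightarrow> real \<Rightarrow> ennreal"
  assumes [measurable]: "\<And>i. g i \<in> borel_measurable borel"
  shows "(\<integral>\<^sup>+ x. (\<Prod>i\<in>UNIV. g i (x $ i)) \<partial>lborel) = (\<Prod>i\<in>UNIV. \<integral>\<^sup>+ t. g i t \<partial>lborel)"
proof -
  interpret product_sigma_finite "\<lambda>_::'n. lborel :: real measure" ..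
  have "(\<integral>\<^sup>+ x. (\<Prod>i\<in>UNIV. g i (x $ i)) \<partial>lborel)
      = (\<integral>\<^sup>+ x. (\<Prod>i\<in>UNIV. g i (x i)) \<partial>(\<Pi>\<^sub>M i\<in>UNIV. lborel))"
    by (subst lborel_vec_eq[of "\<lambda>i::'n. i" UNIV]) (simp_all add: nn_integral_distr bij_betw_def)
  then show ?thesis by (simp add: product_nn_integral_prod)
qed

lemma lborel_vec_prod_integral:
  fixes g :: "'n::finite \<Rightarrow> real \<Rightarrow> real"
  assumes int: "\<And>i. integrable lborel (g i)"
  shows "integrable lborel (\<lambda>x. \<Prod>i\<in>UNIV. g i (x $ i))"
    and "(\<integral>x. (\<Prod>i\<in>UNIV. g i (x $ i)) \<partial>lborel) = (\<Prod>i\<in>UNIV. \<integral>t. g i t \<partial>lborel)"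
proof -
  interpret product_sigma_finite "\<lambda>_::'n. lborel :: real measure" ..
  have [measurable]: "g i \<in> borel_measurable borel" for i
    using borel_measurable_integrable[OF int] by simp
  have m: "(\<lambda>x. \<Prod>i\<in>UNIV. g i (x $ i)) \<in> borel_measurable borel" by measurable
  have v: "(\<lambda>x. (\<chi> i. x i) :: real ^ 'n) \<in> borel_measurable (\<Pi>\<^sub>M i\<in>UNIV. lborel)"
    by (rule measurable_vec_lambda[of "\<lambda>i x. x i"]) measurable
  show "integrable lborel (\<lambda>x. \<Prod>i\<in>UNIV. g i (x $ i))"
    by (subst lborel_vec_eq[of "\<lambda>i::'n. i" UNIV], simp add: bij_betw_def)
       (use product_integrable_prod[of UNIV g] int in \<open>simp add: integrable_distr_eq[OF v m]\<close>)
  show "(\<integral>x. (\<Prod>i\<in>UNIV. g i (x $ i)) \<partial>lborel) = (\<Prod>i\<in>UNIV. \<integral>t. g i t \<partial>lborel)"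
    by (subst lborel_vec_eq[of "\<lambda>i::'n. i" UNIV], simp add: bij_betw_def)
       (use product_integral_prod[of UNIV g] int in \<open>simp add: integral_distr[OF v m]\<close>)
qed

definition normal_vec :: "real \<Rightarrow> real ^ 'n \<Rightarrow> real" where
  "normal_vec \<sigma> x = (\<Prod>i\<in>UNIV. normal_density 0 \<sigma> (x $ i))"

lemma normal_vec_nonneg [simp]: "0 \<le> normal_vec \<sigma> x"
  by (simp add: normal_vec_def prod_nonneg)

lemma measurable_normal_vec [measurable]: "normal_vec \<sigma> \<in> borel_measurable borel"
  unfolding normal_vec_def by measurable

lemma std_gaussian_normal_vec: "std_gaussian = density lborel (\<lambda>x. ennreal (normal_vec 1 x))"
  by (simp add: std_gaussian_def normal_vec_def)

lemma sets_std_gaussian [measurable_cong, simp]: "sets std_gaussian = sets borel"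
  by (simp add: std_gaussian_def)

lemma space_std_gaussian [simp]: "space std_gaussian = UNIV"
  by (simp add: std_gaussian_def)

lemma std_gaussian_prod_integral:
  fixes g :: "'n::finite \<Rightarrow> real \<Rightarrow> real"
  assumes int: "\<And>i. integrable lborel (\<lambda>t. std_normal_density t * g i t)"
    and m [measurable]: "\<And>i. g i \<in> borel_measurable borel"
  shows "integrable std_gaussian (\<lambda>x. \<Prod>i\<in>UNIV. g i (x $ i))"
    and "(\<integral>x. (\<Prod>i\<in>UNIV. g i (x $ i)) \<partial>std_gaussian) = (\<Prod>i\<in>UNIV. \<integral>t. std_normal_density t * g i t \<partial>lborel)"
  using lborel_vec_prod_integral[OF int]
  by (simp_all add: std_gaussian_def integrable_density integral_density prod_nonneg prod.distrib)

lemma prob_space_std_gaussian: "prob_space (std_gaussian :: (real ^ 'n) measure)"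
proof
  have "emeasure (std_gaussian :: (real ^ 'n) measure) (space std_gaussian)
      = (\<integral>\<^sup>+ x. (\<Prod>i\<in>UNIV. ennreal (std_normal_density (x $ i))) \<partial>(lborel :: (real ^ 'n) measure))"
    by (simp add: std_gaussian_def emeasure_density prod_ennreal)
  also have "\<dots> = (\<Prod>i\<in>(UNIV::'n set). \<integral>\<^sup>+ t. ennreal (std_normal_density t) \<partial>lborel)"
    by (rule nn_integral_lborel_vec_prod) measurable
  also have "(\<integral>\<^sup>+ t. ennreal (std_normal_density t) \<partial>lborel) = 1"
    by (subst nn_integral_eq_integral) auto
  finally show "emeasure (std_gaussian :: (real ^ 'n) measure) (space std_gaussian) = 1" by simp
qed

lemma integrable_std_gaussian_coord_power:
  "integrable (std_gaussian :: (real ^ 'n) measure) (\<lambda>z. (z $ i) ^ k)"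
proof -
  have *: "(z $ i) ^ k = (\<Prod>j\<in>UNIV. (if j = i then (z $ j) ^ k else 1))" for z :: "real ^ 'n"
    by simp
  have "integrable lborel (\<lambda>t. std_normal_density t * (if j = i then t ^ k else 1))" for j
    by (cases "j = i") (simp_all add: integrable_std_normal_moment)
  then show ?thesis unfolding *
    by (rule std_gaussian_prod_integral(1)) measurable
qed

lemma std_gaussian_coord_cov:
  "integrable (std_gaussian :: (real ^ 'n) measure) (\<lambda>z. z $ i * z $ j)"
  "(\<integral>z. z $ i * z $ j \<partial>(std_gaussian :: (real ^ 'n) measure)) = (if i = j then 1 else 0)"
proof -
  \<comment> \<open>Writes the product of two coordinates as a product over all coordinates: the
    factor at k is t^2 if k = i = j, t if k is exactly one of them, and 1 otherwise.\<close>
  let ?g = "\<lambda>k t::real. (if k = i then t else 1) * (if k = j then t else 1)"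
  have *: "z $ i * z $ j = (\<Prod>k\<in>UNIV. ?g k (z $ k))" for z :: "real ^ 'n"
    by (simp add: prod.distrib)
  have int: "integrable lborel (\<lambda>t. std_normal_density t * ?g k t)" for k
    using integrable_std_normal_moment[of 0] integrable_std_normal_moment[of 1] integrable_std_normal_moment[of 2]
    by (cases "k = i"; cases "k = j") (simp_all add: power2_eq_square)
  have m: "?g k \<in> borel_measurable borel" for k by measurable
  show "integrable (std_gaussian :: (real ^ 'n) measure) (\<lambda>z. z $ i * z $ j)"
    unfolding * by (rule std_gaussian_prod_integral(1)[OF int m])
  have "(\<integral>z. z $ i * z $ j \<partial>(std_gaussian :: (real ^ 'n) measure))
      = (\<Prod>k\<in>UNIV. \<integral>t. std_normal_density t * ?g k t \<partial>lborel)"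
    unfolding * by (rule std_gaussian_prod_integral(2)[OF int m])
  also have "\<dots> = (if i = j then 1 else 0)"
  proof (cases "i = j")
    case True
    have "(\<integral>t. std_normal_density t * ?g k t \<partial>lborel) = 1" for k
      using integral_std_normal_moment_even[of 1] integral_std_normal_moment_even[of 0] True
      by (cases "k = i") (simp_all add: power2_eq_square)
    then show ?thesis using True by simp
  next
    case False
    have "(\<integral>t. std_normal_density t * ?g i t \<partial>lborel) = 0"
      using integral_std_normal_moment_odd[of 0] False by simp
    then have "(\<Prod>k\<in>UNIV. \<integral>t. std_normal_density t * ?g k t \<partial>lborel) = 0"
      by (intro prod_zero bexI[of _ i]) auto
    then show ?thesis using False by simp
  qed
  finally show "(\<integral>z. z $ i * z $ j \<partial>(std_gaussian :: (real ^ 'n) measure)) = (if i = j then 1 else 0)" .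
qed

lemma std_gaussian_cov:
  fixes u v :: "real ^ 'n"
  shows "integrable std_gaussian (\<lambda>z. (u \<bullet> z) * (v \<bullet> z))"
    and "(\<integral>z. (u \<bullet> z) * (v \<bullet> z) \<partial>std_gaussian) = u \<bullet> v"
proof -
  have *: "(u \<bullet> z) * (v \<bullet> z) = (\<Sum>i\<in>UNIV. \<Sum>j\<in>UNIV. u $ i * v $ j * (z $ i * z $ j))" for z
    unfolding inner_vec_def by (simp add: sum_product algebra_simps)
  have int: "integrable std_gaussian (\<lambda>z::real^'n. u $ i * v $ j * (z $ i * z $ j))" for i j
    using std_gaussian_coord_cov(1) by (intro integrable_mult_right)
  show "integrable std_gaussian (\<lambda>z. (u \<bullet> z) * (v \<bullet> z))"
    unfolding * by (intro Bochner_Integration.integrable_sum int)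
  have "(\<integral>z. (u \<bullet> z) * (v \<bullet> z) \<partial>std_gaussian) = (\<Sum>i\<in>UNIV. \<Sum>j\<in>UNIV. u $ i * v $ j * (if i = j then 1 else 0))"
    unfolding * by (simp only: Bochner_Integration.integral_sum[OF Bochner_Integration.integrable_sum[OF int]] Bochner_Integration.integral_sum[OF int] integral_mult_right_zero std_gaussian_coord_cov(2))
  also have "\<dots> = u \<bullet> v" by (simp add: inner_vec_def if_distrib cong: if_cong)
  finally show "(\<integral>z. (u \<bullet> z) * (v \<bullet> z) \<partial>std_gaussian) = u \<bullet> v" .
qed

lemma norm_vec_sq: "(norm (z :: real ^ 'n))\<^sup>2 = (\<Sum>i\<in>UNIV. (z $ i)\<^sup>2)"
  unfolding power2_norm_eq_inner inner_vec_def by (simp add: power2_eq_square)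

lemma std_gaussian_norm_sq:
  "integrable (std_gaussian :: (real ^ 'n) measure) (\<lambda>z. (norm z)\<^sup>2)"
  "(\<integral>z. (norm z)\<^sup>2 \<partial>(std_gaussian :: (real ^ 'n) measure)) = real CARD('n)"
proof -
  have *: "(norm z)\<^sup>2 = (\<Sum>i\<in>UNIV. z $ i * z $ i)" for z :: "real ^ 'n"
    unfolding norm_vec_sq by (simp add: power2_eq_square)
  show "integrable (std_gaussian :: (real ^ 'n) measure) (\<lambda>z. (norm z)\<^sup>2)"
    unfolding * by (intro Bochner_Integration.integrable_sum std_gaussian_coord_cov)
  show "(\<integral>z. (norm z)\<^sup>2 \<partial>(std_gaussian :: (real ^ 'n) measure)) = real CARD('n)"
    unfolding * by (subst Bochner_Integration.integral_sum) (simp_all add: std_gaussian_coord_cov)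
qed

text \<open>Powers up to four are dominated by 1 + |z|^4, and Cauchy-Schwarz bounds |z|^4 by fourth
  powers of coordinates. Four is the highest power that occurs in \<open>step_error\<close>.\<close>

lemma std_gaussian_norm_pow:
  assumes "k \<le> 4"
  shows "integrable (std_gaussian :: (real ^ 'n) measure) (\<lambda>z. norm z ^ k)"
proof (rule Bochner_Integration.integrable_bound)
  let ?B = "\<lambda>z::real^'n. 1 + real CARD('n) * (\<Sum>i\<in>UNIV. (z $ i) ^ 4)"
  interpret prob_space "std_gaussian :: (real ^ 'n) measure" by (rule prob_space_std_gaussian)
  show "integrable std_gaussian ?B"
    by (intro Bochner_Integration.integrable_add integrable_mult_right Bochner_Integration.integrable_sum integrable_std_gaussian_coord_power) simp
  have "norm z ^ k \<le> ?B z" for z :: "real ^ 'n"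
  proof -
    have "norm z ^ k \<le> 1 + norm z ^ 4"
    proof (cases "norm z \<le> 1")
      case True
      have "norm z ^ k \<le> 1" by (rule power_le_one) (use True in auto)
      then show ?thesis by (smt (verit) zero_le_power norm_ge_zero)
    next
      case False
      then have "norm z ^ k \<le> norm z ^ 4" by (intro power_increasing assms) auto
      then show ?thesis by simp
    qed
    also have "norm z ^ 4 = (\<Sum>i\<in>UNIV. (z $ i)\<^sup>2)\<^sup>2"
      by (subst norm_vec_sq[symmetric]) (simp flip: power_mult)
    also have "\<dots> \<le> real CARD('n) * (\<Sum>i\<in>UNIV. ((z $ i)\<^sup>2)\<^sup>2)"
      using sum_squared_le_sum_of_squares[of "\<lambda>i. (z $ i)\<^sup>2" UNIV] by (simp add: mult.commute)
    finally show ?thesis by (simp flip: power_mult)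
  qed
  then show "AE z in std_gaussian. norm (norm (z::real^'n) ^ k) \<le> norm (?B z)"
    by (intro AE_I2) (simp add: sum_nonneg)
qed measurable

section \<open>Scaling, reflection and convolution of Gaussian vectors\<close>

lemma nn_integral_lborel_shift:
  fixes f :: "'a::euclidean_space \<Rightarrow> ennreal"
  assumes [measurable]: "f \<in> borel_measurable borel"
  shows "(\<integral>\<^sup>+ x. f (c + x) \<partial>lborel) = (\<integral>\<^sup>+ x. f x \<partial>lborel)"
  by (subst (2) lborel_distr_plus[of c, symmetric]) (simp add: nn_integral_distr)

lemma nn_integral_lborel_scale:
  fixes f :: "'a::euclidean_space \<Rightarrow> ennreal"
  assumes [measurable]: "f \<in> borel_measurable borel" and "c \<noteq> 0"
  shows "(\<integral>\<^sup>+ x. f x \<partial>lborel) = (\<integral>\<^sup>+ x. ennreal (\<bar>c\<bar> ^ DIM('a)) * f (c *\<^sub>R x) \<partial>lborel)"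
  by (subst (1) lborel_affine[OF assms(2), of 0]) (simp add: nn_integral_density nn_integral_distr)

lemma normal_vec_scale:
  fixes x :: "real ^ 'n"
  assumes "c \<noteq> 0"
  shows "\<bar>c\<bar> ^ CARD('n) * normal_vec \<bar>c\<bar> (c *\<^sub>R x) = normal_vec 1 x"
proof -
  have "\<bar>c\<bar> * normal_density 0 \<bar>c\<bar> (c * t) = std_normal_density t" for t
    using assms by (simp add: normal_density_def real_sqrt_mult power_mult_distrib)
  moreover have "\<bar>c\<bar> ^ CARD('n) = (\<Prod>i\<in>(UNIV::'n set). \<bar>c\<bar>)" by simp
  ultimately show ?thesis
    unfolding normal_vec_def by (simp flip: prod.distrib del: prod_constant)
qed

lemma nn_integral_std_gaussian_scale:
  fixes f :: "real ^ 'n \<Rightarrow> ennreal"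
  assumes [measurable]: "f \<in> borel_measurable borel" and "c \<noteq> 0"
  shows "(\<integral>\<^sup>+ z. f (c *\<^sub>R z) \<partial>std_gaussian) = (\<integral>\<^sup>+ x. ennreal (normal_vec \<bar>c\<bar> x) * f x \<partial>lborel)"
proof -
  have "(\<integral>\<^sup>+ z. f (c *\<^sub>R z) \<partial>std_gaussian) = (\<integral>\<^sup>+ x. ennreal (normal_vec 1 x) * f (c *\<^sub>R x) \<partial>lborel)"
    by (simp add: std_gaussian_normal_vec nn_integral_density)
  also have "\<dots> = (\<integral>\<^sup>+ x. ennreal (\<bar>c\<bar> ^ CARD('n)) * (ennreal (normal_vec \<bar>c\<bar> (c *\<^sub>R x)) * f (c *\<^sub>R x)) \<partial>lborel)"
    by (simp flip: mult.assoc ennreal_mult add: normal_vec_scale[OF assms(2)])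
  also have "\<dots> = (\<integral>\<^sup>+ x. ennreal (normal_vec \<bar>c\<bar> x) * f x \<partial>lborel)"
    using nn_integral_lborel_scale[of "\<lambda>x. ennreal (normal_vec \<bar>c\<bar> x) * f x" c] assms(2) by simp
  finally show ?thesis .
qed

text \<open>Only \<bar>c\<bar> enters the density in the scaling formula, so c = -1 and c = 1 agree.
  This symmetry makes odd integrals vanish and reverses moves in
  \<open>detailed_balance\<close>.\<close>

lemma nn_integral_std_gaussian_uminus:
  fixes f :: "real ^ 'n \<Rightarrow> ennreal"
  assumes [measurable]: "f \<in> borel_measurable borel"
  shows "(\<integral>\<^sup>+ z. f (- z) \<partial>std_gaussian) = (\<integral>\<^sup>+ z. f z \<partial>std_gaussian)"
  using nn_integral_std_gaussian_scale[of f "-1"] nn_integral_std_gaussian_scale[of f 1] by simp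

lemma distr_std_gaussian_uminus: "distr std_gaussian borel uminus = (std_gaussian :: (real ^ 'n) measure)"
  by (rule measure_eqI) (auto simp flip: nn_integral_indicator
      simp: nn_integral_distr nn_integral_std_gaussian_uminus)

lemma integral_std_gaussian_odd:
  fixes f :: "real ^ 'n \<Rightarrow> real"
  assumes [measurable]: "f \<in> borel_measurable borel" and odd: "\<And>z. f (- z) = - f z"
  shows "(\<integral>z. f z \<partial>std_gaussian) = 0"
proof -
  have "(\<integral>z. f z \<partial>std_gaussian) = (\<integral>z. f (- z) \<partial>std_gaussian)"
    by (subst distr_std_gaussian_uminus[symmetric]) (simp add: integral_distr)
  then show ?thesis by (simp add: odd)
qed

lemma normal_vec_conv:
  fixes w :: "real ^ 'n"
  assumes "a > 0" "b > 0"
  shows "(\<integral>\<^sup>+ y. ennreal (normal_vec a (w - y) * normal_vec b y) \<partial>lborel)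
    = ennreal (normal_vec (sqrt (a\<^sup>2 + b\<^sup>2)) w)"
proof -
  have "(\<integral>\<^sup>+ y. ennreal (normal_vec a (w - y) * normal_vec b y) \<partial>lborel)
      = (\<integral>\<^sup>+ y. (\<Prod>i\<in>UNIV. ennreal (normal_density 0 a (w $ i - y $ i) * normal_density 0 b (y $ i))) \<partial>lborel)"
    by (simp add: normal_vec_def prod_ennreal prod.distrib)
  also have "\<dots> = (\<Prod>i\<in>UNIV. \<integral>\<^sup>+ t. ennreal (normal_density 0 a (w $ i - t) * normal_density 0 b t) \<partial>lborel)"
    by (rule nn_integral_lborel_vec_prod) measurable
  also have "\<dots> = (\<Prod>i\<in>UNIV. ennreal (normal_density 0 (sqrt (a\<^sup>2 + b\<^sup>2)) (w $ i)))"
    using fun_cong[OF conv_normal_density_zero_mean[OF assms]] by simp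
  finally show ?thesis by (simp add: normal_vec_def prod_ennreal)
qed

text \<open>After rescaling, the densities of the two independent terms appear; translation and
  Tonelli bring them into the form of a convolution, which \<open>normal_vec_conv\<close> evaluates
  coordinatewise.\<close>

lemma std_gaussian_stable:
  fixes f :: "real ^ 'n \<Rightarrow> ennreal"
  assumes [measurable]: "f \<in> borel_measurable borel" and "a > 0" "b > 0"
  shows "(\<integral>\<^sup>+ z. \<integral>\<^sup>+ w. f (a *\<^sub>R w + b *\<^sub>R z) \<partial>std_gaussian \<partial>std_gaussian)
    = (\<integral>\<^sup>+ z. f (sqrt (a\<^sup>2 + b\<^sup>2) *\<^sub>R z) \<partial>std_gaussian)"
proof -
  interpret S: prob_space "std_gaussian :: (real ^ 'n) measure" by (rule prob_space_std_gaussian)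
  have "(\<integral>\<^sup>+ z. \<integral>\<^sup>+ w. f (a *\<^sub>R w + b *\<^sub>R z) \<partial>std_gaussian \<partial>std_gaussian)
     = (\<integral>\<^sup>+ y. ennreal (normal_vec b y) * (\<integral>\<^sup>+ w. f (a *\<^sub>R w + y) \<partial>std_gaussian) \<partial>lborel)"
    using nn_integral_std_gaussian_scale[of "\<lambda>y. \<integral>\<^sup>+ w. f (a *\<^sub>R w + y) \<partial>std_gaussian" b] assms by simp
  also have "\<dots> = (\<integral>\<^sup>+ y. ennreal (normal_vec b y) * (\<integral>\<^sup>+ x. ennreal (normal_vec a x) * f (x + y) \<partial>lborel) \<partial>lborel)"
    using nn_integral_std_gaussian_scale[of "\<lambda>x. f (x + _)" a] assms by simp
  also have "\<dots> = (\<integral>\<^sup>+ y. ennreal (normal_vec b y) * (\<integral>\<^sup>+ x. ennreal (normal_vec a (x - y)) * f x \<partial>lborel) \<partial>lborel)"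
  proof (intro nn_integral_cong, goal_cases)
    case (1 y)
    show ?case
      using nn_integral_lborel_shift[of "\<lambda>x. ennreal (normal_vec a (x - y)) * f x" y] by (simp add: add.commute)
  qed
  also have "\<dots> = (\<integral>\<^sup>+ y. \<integral>\<^sup>+ x. f x * ennreal (normal_vec a (x - y) * normal_vec b y) \<partial>lborel \<partial>lborel)"
    by (simp add: nn_integral_cmult[symmetric] ennreal_mult mult_ac)
  also have "\<dots> = (\<integral>\<^sup>+ x. \<integral>\<^sup>+ y. f x * ennreal (normal_vec a (x - y) * normal_vec b y) \<partial>lborel \<partial>lborel)"
    by (rule lborel_pair.Fubini') measurable
  also have "\<dots> = (\<integral>\<^sup>+ x. f x * ennreal (normal_vec (sqrt (a\<^sup>2 + b\<^sup>2)) x) \<partial>lborel)"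
    by (simp add: nn_integral_cmult normal_vec_conv[OF assms(2,3)])
  also have "\<dots> = (\<integral>\<^sup>+ z. f (sqrt (a\<^sup>2 + b\<^sup>2) *\<^sub>R z) \<partial>std_gaussian)"
    using nn_integral_std_gaussian_scale[of f "sqrt (a\<^sup>2 + b\<^sup>2)"] assms
    by (simp add: mult.commute abs_of_nonneg sum_power2_eq_zero_iff)
  finally show ?thesis .
qed

section \<open>Couplings and Gaussian convolution\<close>

lemma couplingsI:
  assumes sets: "sets M = sets borel" "sets N = sets borel" "sets Q = sets (borel \<Otimes>\<^sub>M borel)"
    and fst: "\<And>f. f \<in> borel_measurable borel \<Longrightarrow> (\<integral>\<^sup>+ z. f (fst z) \<partial>Q) = (\<integral>\<^sup>+ x. f x \<partial>M)"
    and snd: "\<And>f. f \<in> borel_measurable borel \<Longrightarrow> (\<integral>\<^sup>+ z. f (snd z) \<partial>Q) = (\<integral>\<^sup>+ x. f x \<partial>N)"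
  shows "Q \<in> couplings M N"
proof -
  note [measurable_cong] = sets
  have "distr Q M fst = M"
  proof (rule measure_eqI)
    fix A assume "A \<in> sets (distr Q M fst)"
    then have A [measurable]: "A \<in> sets borel" using sets by simp
    have "emeasure (distr Q M fst) A = (\<integral>\<^sup>+ z. indicator A z \<partial>distr Q M fst)"
      using A sets by simp
    also have "\<dots> = (\<integral>\<^sup>+ z. indicator A (fst z) \<partial>Q)"
      by (rule nn_integral_distr) measurable
    finally show "emeasure (distr Q M fst) A = emeasure M A"
      using A sets by (simp add: fst)
  qed simp
  moreover have "distr Q N snd = N"
  proof (rule measure_eqI)
    fix A assume "A \<in> sets (distr Q N snd)"
    then have A [measurable]: "A \<in> sets borel" using sets by simp
    have "emeasure (distr Q N snd) A = (\<integral>\<^sup>+ z. indicator A z \<partial>distr Q N snd)"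
      using A sets by simp
    also have "\<dots> = (\<integral>\<^sup>+ z. indicator A (snd z) \<partial>Q)"
      by (rule nn_integral_distr) measurable
    finally show "emeasure (distr Q N snd) A = emeasure N A"
      using A sets by (simp add: snd)
  qed simp
  moreover have "sets Q = sets (M \<Otimes>\<^sub>M N)"
    using sets sets_pair_measure_cong[OF sets(1,2)] by simp
  ultimately show ?thesis by (simp add: couplings_def)
qed

context
  fixes Q :: "('a::second_countable_topology \<times> 'a) measure" and M N :: "'a measure"
  assumes Q: "Q \<in> couplings M N" and sM: "sets M = sets borel" and sN: "sets N = sets borel"
begin

lemma sets_coupling: "sets Q = sets (borel \<Otimes>\<^sub>M borel)"
  using Q sets_pair_measure_cong[OF sM sN] by (simp add: couplings_def)

lemma measurable_coupling_fst: "fst \<in> Q \<rightarrow>\<^sub>M M"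
  using measurable_cong_sets[OF sets_coupling sM] by simp

lemma measurable_coupling_snd: "snd \<in> Q \<rightarrow>\<^sub>M N"
  using measurable_cong_sets[OF sets_coupling sN] by simp

lemma distr_coupling: "distr Q M fst = M" "distr Q N snd = N"
  using Q by (auto simp: couplings_def)

lemma nn_integral_coupling_fst:
  "f \<in> borel_measurable borel \<Longrightarrow> (\<integral>\<^sup>+ z. f (fst z) \<partial>Q) = (\<integral>\<^sup>+ x. f x \<partial>M)"
  by (subst distr_coupling(1)[symmetric], subst nn_integral_distr)
     (simp_all add: measurable_coupling_fst measurable_cong_sets[OF sM])

lemma nn_integral_coupling_snd:
  "f \<in> borel_measurable borel \<Longrightarrow> (\<integral>\<^sup>+ z. f (snd z) \<partial>Q) = (\<integral>\<^sup>+ x. f x \<partial>N)"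
  by (subst distr_coupling(2)[symmetric], subst nn_integral_distr)
     (simp_all add: measurable_coupling_snd measurable_cong_sets[OF sN])

lemma integrable_coupling_fst: "integrable M (f :: _ \<Rightarrow> real) \<Longrightarrow> integrable Q (\<lambda>z. f (fst z))"
  using integrable_distr[OF measurable_coupling_fst, of f] distr_coupling(1) by simp

lemma integrable_coupling_snd: "integrable N (f :: _ \<Rightarrow> real) \<Longrightarrow> integrable Q (\<lambda>z. f (snd z))"
  using integrable_distr[OF measurable_coupling_snd, of f] distr_coupling(2) by simp

lemma integral_coupling_fst:
  "integrable M (f :: _ \<Rightarrow> real) \<Longrightarrow> (\<integral>z. f (fst z) \<partial>Q) = (\<integral>x. f x \<partial>M)"
  using integral_distr[OF measurable_coupling_fst, of f] distr_coupling(1) by simp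

lemma integral_coupling_snd:
  "integrable N (f :: _ \<Rightarrow> real) \<Longrightarrow> (\<integral>z. f (snd z) \<partial>Q) = (\<integral>x. f x \<partial>N)"
  using integral_distr[OF measurable_coupling_snd, of f] distr_coupling(2) by simp

lemma prob_space_coupling: "prob_space M \<Longrightarrow> prob_space Q"
proof
  assume "prob_space M"
  then have "emeasure M (space M) = 1" by (rule prob_space.emeasure_space_1)
  then show "emeasure Q (space Q) = 1"
    using nn_integral_coupling_fst[of "\<lambda>_. 1"] by simp
qed

end

text \<open>The law of X + s Z with X of law \<mu> and Z an independent standard Gaussian: the heat
  flow started at \<mu>, after time s^2 / 2. The noise of the algorithm is the case s = sqrt (2
  h).\<close>

definition gauss_conv :: "(real ^ 'n) measure \<Rightarrow> real \<Rightarrow> (real ^ 'n) measure" where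
  "gauss_conv \<mu> s = distr (\<mu> \<Otimes>\<^sub>M std_gaussian) borel (\<lambda>(x, z). x + s *\<^sub>R z)"

lemma sets_gauss_conv [measurable_cong, simp]: "sets (gauss_conv \<mu> s) = sets borel"
  by (simp add: gauss_conv_def)

lemma nn_integral_gauss_conv:
  assumes [measurable_cong]: "sets \<mu> = sets borel" and [measurable]: "f \<in> borel_measurable borel"
  shows "(\<integral>\<^sup>+ x. f x \<partial>gauss_conv \<mu> s) = (\<integral>\<^sup>+ x. \<integral>\<^sup>+ z. f (x + s *\<^sub>R z) \<partial>std_gaussian \<partial>\<mu>)"
proof -
  interpret prob_space "std_gaussian :: (real ^ 'n) measure" by (rule prob_space_std_gaussian)
  have "(\<integral>\<^sup>+ x. f x \<partial>gauss_conv \<mu> s) = (\<integral>\<^sup>+ w. f (fst w + s *\<^sub>R snd w) \<partial>(\<mu> \<Otimes>\<^sub>M std_gaussian))"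
    unfolding gauss_conv_def by (subst nn_integral_distr) (auto simp: case_prod_beta)
  also have "\<dots> = (\<integral>\<^sup>+ x. \<integral>\<^sup>+ z. f (x + s *\<^sub>R z) \<partial>std_gaussian \<partial>\<mu>)"
    by (subst nn_integral_fst[symmetric]) auto
  finally show ?thesis .
qed

lemma prob_space_gauss_conv:
  assumes "prob_space \<mu>" and [measurable_cong]: "sets \<mu> = sets borel"
  shows "prob_space (gauss_conv \<mu> s)"
proof -
  interpret pair_prob_space \<mu> "std_gaussian :: (real ^ 'n) measure"
    by (intro pair_prob_space.intro pair_sigma_finite.intro prob_space_imp_sigma_finite assms
        prob_space_std_gaussian)
  show ?thesis unfolding gauss_conv_def by (intro prob_space_distr) measurable
qed

lemma measure_eqI_nn_integral:
  assumes "sets M = sets borel" "sets N = sets borel"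
    and "\<And>f. f \<in> borel_measurable borel \<Longrightarrow> (\<integral>\<^sup>+ x. f x \<partial>M) = (\<integral>\<^sup>+ x. f x \<partial>N)"
  shows "M = N"
proof (rule measure_eqI)
  fix A assume "A \<in> sets M"
  then show "emeasure M A = emeasure N A"
    using assms(3)[of "indicator A"] assms(1,2) by simp
qed (simp add: assms)

text \<open>The semigroup property of the heat flow: variances add. It lets many small moves
  recombine into one increment of the algorithm.\<close>

lemma gauss_conv_gauss_conv:
  fixes \<mu> :: "(real ^ 'n) measure"
  assumes [measurable_cong]: "sets \<mu> = sets borel" and "a > 0" "b > 0"
  shows "gauss_conv (gauss_conv \<mu> b) a = gauss_conv \<mu> (sqrt (a\<^sup>2 + b\<^sup>2))"
proof (rule measure_eqI_nn_integral)
  interpret S: prob_space "std_gaussian :: (real ^ 'n) measure" by (rule prob_space_std_gaussian)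
  fix f :: "real ^ 'n \<Rightarrow> ennreal" assume [measurable]: "f \<in> borel_measurable borel"
  have "(\<integral>\<^sup>+ z. \<integral>\<^sup>+ w. f (x + b *\<^sub>R z + a *\<^sub>R w) \<partial>std_gaussian \<partial>std_gaussian)
     = (\<integral>\<^sup>+ z. f (x + sqrt (a\<^sup>2 + b\<^sup>2) *\<^sub>R z) \<partial>std_gaussian)" for x
    using std_gaussian_stable[of "\<lambda>v. f (x + v)" a b] assms(2,3) by (simp add: add_ac)
  then show "(\<integral>\<^sup>+ x. f x \<partial>gauss_conv (gauss_conv \<mu> b) a) = (\<integral>\<^sup>+ x. f x \<partial>gauss_conv \<mu> (sqrt (a\<^sup>2 + b\<^sup>2)))"
    by (simp add: nn_integral_gauss_conv assms(1))
qed simp_all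

section \<open>Elementary estimates for the rejection probability\<close>

lemma one_minus_exp_ge: "t - t\<^sup>2 / 2 \<le> 1 - exp (- t)" if "t \<ge> 0" for t :: real
proof -
  \<comment> \<open>The goal amounts to exp (- t) \<le> 1 - t + t^2 / 2. The second factor is the
    Taylor minorant of exp t, so it suffices that the product is at least 1.\<close>
  have "(1 - t + t\<^sup>2 / 2) * (1 + t + t\<^sup>2 / 2) = 1 + t ^ 4 / 4"
    by (simp add: algebra_simps power2_eq_square power4_eq_xxxx)
  then have 1: "1 \<le> (1 - t + t\<^sup>2 / 2) * (1 + t + t\<^sup>2 / 2)" by simp
  have "0 \<le> (1 - t)\<^sup>2" by simp
  then have "0 \<le> 1 - t + t\<^sup>2 / 2" unfolding power2_diff by simp
  then have "(1 - t + t\<^sup>2 / 2) * (1 + t + t\<^sup>2 / 2) \<le> (1 - t + t\<^sup>2 / 2) * exp t"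
    using exp_lower_Taylor_quadratic[OF that] by (intro mult_left_mono) auto
  with 1 have "1 \<le> (1 - t + t\<^sup>2 / 2) * exp t" by linarith
  then have "exp (- t) \<le> 1 - t + t\<^sup>2 / 2" by (simp add: exp_minus field_simps)
  then show ?thesis by simp
qed

text \<open>Here d is meant as the change of the potential under a proposal and t as its
  linearization, so that the rejection probability is compared with its leading part. The upper
  estimate is linear; the quadratic term pays for the lower one.\<close>

lemma rejection_estimate:
  fixes d t :: real
  shows "\<bar>(1 - min 1 (exp (- d))) - max 0 t\<bar> \<le> \<bar>d - t\<bar> + t\<^sup>2 / 2"
proof -
  have up: "1 - min 1 (exp (- d)) \<le> max 0 d"
    using exp_ge_add_one_self[of "- d"] by (auto simp: min_def max_def)
  have t2: "0 \<le> t\<^sup>2" by simp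
  have lo: "max 0 t - \<bar>d - t\<bar> - t\<^sup>2 / 2 \<le> 1 - min 1 (exp (- d))"
  proof (cases "0 < d \<and> 0 < t")
    case False
    have "0 \<le> 1 - min 1 (exp (- d))" by simp
    moreover have "max 0 t - \<bar>d - t\<bar> \<le> 0" using False by auto
    ultimately show ?thesis using t2 by linarith
  next
    case True
    then have eq: "1 - min 1 (exp (- d)) = 1 - exp (- d)" by (simp add: min_def)
    show ?thesis
    proof (cases "t \<le> d")
      case le: True
      then have "1 - exp (- t) \<le> 1 - exp (- d)" by simp
      moreover have "max 0 t = t" using True by simp
      ultimately show ?thesis using one_minus_exp_ge[of t] True eq abs_ge_zero[of "d - t"] by linarith
    next
      \<comment> \<open>Now d < t. The Taylor bound is taken at d, and d^2 \<le> t^2 keeps the error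
        in terms of t.\<close>
      case False
      then have "d\<^sup>2 \<le> t\<^sup>2" using True by (intro power_mono) auto
      moreover have "max 0 t = t" using True by simp
      ultimately show ?thesis using one_minus_exp_ge[of d] True False eq by linarith
    qed
  qed
  have "max 0 d \<le> max 0 t + \<bar>d - t\<bar>" by auto
  with up lo t2 show ?thesis by linarith
qed

section \<open>Metropolis moves\<close>

text \<open>Kept apart from \<open>smooth_potential\<close> because it must also cover the target
  \<open>gibbs f\<close>, for which neither strong convexity nor a fourth moment is assumed.\<close>

locale integrable_potential =
  fixes U :: "real ^ 'n \<Rightarrow> real"
  assumes measurable_U [measurable]: "U \<in> borel_measurable borel"
    and integrable_exp: "integrable lborel (\<lambda>x. exp (- U x))"
begin

definition Z :: real where "Z = (\<integral>v. exp (- U v) \<partial>lborel)"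

lemma Z_pos: "0 < Z"
proof -
  have "0 \<le> Z" unfolding Z_def by simp
  moreover have "Z \<noteq> 0"
  proof
    assume "Z = 0"
    then have "AE x in (lborel :: (real ^ 'n) measure). exp (- U x) = 0"
      unfolding Z_def using integrable_exp by (subst (asm) integral_nonneg_eq_0_iff_AE) auto
    then have "AE x in (lborel :: (real ^ 'n) measure). False" by simp
    then show False by (simp add: AE_iff_null null_sets_def emeasure_lborel_UNIV)
  qed
  ultimately show ?thesis by simp
qed

lemma gibbs_eq: "gibbs U = density lborel (\<lambda>x. ennreal (exp (- U x) / Z))"
  by (simp add: gibbs_def Z_def)

lemma sets_gibbs [measurable_cong, simp]: "sets (gibbs U) = sets borel"
  by (simp add: gibbs_def)

lemma nn_integral_gibbs:
  "f \<in> borel_measurable borel \<Longrightarrow> (\<integral>\<^sup>+ x. f x \<partial>gibbs U) = (\<integral>\<^sup>+ x. ennreal (exp (- U x) / Z) * f x \<partial>lborel)"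
  unfolding gibbs_eq by (subst nn_integral_density) auto

lemma integrable_gibbs_iff:
  "f \<in> borel_measurable borel \<Longrightarrow>
   integrable (gibbs U) (f :: _ \<Rightarrow> real) \<longleftrightarrow> integrable lborel (\<lambda>x. exp (- U x) * f x)"
proof -
  assume [measurable]: "f \<in> borel_measurable borel"
  have "integrable (gibbs U) f \<longleftrightarrow> integrable lborel (\<lambda>x. (1 / Z) * (exp (- U x) * f x))"
    unfolding gibbs_eq using Z_pos by (subst integrable_density) auto
  then show ?thesis using Z_pos by (simp del: times_divide_eq_left)
qed

lemma prob_space_gibbs: "prob_space (gibbs U)"
proof
  have "emeasure (gibbs U) (space (gibbs U)) = (\<integral>\<^sup>+ x. ennreal (exp (- U x) / Z) \<partial>lborel)"
    using nn_integral_gibbs[of "\<lambda>_. 1"] by simp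
  also have "\<dots> = ennreal (\<integral>x. exp (- U x) / Z \<partial>lborel)"
    using integrable_exp Z_pos by (intro nn_integral_eq_integral) auto
  also have "\<dots> = 1" using Z_pos by (simp add: Z_def)
  finally show "emeasure (gibbs U) (space (gibbs U)) = 1" .
qed

end

text \<open>The fourth moment is there because the local error contains |x - y| |G y|^2, which is
  split into squares and thus produces |G y|^4. The constant \<open>m\<close> is the strong
  convexity modulus, equal to \<alpha> in the application.\<close>

locale smooth_potential = integrable_potential U for U :: "real ^ 'n \<Rightarrow> real" +
  fixes G :: "real ^ 'n \<Rightarrow> real ^ 'n" and L m :: real
  assumes grad: "\<And>x. GDERIV U x :> G x"
    and lip: "\<And>x y. norm (G x - G y) \<le> L * norm (x - y)"
    and strong: "\<And>x y. U y \<ge> U x + G x \<bullet> (y - x) + m / 2 * (norm (y - x))\<^sup>2"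
    and m_pos: "0 < m"
    and integrable_exp4: "integrable lborel (\<lambda>x. exp (- U x) * norm x ^ 4)"
begin

lemma above_tangent: "U y \<ge> U x + G x \<bullet> (y - x)"
proof -
  have "0 \<le> m / 2 * (norm (y - x))\<^sup>2" using m_pos by simp
  then show ?thesis using strong[of x y] by linarith
qed

lemmas descent = descent_lemma[OF grad lip]

lemma m_le_L: "m \<le> L"
proof -
  define v :: "real ^ 'n" where "v = axis undefined 1"
  have "norm v = 1" by (simp add: v_def norm_axis_1)
  then show ?thesis using descent[of 0 v] strong[of 0 v] by simp
qed

lemma L_pos: "0 < L"
  using m_le_L m_pos by linarith

lemma linearization_error: "\<bar>U (y + v) - U y - G y \<bullet> v\<bar> \<le> L / 2 * (norm v)\<^sup>2"
  using descent[of y v] above_tangent[of y "y + v"] L_pos by (auto simp: abs_if)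

lemma lipschitz_G: "L-lipschitz_on UNIV G"
  using lip L_pos by (auto simp: lipschitz_on_def dist_norm)

lemma measurable_G [measurable]: "G \<in> borel_measurable borel"
  using lipschitz_on_continuous_on[OF lipschitz_G] by (rule borel_measurable_continuous_onI)

lemma gibbs_norm_pow:
  assumes "k \<le> 4"
  shows "integrable (gibbs U) (\<lambda>x. norm x ^ k)"
proof -
  interpret prob_space "gibbs U" by (rule prob_space_gibbs)
  have 4: "integrable (gibbs U) (\<lambda>x. 1 + norm x ^ 4)"
    using integrable_exp4 by (intro Bochner_Integration.integrable_add) (auto simp: integrable_gibbs_iff)
  show ?thesis
  proof (rule Bochner_Integration.integrable_bound[OF 4])
    have "norm x ^ k \<le> 1 + norm x ^ 4" for x :: "real ^ 'n"
    proof (cases "norm x \<le> 1")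
      case True
      have "norm x ^ k \<le> 1" by (rule power_le_one) (use True in auto)
      moreover have "0 \<le> norm x ^ 4" by simp
      ultimately show ?thesis by linarith
    next
      case False
      then have "norm x ^ k \<le> norm x ^ 4" by (intro power_increasing assms) auto
      then show ?thesis by simp
    qed
    then show "AE x in gibbs U. norm (norm x ^ k) \<le> norm (1 + norm x ^ 4)"
      by (intro AE_I2) simp
  qed measurable
qed

lemma U_growth: "\<bar>U x\<bar> \<le> \<bar>U 0\<bar> + norm (G 0) + (norm (G 0) + L) * (norm x)\<^sup>2"
proof -
  have "\<bar>U x\<bar> \<le> \<bar>U 0\<bar> + \<bar>G 0 \<bullet> x\<bar> + L / 2 * (norm x)\<^sup>2"
    using linearization_error[of 0 x] unfolding add_0 by linarith
  moreover have "\<bar>G 0 \<bullet> x\<bar> \<le> norm (G 0) * norm x" by (rule Cauchy_Schwarz_ineq2)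
  moreover have "norm (G 0) * norm x \<le> norm (G 0) * (1 + (norm x)\<^sup>2)"
  proof (rule mult_left_mono)
    have "0 \<le> (norm x - 1)\<^sup>2" "0 \<le> (norm x)\<^sup>2" by simp_all
    then show "norm x \<le> 1 + (norm x)\<^sup>2" using norm_ge_zero[of x] unfolding power2_diff power_one by linarith
  qed simp
  moreover have "L / 2 * (norm x)\<^sup>2 \<le> L * (norm x)\<^sup>2" using L_pos by simp
  ultimately show ?thesis by (simp add: algebra_simps)
qed

lemma integrable_U:
  assumes "prob_space \<mu>" and [measurable_cong]: "sets \<mu> = sets borel"
    and "integrable \<mu> (\<lambda>x. (norm x)\<^sup>2)"
  shows "integrable \<mu> U"
proof (rule Bochner_Integration.integrable_bound)
  interpret prob_space \<mu> by fact
  show "integrable \<mu> (\<lambda>x. \<bar>U 0\<bar> + norm (G 0) + (norm (G 0) + L) * (norm x)\<^sup>2)"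
    using assms(3) by auto
  show "AE x in \<mu>. norm (U x) \<le> norm (\<bar>U 0\<bar> + norm (G 0) + (norm (G 0) + L) * (norm x)\<^sup>2)"
    using U_growth by (intro AE_I2) (smt (verit) real_norm_def)
qed measurable

definition acc :: "real \<Rightarrow> real ^ 'n \<Rightarrow> real ^ 'n \<Rightarrow> real" where
  "acc s y z = min 1 (exp (U y - U (y + s *\<^sub>R z)))"

lemma acc_bounds: "0 \<le> acc s y z" "acc s y z \<le> 1"
  by (auto simp: acc_def)

lemma measurable_acc [measurable]:
  "(\<lambda>(y, z). acc s y z) \<in> borel_measurable (borel \<Otimes>\<^sub>M borel)"
  unfolding acc_def by measurable

text \<open>The product \<open>exp (- U y) * acc s y z\<close> is the minimum of two weights and hence symmetric under
  exchanging the start and end points of the move.\<close>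

lemma detailed_balance:
  assumes [measurable]: "\<phi> \<in> borel_measurable borel"
  shows "(\<integral>\<^sup>+ y. \<integral>\<^sup>+ z. ennreal (acc s y z) * \<phi> (y + s *\<^sub>R z) \<partial>std_gaussian \<partial>gibbs U)
       = (\<integral>\<^sup>+ y. \<integral>\<^sup>+ z. ennreal (acc s y z) * \<phi> y \<partial>std_gaussian \<partial>gibbs U)"
proof -
  interpret S: prob_space "std_gaussian :: (real ^ 'n) measure" by (rule prob_space_std_gaussian)
  interpret S: sigma_finite_measure "std_gaussian :: (real ^ 'n) measure" by (rule S.sigma_finite_measure_axioms)
  interpret P: pair_sigma_finite "lborel :: (real ^ 'n) measure" "std_gaussian :: (real ^ 'n) measure" ..
  let ?w = "\<lambda>y z. ennreal (min (exp (- U y)) (exp (- U (y + s *\<^sub>R z))) / Z)"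
  have w: "ennreal (exp (- U y) / Z) * ennreal (acc s y z) = ?w y z" for y z
  proof -
    have "exp (- U y) * acc s y z = min (exp (- U y)) (exp (- U (y + s *\<^sub>R z)))"
      by (auto simp: acc_def min_def exp_diff exp_minus field_simps)
    then show ?thesis using Z_pos acc_bounds[of s y z] by (simp flip: ennreal_mult)
  qed
  have swap: "(\<integral>\<^sup>+ y. \<integral>\<^sup>+ z. ennreal (acc s y z) * \<psi> y z \<partial>std_gaussian \<partial>gibbs U)
     = (\<integral>\<^sup>+ z. \<integral>\<^sup>+ y. ?w y z * \<psi> y z \<partial>lborel \<partial>std_gaussian)"
    if [measurable]: "(\<lambda>(y, z). \<psi> y z) \<in> borel_measurable (borel \<Otimes>\<^sub>M borel)" for \<psi>
  proof -
    have "(\<integral>\<^sup>+ y. \<integral>\<^sup>+ z. ennreal (acc s y z) * \<psi> y z \<partial>std_gaussian \<partial>gibbs U)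
       = (\<integral>\<^sup>+ y. \<integral>\<^sup>+ z. ?w y z * \<psi> y z \<partial>std_gaussian \<partial>lborel)"
      by (subst nn_integral_gibbs) (auto simp flip: nn_integral_cmult w simp: mult.assoc)
    also have "\<dots> = (\<integral>\<^sup>+ z. \<integral>\<^sup>+ y. ?w y z * \<psi> y z \<partial>lborel \<partial>std_gaussian)"
      by (rule P.Fubini'[symmetric]) measurable
    finally show ?thesis .
  qed
  have "(\<integral>\<^sup>+ y. \<integral>\<^sup>+ z. ennreal (acc s y z) * \<phi> (y + s *\<^sub>R z) \<partial>std_gaussian \<partial>gibbs U)
     = (\<integral>\<^sup>+ z. \<integral>\<^sup>+ y. ?w y z * \<phi> (y + s *\<^sub>R z) \<partial>lborel \<partial>std_gaussian)"
    by (rule swap) measurable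
  \<comment> \<open>Translating y by s z swaps the arguments of the minimum and turns the move z
    into - z; the reflection symmetry of the Gaussian then removes the sign.\<close>
  also have "\<dots> = (\<integral>\<^sup>+ z. \<integral>\<^sup>+ y. ?w y (- z) * \<phi> y \<partial>lborel \<partial>std_gaussian)"
  proof (rule nn_integral_cong, goal_cases)
    case (1 z)
    show ?case
      using nn_integral_lborel_shift[of "\<lambda>y. ?w (y - s *\<^sub>R z) z * \<phi> y" "s *\<^sub>R z"]
      by (simp add: min.commute add.commute)
  qed
  also have "\<dots> = (\<integral>\<^sup>+ z. \<integral>\<^sup>+ y. ?w y z * \<phi> y \<partial>lborel \<partial>std_gaussian)"
    by (rule nn_integral_std_gaussian_uminus[of "\<lambda>z. \<integral>\<^sup>+ y. ?w y z * \<phi> y \<partial>lborel"]) measurable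
  also have "\<dots> = (\<integral>\<^sup>+ y. \<integral>\<^sup>+ z. ennreal (acc s y z) * \<phi> y \<partial>std_gaussian \<partial>gibbs U)"
    by (rule swap[symmetric]) measurable
  finally show ?thesis .
qed

text \<open>The Boolean is the acceptance coin, realized by a density with respect to counting
  measure. Both points share the increment z and only the second may be stopped, so x - y is
  unchanged on acceptance and becomes x - y + s z on rejection.\<close>

definition metropolis :: "real \<Rightarrow> ((real ^ 'n) \<times> (real ^ 'n)) measure \<Rightarrow> ((real ^ 'n) \<times> (real ^ 'n)) measure" where
  "metropolis s Q =
     distr (density (Q \<Otimes>\<^sub>M (std_gaussian \<Otimes>\<^sub>M count_space UNIV))
             (\<lambda>((x, y), (z, b)). ennreal (if b then acc s y z else 1 - acc s y z)))
       (borel \<Otimes>\<^sub>M borel)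
       (\<lambda>((x, y), (z, b)). (x + s *\<^sub>R z, if b then y + s *\<^sub>R z else y))"

lemma nn_integral_metropolis:
  assumes [measurable_cong]: "sets Q = sets (borel \<Otimes>\<^sub>M borel)"
    and [measurable]: "\<phi> \<in> borel_measurable (borel \<Otimes>\<^sub>M borel)"
  shows "(\<integral>\<^sup>+ w. \<phi> w \<partial>metropolis s Q)
    = (\<integral>\<^sup>+ w. \<integral>\<^sup>+ z. ennreal (acc s (snd w) z) * \<phi> (fst w + s *\<^sub>R z, snd w + s *\<^sub>R z)
         + ennreal (1 - acc s (snd w) z) * \<phi> (fst w + s *\<^sub>R z, snd w) \<partial>std_gaussian \<partial>Q)"
proof -
  let ?B = "count_space (UNIV :: bool set)"
  interpret S: prob_space "std_gaussian :: (real ^ 'n) measure" by (rule prob_space_std_gaussian)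
  interpret B: sigma_finite_measure ?B by (rule sigma_finite_measure_count_space_finite) simp
  interpret SB: pair_sigma_finite "std_gaussian :: (real ^ 'n) measure" ?B ..
  interpret SB: sigma_finite_measure "(std_gaussian :: (real ^ 'n) measure) \<Otimes>\<^sub>M ?B"
    by (rule SB.sigma_finite_measure_axioms)
  let ?g = "\<lambda>w z b. ennreal (if b then acc s (snd w) z else 1 - acc s (snd w) z)
      * \<phi> (fst w + s *\<^sub>R z, if b then snd w + s *\<^sub>R z else snd w)"
  have "(\<integral>\<^sup>+ w. \<phi> w \<partial>metropolis s Q)
     = (\<integral>\<^sup>+ v. ?g (fst v) (fst (snd v)) (snd (snd v)) \<partial>(Q \<Otimes>\<^sub>M (std_gaussian \<Otimes>\<^sub>M ?B)))"
    unfolding metropolis_def case_prod_beta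
    by (subst nn_integral_distr, measurable, subst nn_integral_density, measurable)
  also have "\<dots> = (\<integral>\<^sup>+ w. \<integral>\<^sup>+ zb. ?g w (fst zb) (snd zb) \<partial>(std_gaussian \<Otimes>\<^sub>M ?B) \<partial>Q)"
    by (subst SB.nn_integral_fst[symmetric]) (auto cong: if_cong)
  also have "\<dots> = (\<integral>\<^sup>+ w. \<integral>\<^sup>+ z. \<integral>\<^sup>+ b. ?g w z b \<partial>?B \<partial>std_gaussian \<partial>Q)"
    by (intro nn_integral_cong, subst B.nn_integral_fst[symmetric]) (auto cong: if_cong)
  finally show ?thesis
    by (simp add: nn_integral_count_space_finite UNIV_bool add.commute)
qed

text \<open>For the first point the two weights of the coin add up to one, which leaves a pure
  Gaussian move. For the second, detailed balance replaces the accepted end points by their starting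
  points, so \<open>gibbs U\<close> is invariant without error.\<close>

lemma metropolis_coupling:
  assumes Q: "Q \<in> couplings \<mu> (gibbs U)" and sets_mu [measurable_cong]: "sets \<mu> = sets borel"
  shows "metropolis s Q \<in> couplings (gauss_conv \<mu> s) (gibbs U)"
proof (rule couplingsI)
  interpret S: prob_space "std_gaussian :: (real ^ 'n) measure" by (rule prob_space_std_gaussian)
  note sQ [measurable_cong] = sets_coupling[OF Q sets_mu sets_gibbs]
  have acc1: "ennreal (acc s y z) * c + ennreal (1 - acc s y z) * c = c" for y z c
    using acc_bounds[of s y z] by (simp flip: distrib_right ennreal_plus)
  fix f :: "real ^ 'n \<Rightarrow> ennreal" assume f [measurable]: "f \<in> borel_measurable borel"
  have "(\<integral>\<^sup>+ w. f (fst w) \<partial>metropolis s Q) = (\<integral>\<^sup>+ w. \<integral>\<^sup>+ z. f (fst w + s *\<^sub>R z) \<partial>std_gaussian \<partial>Q)"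
    by (subst nn_integral_metropolis[OF sQ]) (auto simp: acc1)
  also have "\<dots> = (\<integral>\<^sup>+ x. \<integral>\<^sup>+ z. f (x + s *\<^sub>R z) \<partial>std_gaussian \<partial>\<mu>)"
    by (rule nn_integral_coupling_fst[OF Q sets_mu sets_gibbs, of "\<lambda>x. \<integral>\<^sup>+ z. f (x + s *\<^sub>R z) \<partial>std_gaussian"]) measurable
  also have "\<dots> = (\<integral>\<^sup>+ x. f x \<partial>gauss_conv \<mu> s)"
    by (simp add: nn_integral_gauss_conv[OF sets_mu f])
  finally show "(\<integral>\<^sup>+ w. f (fst w) \<partial>metropolis s Q) = (\<integral>\<^sup>+ x. f x \<partial>gauss_conv \<mu> s)" .
  have "(\<integral>\<^sup>+ w. f (snd w) \<partial>metropolis s Q)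
     = (\<integral>\<^sup>+ w. \<integral>\<^sup>+ z. ennreal (acc s (snd w) z) * f (snd w + s *\<^sub>R z)
         + ennreal (1 - acc s (snd w) z) * f (snd w) \<partial>std_gaussian \<partial>Q)"
    by (subst nn_integral_metropolis[OF sQ]) auto
  also have "\<dots> = (\<integral>\<^sup>+ y. \<integral>\<^sup>+ z. ennreal (acc s y z) * f (y + s *\<^sub>R z)
         + ennreal (1 - acc s y z) * f y \<partial>std_gaussian \<partial>gibbs U)"
    by (rule nn_integral_coupling_snd[OF Q sets_mu sets_gibbs, of "\<lambda>y. \<integral>\<^sup>+ z. ennreal (acc s y z) * f (y + s *\<^sub>R z)
         + ennreal (1 - acc s y z) * f y \<partial>std_gaussian"]) measurable
  also have "\<dots> = (\<integral>\<^sup>+ y. \<integral>\<^sup>+ z. ennreal (acc s y z) * f (y + s *\<^sub>R z) \<partial>std_gaussian \<partial>gibbs U)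
         + (\<integral>\<^sup>+ y. \<integral>\<^sup>+ z. ennreal (1 - acc s y z) * f y \<partial>std_gaussian \<partial>gibbs U)"
    by (simp add: nn_integral_add)
  also have "\<dots> = (\<integral>\<^sup>+ y. \<integral>\<^sup>+ z. ennreal (acc s y z) * f y \<partial>std_gaussian \<partial>gibbs U)
         + (\<integral>\<^sup>+ y. \<integral>\<^sup>+ z. ennreal (1 - acc s y z) * f y \<partial>std_gaussian \<partial>gibbs U)"
    by (simp only: detailed_balance[OF f])
  also have "\<dots> = (\<integral>\<^sup>+ y. \<integral>\<^sup>+ z. ennreal (acc s y z) * f y + ennreal (1 - acc s y z) * f y \<partial>std_gaussian \<partial>gibbs U)"
    by (simp add: nn_integral_add)
  also have "\<dots> = (\<integral>\<^sup>+ y. f y \<partial>gibbs U)" by (simp add: acc1 S.emeasure_space_1[simplified])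
  finally show "(\<integral>\<^sup>+ w. f (snd w) \<partial>metropolis s Q) = (\<integral>\<^sup>+ y. f y \<partial>gibbs U)" .
qed (auto simp: metropolis_def)

end

section \<open>Cost of one small step\<close>

lemma integrable_std_gaussian_inner: "integrable std_gaussian (\<lambda>z. v \<bullet> z)" for v :: "real ^ 'n"
proof (rule Bochner_Integration.integrable_bound)
  show "integrable (std_gaussian :: (real ^ 'n) measure) (\<lambda>z. norm v * norm z)"
    using std_gaussian_norm_pow[of 1, where 'n='n] by simp
  show "AE z in std_gaussian. norm (v \<bullet> z) \<le> norm (norm v * norm z)"
    by (intro AE_I2) (simp add: Cauchy_Schwarz_ineq2)
qed measurable

lemma integral_std_gaussian_inner: "(\<integral>z. v \<bullet> z \<partial>std_gaussian) = 0" for v :: "real ^ 'n"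
  by (rule integral_std_gaussian_odd) simp_all

lemma std_gaussian_shift_norm_sq:
  fixes x :: "real ^ 'n"
  shows "integrable std_gaussian (\<lambda>z. (norm (x + s *\<^sub>R z))\<^sup>2)"
    and "(\<integral>z. (norm (x + s *\<^sub>R z))\<^sup>2 \<partial>std_gaussian) = (norm x)\<^sup>2 + s\<^sup>2 * CARD('n)"
proof -
  interpret S: prob_space "std_gaussian :: (real ^ 'n) measure" by (rule prob_space_std_gaussian)
  have *: "(norm (x + s *\<^sub>R z))\<^sup>2 = (norm x)\<^sup>2 + (2 * s) * (x \<bullet> z) + s\<^sup>2 * (norm z)\<^sup>2" for z
    unfolding power2_norm_eq_inner
    by (simp add: inner_add_left inner_add_right inner_commute power2_eq_square)
  show "integrable std_gaussian (\<lambda>z. (norm (x + s *\<^sub>R z))\<^sup>2)"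
    unfolding * using std_gaussian_norm_sq(1) integrable_std_gaussian_inner[of x]
    by (intro Bochner_Integration.integrable_add) auto
  show "(\<integral>z. (norm (x + s *\<^sub>R z))\<^sup>2 \<partial>std_gaussian) = (norm x)\<^sup>2 + s\<^sup>2 * CARD('n)"
    unfolding * using std_gaussian_norm_sq[where 'n='n] integrable_std_gaussian_inner[of x]
    by (simp add: integral_std_gaussian_inner S.prob_space[simplified])
qed

lemma gauss_conv_second_moment:
  fixes \<mu> :: "(real ^ 'n) measure"
  assumes "prob_space \<mu>" and sets [measurable_cong]: "sets \<mu> = sets borel"
    and int: "integrable \<mu> (\<lambda>x. (norm x)\<^sup>2)"
  shows "integrable (gauss_conv \<mu> s) (\<lambda>x. (norm x)\<^sup>2)"
    and "(\<integral>x. (norm x)\<^sup>2 \<partial>gauss_conv \<mu> s) = (\<integral>x. (norm x)\<^sup>2 \<partial>\<mu>) + s\<^sup>2 * CARD('n)"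
proof -
  interpret prob_space \<mu> by fact
  have "(\<integral>\<^sup>+ x. ennreal ((norm x)\<^sup>2) \<partial>gauss_conv \<mu> s)
      = (\<integral>\<^sup>+ x. \<integral>\<^sup>+ z. ennreal ((norm (x + s *\<^sub>R z))\<^sup>2) \<partial>std_gaussian \<partial>\<mu>)"
    by (simp add: nn_integral_gauss_conv[OF sets])
  also have "\<dots> = (\<integral>\<^sup>+ x. ennreal ((norm x)\<^sup>2 + s\<^sup>2 * CARD('n)) \<partial>\<mu>)"
    by (subst nn_integral_eq_integral) (auto simp: std_gaussian_shift_norm_sq)
  also have "\<dots> = ennreal ((\<integral>x. (norm x)\<^sup>2 \<partial>\<mu>) + s\<^sup>2 * CARD('n))"
    using int by (subst nn_integral_eq_integral) (auto simp: prob_space)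
  finally have *: "(\<integral>\<^sup>+ x. ennreal ((norm x)\<^sup>2) \<partial>gauss_conv \<mu> s)
      = ennreal ((\<integral>x. (norm x)\<^sup>2 \<partial>\<mu>) + s\<^sup>2 * CARD('n))" .
  show "integrable (gauss_conv \<mu> s) (\<lambda>x. (norm x)\<^sup>2)"
    by (rule integrableI_nonneg) (auto simp: *)
  show "(\<integral>x. (norm x)\<^sup>2 \<partial>gauss_conv \<mu> s) = (\<integral>x. (norm x)\<^sup>2 \<partial>\<mu>) + s\<^sup>2 * CARD('n)"
    by (subst integral_eq_nn_integral) (auto simp: * simp del: ennreal_plus)
qed

text \<open>A Bochner integral, hence 0 by default when the squared distance is not integrable;
  finite second moments of both marginals exclude that case, by
  \<open>integrable_sq_cost\<close>.\<close>

definition sq_cost :: "('a::metric_space \<times> 'a) measure \<Rightarrow> real" where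
  "sq_cost Q = (\<integral>w. (dist (fst w) (snd w))\<^sup>2 \<partial>Q)"

lemma dist_sq_le: "(dist x y)\<^sup>2 \<le> 2 * (norm x)\<^sup>2 + 2 * (norm y)\<^sup>2" for x y :: "'a::real_inner"
proof -
  have "0 \<le> (norm (x + y))\<^sup>2" by simp
  then show ?thesis
    unfolding dist_norm power2_norm_eq_inner
    by (simp add: inner_diff_left inner_diff_right inner_add_left inner_add_right inner_commute)
qed

lemma integrable_sq_cost:
  fixes Q :: "((real ^ 'n) \<times> (real ^ 'n)) measure"
  assumes Q: "Q \<in> couplings M N" and sets: "sets M = sets borel" "sets N = sets borel"
    and int: "integrable M (\<lambda>x. (norm x)\<^sup>2)" "integrable N (\<lambda>x. (norm x)\<^sup>2)"
  shows "integrable Q (\<lambda>w. (dist (fst w) (snd w))\<^sup>2)"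
proof (rule Bochner_Integration.integrable_bound)
  note [measurable_cong] = sets_coupling[OF Q sets]
  show "integrable Q (\<lambda>w. 2 * (norm (fst w))\<^sup>2 + 2 * (norm (snd w))\<^sup>2)"
    using integrable_coupling_fst[OF Q sets int(1)] integrable_coupling_snd[OF Q sets int(2)] by simp
  show "(\<lambda>w. (dist (fst w) (snd w))\<^sup>2) \<in> borel_measurable Q" by measurable
  show "AE w in Q. norm ((dist (fst w) (snd w))\<^sup>2) \<le> norm (2 * (norm (fst w))\<^sup>2 + 2 * (norm (snd w))\<^sup>2)"
    by (intro AE_I2) (use dist_sq_le in auto)
qed

context smooth_potential
begin

text \<open>This integrates the descent lemma: the linear term has mean zero and the quadratic one
  has mean L/2 s^2 p.\<close>

lemma integral_U_gauss_conv:
  assumes "prob_space \<mu>" and sets [measurable_cong]: "sets \<mu> = sets borel"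
    and int: "integrable \<mu> (\<lambda>x. (norm x)\<^sup>2)"
  shows "(\<integral>x. U x \<partial>gauss_conv \<mu> s) \<le> (\<integral>x. U x \<partial>\<mu>) + L / 2 * s\<^sup>2 * CARD('n)"
proof -
  interpret pair_prob_space \<mu> "std_gaussian :: (real ^ 'n) measure"
    by (intro pair_prob_space.intro pair_sigma_finite.intro prob_space_imp_sigma_finite assms
        prob_space_std_gaussian)
  have m: "(\<lambda>(x, z). x + s *\<^sub>R z) \<in> \<mu> \<Otimes>\<^sub>M std_gaussian \<rightarrow>\<^sub>M borel" by measurable
  have "integrable (gauss_conv \<mu> s) U"
    using prob_space_gauss_conv gauss_conv_second_moment assms by (intro integrable_U) auto
  then have i2: "integrable (\<mu> \<Otimes>\<^sub>M std_gaussian) (\<lambda>w. U (fst w + s *\<^sub>R snd w))"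
    unfolding gauss_conv_def by (subst (asm) integrable_distr_eq[OF m]) (auto simp: case_prod_beta)
  have "(\<integral>x. U x \<partial>gauss_conv \<mu> s) = (\<integral>w. U (fst w + s *\<^sub>R snd w) \<partial>(\<mu> \<Otimes>\<^sub>M std_gaussian))"
    unfolding gauss_conv_def by (subst integral_distr[OF m]) (auto simp: case_prod_beta)
  also have "\<dots> = (\<integral>x. \<integral>z. U (x + s *\<^sub>R z) \<partial>std_gaussian \<partial>\<mu>)"
    using integral_fst'[OF i2] by simp
  also have "\<dots> \<le> (\<integral>x. U x + L / 2 * s\<^sup>2 * CARD('n) \<partial>\<mu>)"
  proof (rule integral_mono_AE)
    show "integrable \<mu> (\<lambda>x. \<integral>z. U (x + s *\<^sub>R z) \<partial>std_gaussian)"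
      using integrable_fst'[OF i2] by simp
    show "integrable \<mu> (\<lambda>x. U x + L / 2 * s\<^sup>2 * CARD('n))"
      using integrable_U[OF assms] by simp
    \<comment> \<open>Fubini gives integrability in z only for almost every x, hence the conditional
      form.\<close>
    have "(\<integral>z. U (x + s *\<^sub>R z) \<partial>std_gaussian) \<le> U x + L / 2 * s\<^sup>2 * CARD('n)"
      if "integrable std_gaussian (\<lambda>z. U (x + s *\<^sub>R z))" for x
    proof -
      have "(\<integral>z. U (x + s *\<^sub>R z) \<partial>std_gaussian)
          \<le> (\<integral>z. U x + s * (G x \<bullet> z) + L / 2 * s\<^sup>2 * (norm z)\<^sup>2 \<partial>std_gaussian)"
        using that std_gaussian_norm_sq(1)[where 'n='n] integrable_std_gaussian_inner[of "G x"]
          descent[of x "s *\<^sub>R _"]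
        by (intro integral_mono) (auto simp: power_mult_distrib mult.assoc)
      also have "\<dots> = U x + L / 2 * s\<^sup>2 * CARD('n)"
        using std_gaussian_norm_sq[where 'n='n] integrable_std_gaussian_inner[of "G x"]
        by (simp add: integral_std_gaussian_inner M2.prob_space[simplified])
      finally show ?thesis .
    qed
    then show "AE x in \<mu>. (\<integral>z. U (x + s *\<^sub>R z) \<partial>std_gaussian) \<le> U x + L / 2 * s\<^sup>2 * CARD('n)"
      using AE_integrable_fst'[OF i2] by (auto elim!: eventually_mono)
  qed
  also have "\<dots> = (\<integral>x. U x \<partial>\<mu>) + L / 2 * s\<^sup>2 * CARD('n)"
    using integrable_U[OF assms] by (simp add: M1.prob_space)
  finally show ?thesis .
qed

text \<open>The coefficient of s^3 in \<open>rejection_drift\<close>, averaged over z with D = x -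
  y. B/2 s^2 |z|^2 bounds the error of the leading-order rejection probability: L from the
  linearization of U, |G y|^2 from the quadratic term of \<open>rejection_estimate\<close>.\<close>

definition step_error :: "real ^ 'n \<Rightarrow> real ^ 'n \<Rightarrow> real" where
  "step_error x y = (let B = L + (norm (G y))\<^sup>2;
       m3 = (\<integral>z. norm z ^ 3 \<partial>(std_gaussian :: (real ^ 'n) measure));
       m4 = (\<integral>z. norm z ^ 4 \<partial>(std_gaussian :: (real ^ 'n) measure))
     in norm (x - y) * B * m3 + norm (G y) * m3 + B / 2 * m4)"

text \<open>To leading order a move is rejected with probability \<open>max 0 (s * (G y \<bullet> z))\<close>, the mean of a term linear
  in \<open>z\<close> and of an even one; integrated against \<open>D \<bullet> z\<close>, only the linear term survives and yields the
  drift \<open>D \<bullet> G y\<close>.\<close>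

lemma rejection_drift:
  assumes s: "0 < s" "s \<le> 1"
  shows "acc s y z * (norm D)\<^sup>2 + (1 - acc s y z) * (norm (D + s *\<^sub>R z))\<^sup>2
    \<le> (norm D)\<^sup>2 + s\<^sup>2 * ((D \<bullet> z) * (G y \<bullet> z)) + s\<^sup>2 * ((D \<bullet> z) * \<bar>G y \<bullet> z\<bar>)
      + s ^ 3 * (norm D * (L + (norm (G y))\<^sup>2) * norm z ^ 3 + norm (G y) * norm z ^ 3
        + (L + (norm (G y))\<^sup>2) / 2 * norm z ^ 4)"
proof -
  define g where "g = G y"
  define B where "B = L + (norm g)\<^sup>2"
  define t where "t = s * (g \<bullet> z)"
  define d where "d = U (y + s *\<^sub>R z) - U y"
  define r where "r = 1 - acc s y z"
  define n where "n = norm z"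
  \<comment> \<open>The sum of the bounds L/2 s^2 n^2 for |d - t| and s^2 |g|^2 n^2 / 2 for t^2 /
    2.\<close>
  define e where "e = s\<^sup>2 * n\<^sup>2 * (B / 2)"
  have B0: "0 \<le> B" using L_pos by (simp add: B_def)
  have n0: "0 \<le> n" by (simp add: n_def)
  have tb: "\<bar>t\<bar> \<le> s * norm g * n"
    using Cauchy_Schwarz_ineq2[of g z] s by (simp add: t_def n_def abs_mult mult.assoc)
  have "\<bar>d - t\<bar> \<le> L / 2 * (s\<^sup>2 * n\<^sup>2)"
    using linearization_error[of y "s *\<^sub>R z"] s
    by (simp add: d_def t_def g_def n_def power_mult_distrib)
  moreover have "t\<^sup>2 \<le> (s * norm g * n)\<^sup>2"
    using tb power_mono[of "\<bar>t\<bar>" "s * norm g * n" 2] by simp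
  ultimately have "\<bar>d - t\<bar> + t\<^sup>2 / 2 \<le> e"
    unfolding e_def B_def by (simp add: power_mult_distrib algebra_simps)
  moreover have "acc s y z = min 1 (exp (- d))" by (simp add: acc_def d_def)
  ultimately have re: "\<bar>r - max 0 t\<bar> \<le> e"
    using rejection_estimate[of d t] unfolding r_def by linarith
  have e0: "0 \<le> e" using B0 by (simp add: e_def)
  have Dz: "\<bar>D \<bullet> z\<bar> \<le> norm D * n" using Cauchy_Schwarz_ineq2 by (simp add: n_def)
  have "(D \<bullet> z) * (r - max 0 t) \<le> \<bar>D \<bullet> z\<bar> * \<bar>r - max 0 t\<bar>"
    by (simp flip: abs_mult)
  also have "\<dots> \<le> (norm D * n) * e" using re Dz e0 by (intro mult_mono) auto
  finally have "2 * s * ((D \<bullet> z) * (r - max 0 t)) \<le> 2 * s * ((norm D * n) * e)"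
    using s by (intro mult_left_mono) auto
  also have "\<dots> = s ^ 3 * (norm D * B * n ^ 3)"
    by (simp add: e_def power2_eq_square power3_eq_cube)
  finally have 1: "2 * s * ((D \<bullet> z) * r) \<le> 2 * s * ((D \<bullet> z) * max 0 t) + s ^ 3 * (norm D * B * n ^ 3)"
    by (simp add: algebra_simps)
  have "max 0 t = (t + \<bar>t\<bar>) / 2" by (auto simp: max_def)
  then have 2: "2 * s * ((D \<bullet> z) * max 0 t) = s\<^sup>2 * ((D \<bullet> z) * (g \<bullet> z)) + s\<^sup>2 * ((D \<bullet> z) * \<bar>g \<bullet> z\<bar>)"
    using s by (simp add: t_def abs_mult algebra_simps power2_eq_square)
  \<comment> \<open>The rejection probability is itself of order s, so the quadratic term r s^2 n^2
    belongs to the s^3 error; s \<le> 1 absorbs its s^4 part.\<close>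
  have "r \<le> s * norm g * n + e" using re tb by (auto simp: max_def abs_if split: if_splits)
  then have "r * (s\<^sup>2 * n\<^sup>2) \<le> (s * norm g * n + e) * (s\<^sup>2 * n\<^sup>2)" by (intro mult_right_mono) auto
  also have "\<dots> = s ^ 3 * (norm g * n ^ 3) + s ^ 4 * (B / 2 * n ^ 4)"
    by (simp add: e_def algebra_simps power2_eq_square power3_eq_cube power4_eq_xxxx)
  also have "s ^ 4 * (B / 2 * n ^ 4) \<le> s ^ 3 * (B / 2 * n ^ 4)"
    using s B0 by (intro mult_right_mono power_decreasing) auto
  finally have 3: "r * (s\<^sup>2 * n\<^sup>2) \<le> s ^ 3 * (norm g * n ^ 3) + s ^ 3 * (B / 2 * n ^ 4)" by simp
  have "(norm (D + s *\<^sub>R z))\<^sup>2 = (norm D)\<^sup>2 + 2 * s * (D \<bullet> z) + s\<^sup>2 * n\<^sup>2"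
    unfolding n_def power2_norm_eq_inner
    by (simp add: inner_add_left inner_add_right inner_commute power2_eq_square)
  then have "acc s y z * (norm D)\<^sup>2 + (1 - acc s y z) * (norm (D + s *\<^sub>R z))\<^sup>2
      = (norm D)\<^sup>2 + 2 * s * ((D \<bullet> z) * r) + r * (s\<^sup>2 * n\<^sup>2)"
    by (simp add: r_def algebra_simps)
  also have "\<dots> \<le> (norm D)\<^sup>2 + s\<^sup>2 * ((D \<bullet> z) * (g \<bullet> z)) + s\<^sup>2 * ((D \<bullet> z) * \<bar>g \<bullet> z\<bar>)
      + s ^ 3 * (norm D * B * n ^ 3 + norm g * n ^ 3 + B / 2 * n ^ 4)"
    using 1 2 3 by (simp add: algebra_simps)
  finally show ?thesis by (simp add: g_def B_def n_def)
qed

lemma expected_rejection_drift: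
  assumes s: "0 < s" "s \<le> 1"
  defines "H \<equiv> \<lambda>x y z. acc s y z * (norm (x - y))\<^sup>2 + (1 - acc s y z) * (norm (x - y + s *\<^sub>R z))\<^sup>2"
  shows "integrable std_gaussian (H x y)"
    and "(\<integral>z. H x y z \<partial>std_gaussian) \<le> (norm (x - y))\<^sup>2 + s\<^sup>2 * (U x - U y) + s ^ 3 * step_error x y"
proof -
  interpret S: prob_space "std_gaussian :: (real ^ 'n) measure" by (rule prob_space_std_gaussian)
  define D where "D = x - y"
  define g where "g = G y"
  have [measurable]: "H x y \<in> borel_measurable borel" unfolding H_def by measurable
  show iH: "integrable std_gaussian (H x y)"
  proof (rule Bochner_Integration.integrable_bound)
    show "integrable std_gaussian (\<lambda>z. (norm D)\<^sup>2 + (norm (D + s *\<^sub>R z))\<^sup>2)"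
      using std_gaussian_shift_norm_sq(1)[of D s] by simp
    have "acc s y z * (norm D)\<^sup>2 \<le> 1 * (norm D)\<^sup>2"
      "(1 - acc s y z) * (norm (D + s *\<^sub>R z))\<^sup>2 \<le> 1 * (norm (D + s *\<^sub>R z))\<^sup>2" for z
      by (rule mult_right_mono; simp add: acc_bounds)+
    then have "H x y z \<le> (norm D)\<^sup>2 + (norm (D + s *\<^sub>R z))\<^sup>2" for z
      unfolding H_def D_def by (metis add_mono mult_1)
    moreover have "0 \<le> H x y z" for z
      using acc_bounds[of s y z] by (simp add: H_def)
    ultimately show "AE z in std_gaussian. norm (H x y z) \<le> norm ((norm D)\<^sup>2 + (norm (D + s *\<^sub>R z))\<^sup>2)"
      by (intro AE_I2) simp
  qed measurable
  have i1: "integrable std_gaussian (\<lambda>z. (D \<bullet> z) * \<bar>g \<bullet> z\<bar>)"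
    by (rule Bochner_Integration.integrable_bound[OF std_gaussian_cov(1)[of D g]]) (auto simp: abs_mult)
  have i2: "(\<integral>z. (D \<bullet> z) * \<bar>g \<bullet> z\<bar> \<partial>std_gaussian) = 0"
    by (rule integral_std_gaussian_odd) simp_all
  note i = i1 i2 std_gaussian_cov[of D g] std_gaussian_norm_pow[of 3, where 'n='n] std_gaussian_norm_pow[of 4, where 'n='n]
  have "(\<integral>z. H x y z \<partial>std_gaussian) \<le> (\<integral>z. (norm D)\<^sup>2 + s\<^sup>2 * ((D \<bullet> z) * (g \<bullet> z)) + s\<^sup>2 * ((D \<bullet> z) * \<bar>g \<bullet> z\<bar>)
      + s ^ 3 * (norm D * (L + (norm g)\<^sup>2) * norm z ^ 3 + norm g * norm z ^ 3
        + (L + (norm g)\<^sup>2) / 2 * norm z ^ 4) \<partial>std_gaussian)"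
    unfolding H_def D_def g_def
    by (intro integral_mono rejection_drift[OF s]) (use iH i in \<open>auto simp: H_def D_def g_def\<close>)
  also have "\<dots> = (norm D)\<^sup>2 + s\<^sup>2 * (D \<bullet> g) + s ^ 3 * step_error x y"
    using i by (simp add: step_error_def Let_def D_def g_def S.prob_space[simplified])
  \<comment> \<open>Convexity converts the drift into a potential difference, the quantity that the
    gradient step gains.\<close>
  also have "D \<bullet> g \<le> U x - U y"
    using above_tangent[of y x] by (simp add: D_def g_def inner_commute)
  finally show "(\<integral>z. H x y z \<partial>std_gaussian) \<le> (norm (x - y))\<^sup>2 + s\<^sup>2 * (U x - U y) + s ^ 3 * step_error x y"
    by (simp add: D_def mult_left_mono)
qed

text \<open>Growth is permitted exactly where moments are under control: quadratic in the moving
  point x, quartic in the stationary point y. G grows at most linearly, so B grows at most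
  quadratically in y.\<close>

lemma step_error_bound:
  "\<exists>C\<ge>0. \<forall>x y. step_error x y \<le> C * (1 + (norm x)\<^sup>2 + norm y ^ 4)"
proof -
  define m3 where "m3 = (\<integral>z. norm z ^ 3 \<partial>(std_gaussian :: (real ^ 'n) measure))"
  define m4 where "m4 = (\<integral>z. norm z ^ 4 \<partial>(std_gaussian :: (real ^ 'n) measure))"
  define g where "g = norm (G 0) + L"
  define b where "b = L + 2 * g\<^sup>2"
  define C where "C = (4 + 2 * b\<^sup>2) * m3 + 2 * g * m3 + b * m4"
  have g0: "0 \<le> g" using L_pos by (simp add: g_def)
  have b0: "0 \<le> b" using L_pos by (simp add: b_def)
  have m0: "0 \<le> m3" "0 \<le> m4" by (simp_all add: m3_def m4_def)
  have "0 \<le> C" using g0 b0 m0 by (simp add: C_def)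
  moreover have "step_error x y \<le> C * (1 + (norm x)\<^sup>2 + norm y ^ 4)" for x y
  proof -
  define a where "a = norm y"
  define P where "P = 1 + (norm x)\<^sup>2 + norm y ^ 4"
  define B where "B = L + (norm (G y))\<^sup>2"
  have a0: "0 \<le> a" by (simp add: a_def)
  have "0 \<le> (a\<^sup>2 - 1)\<^sup>2" "0 \<le> (a - 1)\<^sup>2" by simp_all
  then have a2: "2 * a\<^sup>2 \<le> 1 + a ^ 4" and a1: "2 * a \<le> 1 + a\<^sup>2"
    unfolding power2_diff by (simp_all flip: power_mult)
  have a4: "0 \<le> a ^ 4" by simp
  have a1': "a \<le> 1 + a ^ 4" using a0 a1 a2 a4 by linarith
  have a2': "a\<^sup>2 \<le> 1 + a ^ 4" using a2 a4 by linarith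
  have P: "1 + a ^ 4 \<le> P" "(norm x)\<^sup>2 \<le> P" "0 \<le> P" by (simp_all add: P_def a_def)
  have "norm (G y) \<le> norm (G 0) + L * a"
    using norm_triangle_sub[of "G y" "G 0"] lip[of y 0] by (simp add: a_def)
  also have "\<dots> \<le> g * (1 + a)" using a0 L_pos by (simp add: g_def algebra_simps)
  finally have G1: "norm (G y) \<le> g * (1 + a)" .
  have "(norm (G y))\<^sup>2 \<le> (g * (1 + a))\<^sup>2" using G1 by (intro power_mono) auto
  also have "\<dots> \<le> g\<^sup>2 * (2 * (1 + a\<^sup>2))"
    unfolding power_mult_distrib using a1 by (intro mult_left_mono) (auto simp: power2_sum)
  finally have "(norm (G y))\<^sup>2 \<le> g\<^sup>2 * (2 * (1 + a\<^sup>2))" .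
  moreover have "b * (1 + a\<^sup>2) = L + L * a\<^sup>2 + g\<^sup>2 * (2 * (1 + a\<^sup>2))"
    by (simp add: b_def algebra_simps)
  moreover have "0 \<le> L * a\<^sup>2" using L_pos by simp
  ultimately have "B \<le> b * (1 + a\<^sup>2)" unfolding B_def by linarith
  then have B2: "B\<^sup>2 \<le> b\<^sup>2 * (1 + a\<^sup>2)\<^sup>2" and B1: "B \<le> b * (2 * P)"
  proof -
    assume *: "B \<le> b * (1 + a\<^sup>2)"
    have "0 \<le> B" using L_pos by (simp add: B_def)
    with * show "B\<^sup>2 \<le> b\<^sup>2 * (1 + a\<^sup>2)\<^sup>2" by (metis power_mono power_mult_distrib)
    have "b * (1 + a\<^sup>2) \<le> b * (2 * P)"
      using b0 P a2 a4 by (intro mult_left_mono) linarith+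
    with * show "B \<le> b * (2 * P)" by linarith
  qed
  have "(1 + a\<^sup>2)\<^sup>2 \<le> 2 * P"
  proof -
    have "(1 + a\<^sup>2)\<^sup>2 = 1 + 2 * a\<^sup>2 + a ^ 4" by (simp add: power2_sum flip: power_mult)
    then show ?thesis using a2 P by linarith
  qed
  then have "b\<^sup>2 * (1 + a\<^sup>2)\<^sup>2 \<le> b\<^sup>2 * (2 * P)" by (intro mult_left_mono) auto
  with B2 have B2': "B\<^sup>2 \<le> b\<^sup>2 * (2 * P)" by linarith
  \<comment> \<open>Splitting the mixed term into squares keeps the growth in x quadratic, at the
    price of B^2, which is quartic in y.\<close>
  have "0 \<le> (norm (x - y) - B)\<^sup>2" by simp
  then have "2 * (norm (x - y) * B) \<le> (norm (x - y))\<^sup>2 + B\<^sup>2" unfolding power2_diff by linarith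
  moreover have "(norm (x - y))\<^sup>2 \<le> 2 * (norm x)\<^sup>2 + 2 * a\<^sup>2"
    using dist_sq_le[of x y] by (simp add: dist_norm a_def)
  ultimately have DB: "norm (x - y) * B \<le> (4 + 2 * b\<^sup>2) * P"
  proof -
    have "0 \<le> b\<^sup>2 * P" using P by simp
    moreover have "b\<^sup>2 * (2 * P) = 2 * (b\<^sup>2 * P)" "(4 + 2 * b\<^sup>2) * P = 4 * P + 2 * (b\<^sup>2 * P)"
      by (simp_all add: algebra_simps)
    moreover assume "2 * (norm (x - y) * B) \<le> (norm (x - y))\<^sup>2 + B\<^sup>2"
      "(norm (x - y))\<^sup>2 \<le> 2 * (norm x)\<^sup>2 + 2 * a\<^sup>2"
    ultimately show ?thesis using B2' a2' P by linarith
  qed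
  have "norm (G y) \<le> g * (2 * P)"
  proof -
    have "1 + a \<le> 2 * P" using a1' P a4 by linarith
    then have "g * (1 + a) \<le> g * (2 * P)" using g0 by (rule mult_left_mono)
    with G1 show ?thesis by linarith
  qed
  then have "norm (x - y) * B * m3 + norm (G y) * m3 + B / 2 * m4
      \<le> (4 + 2 * b\<^sup>2) * P * m3 + g * (2 * P) * m3 + (b * (2 * P)) / 2 * m4"
    using DB B1 m0 by (intro add_mono mult_right_mono) auto
  also have "\<dots> = C * P" by (simp add: C_def algebra_simps)
  finally show ?thesis
    by (simp add: step_error_def Let_def B_def m3_def m4_def P_def)
  qed
  ultimately show ?thesis by blast
qed

lemma gibbs_norm_sq: "integrable (gibbs U) (\<lambda>x. (norm x)\<^sup>2)"
  using gibbs_norm_pow[of 2] by simp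

text \<open>The constant is chosen before s, \<mu> and Q. This order of quantifiers allows the
  estimate to be iterated along the flow and s to tend to 0 afterwards.\<close>

lemma metropolis_cost:
  "\<exists>C\<ge>0. \<forall>s \<mu> Q. 0 < s \<longrightarrow> s \<le> 1 \<longrightarrow> prob_space \<mu> \<longrightarrow> sets \<mu> = sets borel \<longrightarrow>
      integrable \<mu> (\<lambda>x. (norm x)\<^sup>2) \<longrightarrow> Q \<in> couplings \<mu> (gibbs U) \<longrightarrow>
      sq_cost (metropolis s Q) \<le> sq_cost Q + s\<^sup>2 * ((\<integral>x. U x \<partial>\<mu>) - (\<integral>x. U x \<partial>gibbs U))
        + s ^ 3 * C * (1 + (\<integral>x. (norm x)\<^sup>2 \<partial>\<mu>))"
proof -
  obtain C0 where C0: "0 \<le> C0" "\<And>x y. step_error x y \<le> C0 * (1 + (norm x)\<^sup>2 + norm y ^ 4)"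
    using step_error_bound by blast
  define m where "m = (\<integral>y. norm y ^ 4 \<partial>gibbs U)"
  have m0: "0 \<le> m" by (simp add: m_def)
  show ?thesis
  proof (intro exI[of _ "C0 * (1 + m)"] conjI allI impI)
    show "0 \<le> C0 * (1 + m)" using C0 m0 by simp
    fix s :: real and \<mu> :: "(real ^ 'n) measure" and Q
    assume s: "0 < s" "s \<le> 1" and prob: "prob_space \<mu>" and sets [measurable_cong]: "sets \<mu> = sets borel"
      and int: "integrable \<mu> (\<lambda>x. (norm x)\<^sup>2)" and Q: "Q \<in> couplings \<mu> (gibbs U)"
    interpret Q: prob_space Q by (rule prob_space_coupling[OF Q sets sets_gibbs prob])
    note sQ [measurable_cong] = sets_coupling[OF Q sets sets_gibbs]
    note iQ1 = integrable_coupling_fst[OF Q sets sets_gibbs]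
      and iQ2 = integrable_coupling_snd[OF Q sets sets_gibbs]
      and eQ1 = integral_coupling_fst[OF Q sets sets_gibbs]
      and eQ2 = integral_coupling_snd[OF Q sets sets_gibbs]
    note iU = integrable_U[OF prob sets int]
      and iUg = integrable_U[OF prob_space_gibbs sets_gibbs gibbs_norm_sq]
    let ?K = "\<lambda>w. (dist (fst w) (snd w))\<^sup>2 + s\<^sup>2 * (U (fst w) - U (snd w))
        + s ^ 3 * (C0 * (1 + (norm (fst w))\<^sup>2 + norm (snd w) ^ 4))"
    let ?H = "\<lambda>x y z. acc s y z * (norm (x - y))\<^sup>2 + (1 - acc s y z) * (norm (x - y + s *\<^sub>R z))\<^sup>2"
    have HK: "(\<integral>z. ?H (fst w) (snd w) z \<partial>std_gaussian) \<le> ?K w" for w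
    proof -
      have "s ^ 3 * step_error (fst w) (snd w) \<le> s ^ 3 * (C0 * (1 + (norm (fst w))\<^sup>2 + norm (snd w) ^ 4))"
        using C0 s by (intro mult_left_mono) auto
      then show ?thesis
        using expected_rejection_drift(2)[OF s, of "snd w" "fst w"] by (simp add: dist_norm)
    qed
    have H0: "0 \<le> ?H x y z" for x y z using acc_bounds[of s y z] by simp
    \<comment> \<open>The summand U (fst w) - U (snd w) may be negative; nonnegativity of the whole
      is inherited from the expected cost below it, and is needed to pass between
      \<open>ennreal\<close> and real integrals.\<close>
    have K0: "0 \<le> ?K w" for w
      by (rule order_trans[OF _ HK]) (rule Bochner_Integration.integral_nonneg, rule H0)
    have iD: "integrable Q (\<lambda>w. (dist (fst w) (snd w))\<^sup>2)"
      by (rule integrable_sq_cost[OF Q sets sets_gibbs int gibbs_norm_sq])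
    have iK: "integrable Q ?K"
      using iQ1[OF int] iQ2[OF gibbs_norm_pow[of 4]] iQ1[OF iU] iQ2[OF iUg] iD by simp
    have dist1: "dist (x + v) (y + v) = norm (x - y)" and dist2: "dist (x + v) y = norm (x - y + v)"
      for x y v :: "real ^ 'n"
      by (simp_all add: dist_norm algebra_simps)
    have "(\<integral>\<^sup>+ w. ennreal ((dist (fst w) (snd w))\<^sup>2) \<partial>metropolis s Q)
        = (\<integral>\<^sup>+ w. \<integral>\<^sup>+ z. ennreal (?H (fst w) (snd w) z) \<partial>std_gaussian \<partial>Q)"
      by (subst nn_integral_metropolis[OF sQ], measurable)
        (simp add: dist1 dist2 acc_bounds flip: ennreal_mult ennreal_plus)
    also have "\<dots> \<le> (\<integral>\<^sup>+ w. ennreal (?K w) \<partial>Q)"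
    proof (rule nn_integral_mono)
      fix w
      show "(\<integral>\<^sup>+ z. ennreal (?H (fst w) (snd w) z) \<partial>std_gaussian) \<le> ennreal (?K w)"
        using HK[of w] H0 expected_rejection_drift(1)[OF s, of "snd w" "fst w"]
        by (subst nn_integral_eq_integral) (auto intro!: ennreal_leI)
    qed
    also have "\<dots> = ennreal (\<integral>w. ?K w \<partial>Q)"
      using iK K0 by (intro nn_integral_eq_integral) auto
    finally have le: "(\<integral>\<^sup>+ w. ennreal ((dist (fst w) (snd w))\<^sup>2) \<partial>metropolis s Q) \<le> ennreal (\<integral>w. ?K w \<partial>Q)" .
    have "(\<lambda>w. (dist (fst w) (snd w))\<^sup>2) \<in> borel_measurable (metropolis s Q)"
      unfolding metropolis_def by measurable
    then have "sq_cost (metropolis s Q) \<le> (\<integral>w. ?K w \<partial>Q)"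
      unfolding sq_cost_def using le K0
      by (subst integral_eq_nn_integral) (auto intro!: enn2real_leI Bochner_Integration.integral_nonneg)
    also have "\<dots> = sq_cost Q + s\<^sup>2 * ((\<integral>x. U x \<partial>\<mu>) - (\<integral>x. U x \<partial>gibbs U))
        + s ^ 3 * (C0 * (1 + (\<integral>x. (norm x)\<^sup>2 \<partial>\<mu>) + m))"
      using iQ1[OF int] iQ2[OF gibbs_norm_pow[of 4]] iQ1[OF iU] iQ2[OF iUg] iD
      by (simp add: eQ1[OF int] eQ2[OF gibbs_norm_pow[of 4]] eQ1[OF iU] eQ2[OF iUg] m_def sq_cost_def Q.prob_space)
    also have "s ^ 3 * (C0 * (1 + (\<integral>x. (norm x)\<^sup>2 \<partial>\<mu>) + m))
        \<le> s ^ 3 * (C0 * ((1 + m) * (1 + (\<integral>x. (norm x)\<^sup>2 \<partial>\<mu>))))"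
    proof (intro mult_left_mono)
      have "0 \<le> m * (\<integral>x. (norm x)\<^sup>2 \<partial>\<mu>)" using m0 by simp
      then show "1 + (\<integral>x. (norm x)\<^sup>2 \<partial>\<mu>) + m \<le> (1 + m) * (1 + (\<integral>x. (norm x)\<^sup>2 \<partial>\<mu>))"
        by (simp add: algebra_simps)
    qed (use s C0 in auto)
    finally show "sq_cost (metropolis s Q) \<le> sq_cost Q + s\<^sup>2 * ((\<integral>x. U x \<partial>\<mu>) - (\<integral>x. U x \<partial>gibbs U))
        + s ^ 3 * (C0 * (1 + m)) * (1 + (\<integral>x. (norm x)\<^sup>2 \<partial>\<mu>))"
      by (simp add: mult.assoc)
  qed
qed

section \<open>Many small moves during one heat flow\<close>

lemma gauss_conv_funpow:
  fixes \<mu> :: "(real ^ 'n) measure"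
  assumes sets: "sets \<mu> = sets borel" and s: "0 < s"
  shows "((\<lambda>\<mu>. gauss_conv \<mu> s) ^^ Suc j) \<mu> = gauss_conv \<mu> (sqrt (real (Suc j)) * s)"
proof (induction j)
  case (Suc j)
  have "sqrt (s\<^sup>2 + (sqrt (real (Suc j)) * s)\<^sup>2) = sqrt (real (Suc (Suc j)) * s\<^sup>2)"
    by (simp add: power_mult_distrib algebra_simps)
  also have "\<dots> = sqrt (real (Suc (Suc j))) * s" using s by (simp add: real_sqrt_mult)
  finally show ?case
    using gauss_conv_gauss_conv[OF sets s, of "sqrt (real (Suc j)) * s"] s Suc by simp
qed simp

text \<open>The Brownian flow of \<open>\<mu>\<close> is coupled with a stationary chain in small time steps by
  running Metropolis moves with the same Gaussian increments.\<close>

lemma heat_flow_coupling: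
  assumes prob: "prob_space \<mu>" and sets: "sets \<mu> = sets borel"
    and int: "integrable \<mu> (\<lambda>x. (norm x)\<^sup>2)" and Q: "Q \<in> couplings \<mu> (gibbs U)"
    and h: "0 < h" and eps: "0 < \<epsilon>"
  shows "\<exists>Q'\<in>couplings (gauss_conv \<mu> (sqrt (2 * h))) (gibbs U).
    sq_cost Q' \<le> sq_cost Q + 2 * h * ((\<integral>x. U x \<partial>\<mu>) - (\<integral>x. U x \<partial>gibbs U))
      + L * h\<^sup>2 * CARD('n) + \<epsilon>"
proof -
  define p where "p = real CARD('n)"
  obtain C where C: "0 \<le> C"
    "\<And>s \<mu> Q. 0 < s \<Longrightarrow> s \<le> 1 \<Longrightarrow> prob_space \<mu> \<Longrightarrow> sets \<mu> = sets borel \<Longrightarrow>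
      integrable \<mu> (\<lambda>x. (norm x)\<^sup>2) \<Longrightarrow> Q \<in> couplings \<mu> (gibbs U) \<Longrightarrow>
      sq_cost (metropolis s Q) \<le> sq_cost Q + s\<^sup>2 * ((\<integral>x. U x \<partial>\<mu>) - (\<integral>x. U x \<partial>gibbs U))
        + s ^ 3 * C * (1 + (\<integral>x. (norm x)\<^sup>2 \<partial>\<mu>))"
    using metropolis_cost by blast
  define m2 where "m2 = (\<integral>x. (norm x)\<^sup>2 \<partial>\<mu>)"
  \<comment> \<open>Moves with total variance 2 h raise the second moment by at most 2 h p, so E
    bounds the error coefficient of every move.\<close>
  define E where "E = C * (1 + (m2 + 2 * h * p))"
  have E0: "0 \<le> E" using C(1) h by (simp add: E_def m2_def p_def)
  have "(\<lambda>n. sqrt (2 * h / real (Suc n)) * (2 * h * E)) \<longlonglongrightarrow> sqrt 0 * (2 * h * E)"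
    by (intro tendsto_intros LIMSEQ_Suc[OF lim_const_over_n])
  then have "eventually (\<lambda>n. sqrt (2 * h / real (Suc n)) * (2 * h * E) < \<epsilon>) sequentially"
    using eps by (intro order_tendstoD(2)) auto
  moreover have "(\<lambda>n. 2 * h / real (Suc n)) \<longlonglongrightarrow> 0"
    by (rule LIMSEQ_Suc[OF lim_const_over_n])
  then have "eventually (\<lambda>n. 2 * h / real (Suc n) < 1) sequentially"
    by (intro order_tendstoD(2)) auto
  ultimately have "eventually (\<lambda>n. sqrt (2 * h / real (Suc n)) * (2 * h * E) < \<epsilon> \<and> 2 * h / real (Suc n) < 1) sequentially"
    by eventually_elim simp
  \<comment> \<open>With n = k + 1 moves and s^2 = 2 h / n, the total error n s^3 E equals s (2 h
    E). The first condition makes it smaller than \<epsilon>, the second ensures s \<le> 1.\<close>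
  then obtain k where k: "sqrt (2 * h / real (Suc k)) * (2 * h * E) < \<epsilon>" "2 * h / real (Suc k) < 1"
    by (auto simp: eventually_sequentially)
  define n where "n = Suc k"
  define s where "s = sqrt (2 * h / real n)"
  have s: "0 < s" "s \<le> 1" using h k(2) by (auto simp: s_def n_def)
  have s2: "real n * s\<^sup>2 = 2 * h" using h by (simp add: s_def n_def)
  define \<mu>' where "\<mu>' j = ((\<lambda>\<mu>. gauss_conv \<mu> s) ^^ j) \<mu>" for j
  define Q' where "Q' j = (metropolis s ^^ j) Q" for j
  \<comment> \<open>The mean potential of the moving point rises by at most L/2 s^2 p per move and
    enters the cost with weight s^2. Summing gives the factor j (j - 1) / 2, rounded up to j^2 / 2;
    at j = n the term is exactly L h^2 p.\<close>
  have *: "prob_space (\<mu>' j) \<and> sets (\<mu>' j) = sets borel \<and> integrable (\<mu>' j) (\<lambda>x. (norm x)\<^sup>2) \<and>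
      Q' j \<in> couplings (\<mu>' j) (gibbs U) \<and> (\<integral>x. (norm x)\<^sup>2 \<partial>\<mu>' j) = m2 + j * s\<^sup>2 * p \<and>
      (\<integral>x. U x \<partial>\<mu>' j) \<le> (\<integral>x. U x \<partial>\<mu>) + j * (L / 2 * s\<^sup>2 * p) \<and>
      sq_cost (Q' j) \<le> sq_cost Q + j * s\<^sup>2 * ((\<integral>x. U x \<partial>\<mu>) - (\<integral>x. U x \<partial>gibbs U))
        + (real j)\<^sup>2 / 2 * (s\<^sup>2 * (L / 2 * s\<^sup>2 * p)) + j * (s ^ 3 * E)" if "j \<le> n" for j
    using that
  proof (induction j)
    case 0
    then show ?case using prob sets int Q by (simp add: \<mu>'_def Q'_def m2_def)
  next
    case (Suc j)
    then have IH: "prob_space (\<mu>' j)" "sets (\<mu>' j) = sets borel" "integrable (\<mu>' j) (\<lambda>x. (norm x)\<^sup>2)"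
      "Q' j \<in> couplings (\<mu>' j) (gibbs U)" "(\<integral>x. (norm x)\<^sup>2 \<partial>\<mu>' j) = m2 + j * s\<^sup>2 * p"
      "(\<integral>x. U x \<partial>\<mu>' j) \<le> (\<integral>x. U x \<partial>\<mu>) + j * (L / 2 * s\<^sup>2 * p)"
      "sq_cost (Q' j) \<le> sq_cost Q + j * s\<^sup>2 * ((\<integral>x. U x \<partial>\<mu>) - (\<integral>x. U x \<partial>gibbs U))
        + (real j)\<^sup>2 / 2 * (s\<^sup>2 * (L / 2 * s\<^sup>2 * p)) + j * (s ^ 3 * E)"
      by auto
    have \<mu>_Suc: "\<mu>' (Suc j) = gauss_conv (\<mu>' j) s" and Q_Suc: "Q' (Suc j) = metropolis s (Q' j)"
      by (simp_all add: \<mu>'_def Q'_def)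
    have "real j * s\<^sup>2 \<le> real n * s\<^sup>2" using Suc.prems by (intro mult_right_mono) auto
    then have "real j * s\<^sup>2 * p \<le> 2 * h * p" using s2 by (intro mult_right_mono) (auto simp: p_def)
    then have "C * (1 + (\<integral>x. (norm x)\<^sup>2 \<partial>\<mu>' j)) \<le> E"
      unfolding E_def IH(5) using C(1) by (intro mult_left_mono) auto
    then have "s ^ 3 * (C * (1 + (\<integral>x. (norm x)\<^sup>2 \<partial>\<mu>' j))) \<le> s ^ 3 * E"
      using s by (intro mult_left_mono) auto
    moreover have "s\<^sup>2 * ((\<integral>x. U x \<partial>\<mu>' j) - (\<integral>x. U x \<partial>gibbs U))
        \<le> s\<^sup>2 * (((\<integral>x. U x \<partial>\<mu>) + j * (L / 2 * s\<^sup>2 * p)) - (\<integral>x. U x \<partial>gibbs U))"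
      using IH(6) by (intro mult_left_mono) auto
    moreover have "((real j)\<^sup>2 / 2 + j) * (s\<^sup>2 * (L / 2 * s\<^sup>2 * p))
        \<le> (real (Suc j))\<^sup>2 / 2 * (s\<^sup>2 * (L / 2 * s\<^sup>2 * p))"
    proof (rule mult_right_mono)
      show "(real j)\<^sup>2 / 2 + j \<le> (real (Suc j))\<^sup>2 / 2"
        by (simp add: power2_eq_square algebra_simps)
      show "0 \<le> s\<^sup>2 * (L / 2 * s\<^sup>2 * p)" using L_pos by (simp add: p_def)
    qed
    ultimately have "sq_cost (Q' (Suc j)) \<le> sq_cost Q
        + real (Suc j) * s\<^sup>2 * ((\<integral>x. U x \<partial>\<mu>) - (\<integral>x. U x \<partial>gibbs U))
        + (real (Suc j))\<^sup>2 / 2 * (s\<^sup>2 * (L / 2 * s\<^sup>2 * p)) + real (Suc j) * (s ^ 3 * E)"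
      using C(2)[OF s IH(1-4)] IH(7) unfolding Q_Suc by (simp add: algebra_simps)
    moreover have "(\<integral>x. U x \<partial>\<mu>' (Suc j)) \<le> (\<integral>x. U x \<partial>\<mu>) + real (Suc j) * (L / 2 * s\<^sup>2 * p)"
      using integral_U_gauss_conv[OF IH(1-3), of s] IH(6) unfolding \<mu>_Suc p_def
      by (simp add: algebra_simps add_divide_distrib)
    moreover have "(\<integral>x. (norm x)\<^sup>2 \<partial>\<mu>' (Suc j)) = m2 + real (Suc j) * s\<^sup>2 * p"
      using gauss_conv_second_moment(2)[OF IH(1-3), of s] unfolding \<mu>_Suc IH(5)
      by (simp add: algebra_simps p_def)
    ultimately show ?case
      using prob_space_gauss_conv[OF IH(1,2), of s] gauss_conv_second_moment(1)[OF IH(1-3), of s]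
        metropolis_coupling[OF IH(4,2), of s] unfolding \<mu>_Suc Q_Suc by simp
  qed
  have "sqrt (real n) * s = sqrt (2 * h)" by (simp add: s_def n_def flip: real_sqrt_mult)
  then have \<mu>n: "\<mu>' n = gauss_conv \<mu> (sqrt (2 * h))"
    using gauss_conv_funpow[OF sets s(1), of k] unfolding \<mu>'_def n_def by simp
  have "(real n)\<^sup>2 / 2 * (s\<^sup>2 * (L / 2 * s\<^sup>2 * p)) = L / 4 * p * (real n * s\<^sup>2)\<^sup>2"
    by (simp add: power2_eq_square)
  also have "\<dots> = L * h\<^sup>2 * p" unfolding s2 by (simp add: power2_eq_square)
  finally have e1: "(real n)\<^sup>2 / 2 * (s\<^sup>2 * (L / 2 * s\<^sup>2 * p)) = L * h\<^sup>2 * p" .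
  have "real n * (s ^ 3 * E) = s * ((real n * s\<^sup>2) * E)" by (simp add: power2_eq_square power3_eq_cube)
  moreover have "s * ((2 * h) * E) < \<epsilon>" using k(1) by (simp add: s_def n_def)
  ultimately have e2: "real n * (s ^ 3 * E) < \<epsilon>" unfolding s2 by (simp only:)
  show ?thesis
  proof (rule bexI)
    show "Q' n \<in> couplings (gauss_conv \<mu> (sqrt (2 * h))) (gibbs U)"
      using *[of n] \<mu>n by simp
    have "sq_cost (Q' n) \<le> sq_cost Q + real n * s\<^sup>2 * ((\<integral>x. U x \<partial>\<mu>) - (\<integral>x. U x \<partial>gibbs U))
        + (real n)\<^sup>2 / 2 * (s\<^sup>2 * (L / 2 * s\<^sup>2 * p)) + real n * (s ^ 3 * E)"
      using *[of n] by simp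
    then show "sq_cost (Q' n) \<le> sq_cost Q + 2 * h * ((\<integral>x. U x \<partial>\<mu>) - (\<integral>x. U x \<partial>gibbs U))
        + L * h\<^sup>2 * CARD('n) + \<epsilon>"
      using e2 unfolding e1 s2 by (simp add: p_def)
  qed
qed

end

section \<open>Convergence of the Langevin algorithm\<close>

context smooth_potential
begin

text \<open>Only the first component of the coupling is moved, and
  \<open>gradient_step_contraction\<close> is integrated. The potential is evaluated under the new
  law, so that this term cancels against the one in \<open>heat_flow_coupling\<close>.\<close>

lemma gradient_step_coupling:
  assumes prob: "prob_space \<nu>" and sets [measurable_cong]: "sets \<nu> = sets borel"
    and int: "integrable \<nu> (\<lambda>x. (norm x)\<^sup>2)" and Q: "Q \<in> couplings \<nu> (gibbs U)"
    and h: "0 < h" "h * L \<le> 1"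
  defines "\<nu>' \<equiv> distr \<nu> borel (\<lambda>x. x - h *\<^sub>R G x)"
  shows "prob_space \<nu>'" "sets \<nu>' = sets borel" "integrable \<nu>' (\<lambda>x. (norm x)\<^sup>2)"
    and "\<exists>Q'\<in>couplings \<nu>' (gibbs U).
      sq_cost Q' \<le> (1 - m * h) * sq_cost Q - 2 * h * ((\<integral>x. U x \<partial>\<nu>') - (\<integral>x. U x \<partial>gibbs U))"
proof -
  interpret prob_space \<nu> by (rule prob)
  let ?T = "\<lambda>x. x - h *\<^sub>R G x"
  have T: "?T \<in> \<nu> \<rightarrow>\<^sub>M borel" by measurable
  show prob': "prob_space \<nu>'" unfolding \<nu>'_def by (rule prob_space_distr[OF T])
  show sets': "sets \<nu>' = sets borel" by (simp add: \<nu>'_def)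
  have "integrable \<nu> (\<lambda>x. (norm (?T x))\<^sup>2)"
  proof (rule Bochner_Integration.integrable_bound)
    show "integrable \<nu> (\<lambda>x. 2 * (2 * norm x)\<^sup>2 + 2 * (h * norm (G 0))\<^sup>2)"
      using int by (simp add: power_mult_distrib)
    have "(norm (?T x))\<^sup>2 \<le> 2 * (2 * norm x)\<^sup>2 + 2 * (h * norm (G 0))\<^sup>2" for x
    proof -
      have "norm (?T x) \<le> norm x + h * norm (G x)"
        using norm_triangle_ineq4[of x "h *\<^sub>R G x"] h by simp
      also have "h * norm (G x) \<le> h * (norm (G 0) + L * norm x)"
        using norm_triangle_sub[of "G x" "G 0"] lip[of x 0] h by (intro mult_left_mono) auto
      also have "\<dots> \<le> h * norm (G 0) + norm x"
        using mult_right_mono[OF h(2) norm_ge_zero[of x]] by (simp add: algebra_simps)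
      finally have "norm (?T x) \<le> 2 * norm x + h * norm (G 0)" by simp
      then have "(norm (?T x))\<^sup>2 \<le> (2 * norm x + h * norm (G 0))\<^sup>2" by (intro power_mono) auto
      moreover have "0 \<le> (2 * norm x - h * norm (G 0))\<^sup>2" by simp
      ultimately show ?thesis unfolding power2_diff power2_sum by linarith
    qed
    then show "AE x in \<nu>. norm ((norm (?T x))\<^sup>2) \<le> norm (2 * (2 * norm x)\<^sup>2 + 2 * (h * norm (G 0))\<^sup>2)"
      by (intro AE_I2) simp
  qed measurable
  then show int': "integrable \<nu>' (\<lambda>x. (norm x)\<^sup>2)"
    unfolding \<nu>'_def by (subst integrable_distr_eq[OF T]) auto
  note sQ [measurable_cong] = sets_coupling[OF Q sets sets_gibbs]
  define Q' where "Q' = distr Q (borel \<Otimes>\<^sub>M borel) (\<lambda>w. (?T (fst w), snd w))"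
  have T2: "(\<lambda>w. (?T (fst w), snd w)) \<in> Q \<rightarrow>\<^sub>M borel \<Otimes>\<^sub>M borel" by measurable
  have Q': "Q' \<in> couplings \<nu>' (gibbs U)"
  proof (rule couplingsI[OF sets' sets_gibbs])
    fix f :: "real ^ 'n \<Rightarrow> ennreal" assume f [measurable]: "f \<in> borel_measurable borel"
    have "(\<integral>\<^sup>+ w. f (fst w) \<partial>Q') = (\<integral>\<^sup>+ w. f (?T (fst w)) \<partial>Q)"
      unfolding Q'_def by (subst nn_integral_distr[OF T2]) auto
    also have "\<dots> = (\<integral>\<^sup>+ x. f (?T x) \<partial>\<nu>)"
      by (rule nn_integral_coupling_fst[OF Q sets sets_gibbs, of "\<lambda>x. f (?T x)"]) measurable
    also have "\<dots> = (\<integral>\<^sup>+ x. f x \<partial>\<nu>')"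
      unfolding \<nu>'_def by (subst nn_integral_distr[OF T]) auto
    finally show "(\<integral>\<^sup>+ w. f (fst w) \<partial>Q') = (\<integral>\<^sup>+ x. f x \<partial>\<nu>')" .
    have "(\<integral>\<^sup>+ w. f (snd w) \<partial>Q') = (\<integral>\<^sup>+ w. f (snd w) \<partial>Q)"
      unfolding Q'_def by (subst nn_integral_distr[OF T2]) auto
    also have "\<dots> = (\<integral>\<^sup>+ y. f y \<partial>gibbs U)"
      by (rule nn_integral_coupling_snd[OF Q sets sets_gibbs f])
    finally show "(\<integral>\<^sup>+ w. f (snd w) \<partial>Q') = (\<integral>\<^sup>+ y. f y \<partial>gibbs U)" .
  qed (simp add: Q'_def)
  have iU': "integrable \<nu>' U" by (rule integrable_U[OF prob' sets' int'])
  then have iU: "integrable \<nu> (\<lambda>x. U (?T x))"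
    unfolding \<nu>'_def by (subst (asm) integrable_distr_eq[OF T]) auto
  have iUg: "integrable (gibbs U) U" by (rule integrable_U[OF prob_space_gibbs sets_gibbs gibbs_norm_sq])
  have iD: "integrable Q (\<lambda>w. (dist (fst w) (snd w))\<^sup>2)"
    by (rule integrable_sq_cost[OF Q sets sets_gibbs int gibbs_norm_sq])
  have iD': "integrable Q (\<lambda>w. (dist (?T (fst w)) (snd w))\<^sup>2)"
    using integrable_sq_cost[OF Q' sets' sets_gibbs int' gibbs_norm_sq]
    unfolding Q'_def by (subst (asm) integrable_distr_eq[OF T2]) auto
  note iQ1 = integrable_coupling_fst[OF Q sets sets_gibbs iU]
    and iQ2 = integrable_coupling_snd[OF Q sets sets_gibbs iUg]
    and eQ1 = integral_coupling_fst[OF Q sets sets_gibbs iU]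
    and eQ2 = integral_coupling_snd[OF Q sets sets_gibbs iUg]
  have "sq_cost Q' = (\<integral>w. (dist (?T (fst w)) (snd w))\<^sup>2 \<partial>Q)"
    unfolding sq_cost_def Q'_def by (subst integral_distr[OF T2]) auto
  also have "\<dots> \<le> (\<integral>w. (1 - m * h) * (dist (fst w) (snd w))\<^sup>2 - 2 * h * (U (?T (fst w)) - U (snd w)) \<partial>Q)"
    using gradient_step_contraction[OF grad lip strong h]
    by (intro integral_mono) (use iD iD' iQ1 iQ2 in \<open>auto simp: dist_norm\<close>)
  also have "\<dots> = (1 - m * h) * sq_cost Q - 2 * h * ((\<integral>x. U (?T x) \<partial>\<nu>) - (\<integral>x. U x \<partial>gibbs U))"
    using iD iQ1 iQ2 by (simp add: sq_cost_def eQ1 eQ2)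
  also have "(\<integral>x. U (?T x) \<partial>\<nu>) = (\<integral>x. U x \<partial>\<nu>')"
    unfolding \<nu>'_def by (subst integral_distr[OF T]) auto
  finally show "\<exists>Q'\<in>couplings \<nu>' (gibbs U).
      sq_cost Q' \<le> (1 - m * h) * sq_cost Q - 2 * h * ((\<integral>x. U x \<partial>\<nu>') - (\<integral>x. U x \<partial>gibbs U))"
    using Q' by blast
qed

text \<open>The coupling of the point mass at 0 with \<open>gibbs U\<close> costs the second moment
  of \<open>gibbs U\<close>; this is the quantity that decays geometrically. Each iteration composes
  a gradient step with a heat flow.\<close>

lemma langevin_coupling:
  fixes \<nu> :: "nat \<Rightarrow> (real ^ 'n) measure"
  assumes h: "0 < h" "h * L \<le> 1"
    and \<nu>0: "\<nu> 0 = return borel 0"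
    and \<nu>_Suc: "\<And>k. \<nu> (Suc k) = gauss_conv (distr (\<nu> k) borel (\<lambda>x. x - h *\<^sub>R G x)) (sqrt (2 * h))"
  shows "prob_space (\<nu> k) \<and> sets (\<nu> k) = sets borel \<and> integrable (\<nu> k) (\<lambda>x. (norm x)\<^sup>2) \<and>
    (\<exists>Q\<in>couplings (\<nu> k) (gibbs U).
      sq_cost Q \<le> (1 - m * h) ^ k * (\<integral>y. (norm y)\<^sup>2 \<partial>gibbs U) + 2 * L * h * CARD('n) / m)"
proof (induction k)
  case 0
  define Q where "Q = distr (gibbs U) (borel \<Otimes>\<^sub>M borel) (\<lambda>y. (0 :: real ^ 'n, y))"
  have T: "(\<lambda>y. (0 :: real ^ 'n, y)) \<in> gibbs U \<rightarrow>\<^sub>M borel \<Otimes>\<^sub>M borel" by measurable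
  interpret prob_space "gibbs U" by (rule prob_space_gibbs)
  have "Q \<in> couplings (\<nu> 0) (gibbs U)"
    by (rule couplingsI)
      (auto simp: \<nu>0 Q_def nn_integral_distr[OF T] nn_integral_return emeasure_space_1)
  moreover have "sq_cost Q = (\<integral>y. (norm y)\<^sup>2 \<partial>gibbs U)"
    unfolding sq_cost_def Q_def by (subst integral_distr[OF T]) auto
  moreover have "0 \<le> 2 * L * h * CARD('n) / m" using L_pos m_pos h by simp
  moreover have "integrable (return borel 0) (\<lambda>x :: real ^ 'n. (norm x)\<^sup>2)"
    by (rule integrableI_bounded) (auto simp: nn_integral_return)
  ultimately show ?case by (auto simp: \<nu>0 prob_space_return intro!: bexI[of _ Q])
next
  case (Suc k)
  define p where "p = real CARD('n)"
  define S where "S = (\<integral>y. (norm y)\<^sup>2 \<partial>gibbs U)"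
  define \<nu>' where "\<nu>' = distr (\<nu> k) borel (\<lambda>x. x - h *\<^sub>R G x)"
  from Suc obtain Q where IH: "prob_space (\<nu> k)" "sets (\<nu> k) = sets borel"
      "integrable (\<nu> k) (\<lambda>x. (norm x)\<^sup>2)" "Q \<in> couplings (\<nu> k) (gibbs U)"
    and cost: "sq_cost Q \<le> (1 - m * h) ^ k * S + 2 * L * h * p / m"
    unfolding p_def S_def by blast
  note step = gradient_step_coupling[OF IH h, folded \<nu>'_def]
  obtain Q1 where Q1: "Q1 \<in> couplings \<nu>' (gibbs U)"
    "sq_cost Q1 \<le> (1 - m * h) * sq_cost Q - 2 * h * ((\<integral>x. U x \<partial>\<nu>') - (\<integral>x. U x \<partial>gibbs U))"
    using step(4) by blast
  have "0 < L * h\<^sup>2 * CARD('n)" using L_pos h by simp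
  from heat_flow_coupling[OF step(1-3) Q1(1) h(1) this]
  obtain Q2 where Q2: "Q2 \<in> couplings (\<nu> (Suc k)) (gibbs U)"
    "sq_cost Q2 \<le> sq_cost Q1 + 2 * h * ((\<integral>x. U x \<partial>\<nu>') - (\<integral>x. U x \<partial>gibbs U)) + L * h\<^sup>2 * p + L * h\<^sup>2 * p"
    unfolding \<nu>_Suc \<nu>'_def p_def by blast
  have "h * m \<le> h * L" using m_le_L h by (intro mult_left_mono) auto
  then have mh: "0 \<le> 1 - m * h" using h(2) mult.commute[of h m] by linarith
  have "sq_cost Q2 \<le> (1 - m * h) * sq_cost Q + 2 * L * h\<^sup>2 * p"
    using Q2(2) Q1(2) by linarith
  also have "(1 - m * h) * sq_cost Q \<le> (1 - m * h) * ((1 - m * h) ^ k * S + 2 * L * h * p / m)"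
    using cost mh by (rule mult_left_mono)
  \<comment> \<open>The constant 2 L h p / m is the fixed point of c \<mapsto> (1 - m h) c + 2 L h^2
    p, so it is reproduced without growth.\<close>
  also have "\<dots> + 2 * L * h\<^sup>2 * p = (1 - m * h) ^ Suc k * S + 2 * L * h * p / m"
    using m_pos by (simp add: field_simps power2_eq_square)
  finally have "sq_cost Q2 \<le> (1 - m * h) ^ Suc k * S + 2 * L * h * p / m" by simp
  then show ?case
    using Q2(1) gauss_conv_second_moment(1)[OF step(1-3)] prob_space_gauss_conv[OF step(1,2)]
    unfolding p_def S_def by (auto simp: \<nu>_Suc \<nu>'_def)
qed

end

section \<open>The laws of the iterates as a recursion on measures\<close>

lemma lmc_cong:
  "(\<And>i. 1 \<le> i \<Longrightarrow> i \<le> k \<Longrightarrow> \<xi> i \<omega> = \<xi>' i \<omega>') \<Longrightarrow> lmc G \<alpha> h \<xi> k \<omega> = lmc G \<alpha> h \<xi>' k \<omega>'"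
  by (induction k) auto

lemma measurable_lmc:
  assumes [measurable]: "G \<in> borel_measurable borel"
    and "\<And>i. 1 \<le> i \<Longrightarrow> i \<le> k \<Longrightarrow> \<xi> i \<in> borel_measurable N"
  shows "lmc G \<alpha> h \<xi> k \<in> borel_measurable N"
  using assms(2)
proof (induction k)
  case (Suc k)
  then have [measurable]: "lmc G \<alpha> h \<xi> k \<in> borel_measurable N" "\<xi> (Suc k) \<in> borel_measurable N"
    by auto
  show ?case by simp
next
  case 0
  have "lmc G \<alpha> h \<xi> 0 = (\<lambda>_. 0)" by (rule ext) simp
  then show ?case by simp
qed

text \<open>Running \<open>lmc\<close> on the coordinate projections of the noise space shows that
  the k-th iterate is a measurable function of \<xi> 1, ..., \<xi> k. It is therefore independent of
  \<xi> (Suc k), and their joint law is a product.\<close>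

lemma distr_lmc_Suc:
  fixes \<xi> :: "nat \<Rightarrow> 'w \<Rightarrow> real ^ 'n"
  assumes G [measurable]: "G \<in> borel_measurable borel"
    and P: "prob_space P" and ind: "prob_space.indep_vars P (\<lambda>_. borel) \<xi> {1..}"
    and gauss: "\<And>k. k \<ge> 1 \<Longrightarrow> distr P borel (\<xi> k) = std_gaussian"
  shows "distr P borel (lmc G \<alpha> h \<xi> (Suc k))
    = gauss_conv (distr (distr P borel (lmc G \<alpha> h \<xi> k)) borel (\<lambda>x. (1 - \<alpha> * h) *\<^sub>R x - h *\<^sub>R G x)) (sqrt (2 * h))"
proof -
  interpret prob_space P by (rule P)
  have \<xi> [measurable]: "\<xi> i \<in> borel_measurable P" if "1 \<le> i" for i
    using ind that by (auto simp: indep_vars_def)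
  have X [measurable]: "lmc G \<alpha> h \<xi> k \<in> borel_measurable P" by (rule measurable_lmc) auto
  have Z [measurable]: "\<xi> (Suc k) \<in> borel_measurable P" by simp
  have "indep_var (PiM {1..k} (\<lambda>_. borel)) (\<lambda>\<omega>. restrict (\<lambda>i. \<xi> i \<omega>) {1..k})
      (PiM {Suc k} (\<lambda>_. borel)) (\<lambda>\<omega>. restrict (\<lambda>i. \<xi> i \<omega>) {Suc k})"
    by (rule indep_var_restrict[OF ind]) auto
  then have "indep_var borel (lmc G \<alpha> h (\<lambda>i x. x i) k \<circ> (\<lambda>\<omega>. restrict (\<lambda>i. \<xi> i \<omega>) {1..k}))
      borel ((\<lambda>x. x (Suc k)) \<circ> (\<lambda>\<omega>. restrict (\<lambda>i. \<xi> i \<omega>) {Suc k}))"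
    by (rule indep_var_compose) (auto intro!: measurable_lmc)
  moreover have "lmc G \<alpha> h (\<lambda>i x. x i) k \<circ> (\<lambda>\<omega>. restrict (\<lambda>i. \<xi> i \<omega>) {1..k}) = lmc G \<alpha> h \<xi> k"
    by (rule ext, unfold comp_def, rule lmc_cong) auto
  moreover have "(\<lambda>x. x (Suc k)) \<circ> (\<lambda>\<omega>. restrict (\<lambda>i. \<xi> i \<omega>) {Suc k}) = \<xi> (Suc k)" by auto
  ultimately have "indep_var borel (lmc G \<alpha> h \<xi> k) borel (\<xi> (Suc k))" by simp
  then have joint: "distr P borel (lmc G \<alpha> h \<xi> k) \<Otimes>\<^sub>M std_gaussian
      = distr P (borel \<Otimes>\<^sub>M borel) (\<lambda>\<omega>. (lmc G \<alpha> h \<xi> k \<omega>, \<xi> (Suc k) \<omega>))"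
    using gauss[of "Suc k"] by (simp add: indep_var_distribution_eq)
  let ?T = "\<lambda>x. (1 - \<alpha> * h) *\<^sub>R x - h *\<^sub>R G x"
  show ?thesis
  proof (rule measure_eqI_nn_integral)
    interpret S: prob_space "std_gaussian :: (real ^ 'n) measure" by (rule prob_space_std_gaussian)
    fix f :: "real ^ 'n \<Rightarrow> ennreal" assume f [measurable]: "f \<in> borel_measurable borel"
    have "(\<integral>\<^sup>+ x. f x \<partial>gauss_conv (distr (distr P borel (lmc G \<alpha> h \<xi> k)) borel ?T) (sqrt (2 * h)))
        = (\<integral>\<^sup>+ x. \<integral>\<^sup>+ z. f (?T x + sqrt (2 * h) *\<^sub>R z) \<partial>std_gaussian \<partial>distr P borel (lmc G \<alpha> h \<xi> k))"
      by (subst nn_integral_gauss_conv, simp, simp, subst nn_integral_distr, measurable)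
    also have "\<dots> = (\<integral>\<^sup>+ w. f (?T (fst w) + sqrt (2 * h) *\<^sub>R snd w) \<partial>(distr P borel (lmc G \<alpha> h \<xi> k) \<Otimes>\<^sub>M std_gaussian))"
      by (subst S.nn_integral_fst[symmetric]) auto
    also have "\<dots> = (\<integral>\<^sup>+ \<omega>. f (lmc G \<alpha> h \<xi> (Suc k) \<omega>) \<partial>P)"
      unfolding joint by (subst nn_integral_distr) auto
    also have "\<dots> = (\<integral>\<^sup>+ x. f x \<partial>distr P borel (lmc G \<alpha> h \<xi> (Suc k)))"
      by (subst nn_integral_distr) (auto intro!: measurable_lmc)
    finally show "(\<integral>\<^sup>+ x. f x \<partial>distr P borel (lmc G \<alpha> h \<xi> (Suc k)))
        = (\<integral>\<^sup>+ x. f x \<partial>gauss_conv (distr (distr P borel (lmc G \<alpha> h \<xi> k)) borel ?T) (sqrt (2 * h)))" by simp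
  qed simp_all
qed

section \<open>The triangle inequality for Wasserstein distances\<close>

text \<open>Convexity of the q-th power at a / s and b / t with weights s / (s + t) and t / (s + t).
  If the q-th moments of a and b are at most s^q and t^q, integration gives exactly (s +
  t)^q.\<close>

lemma powr_convex_split:
  fixes q a b s t :: real
  assumes q: "1 \<le> q" and ab: "0 \<le> a" "0 \<le> b" and st: "0 < s" "0 < t"
  shows "(a + b) powr q \<le> (s + t) powr (q - 1) * (s powr (1 - q) * a powr q + t powr (1 - q) * b powr q)"
proof -
  have eq: "(s + t) powr (q - 1) * r powr (1 - q) = ((s + t) / r) powr (q - 1)" if "0 < r" for r
    using that st by (simp add: powr_divide powr_diff field_simps)
  have ge1: "1 \<le> (s + t) powr (q - 1) * r powr (1 - q)" if "0 < r" "r \<le> s + t" for r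
    unfolding eq[OF that(1)] using that q by (intro ge_one_powr_ge_zero) auto
  show ?thesis
  \<comment> \<open>If one number vanishes, it suffices that the coefficient of the other power is
    at least 1.\<close>
  proof (cases "a = 0 \<or> b = 0")
    case True
    then show ?thesis
    proof
      assume "a = 0"
      then show ?thesis
        using mult_right_mono[OF ge1[OF st(2)], of "b powr q"] st by (simp add: mult.assoc)
    next
      assume "b = 0"
      then show ?thesis
        using mult_right_mono[OF ge1[OF st(1)], of "a powr q"] st by (simp add: mult.assoc)
    qed
  next
    case False
    with ab have ab: "0 < a" "0 < b" by auto
    define u where "u = t / (s + t)"
    have u: "0 \<le> u" "u \<le> 1" and u1: "1 - u = s / (s + t)" using st by (simp_all add: u_def field_simps)
    have "((1 - u) * (a / s) + u * (b / t)) powr q \<le> (1 - u) * (a / s) powr q + u * (b / t) powr q"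
      using convex_onD[OF powr_convex[OF q], of u "a / s" "b / t"] u ab st by simp
    moreover have "(1 - u) * (a / s) + u * (b / t) = (a + b) / (s + t)"
      unfolding u1 using st by (simp add: u_def add_divide_distrib)
    ultimately have "(a + b) powr q / (s + t) powr q
        \<le> s / (s + t) * (a powr q / s powr q) + t / (s + t) * (b powr q / t powr q)"
      using ab st unfolding u1 by (simp add: powr_divide u_def)
    then have "(a + b) powr q
        \<le> (s / (s + t) * (a powr q / s powr q) + t / (s + t) * (b powr q / t powr q)) * (s + t) powr q"
      using st by (simp add: pos_divide_le_eq)
    also have "\<dots> = (s + t) powr (q - 1) * (s powr (1 - q) * a powr q + t powr (1 - q) * b powr q)"
    proof -
      have "(s + t) powr (q - 1) = (s + t) powr q / (s + t)" "s powr (1 - q) = s / s powr q"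
        "t powr (1 - q) = t / t powr q"
        using st by (simp_all add: powr_diff)
      then show ?thesis by (simp add: algebra_simps)
    qed
    finally show ?thesis .
  qed
qed

text \<open>Positive bounds s and t stand in for the norms, so that vanishing and infinite norms
  need no separate treatment.\<close>

lemma Minkowski_nn_integral:
  fixes f g :: "'a \<Rightarrow> real"
  assumes q: "1 \<le> q" and [measurable]: "f \<in> borel_measurable M" "g \<in> borel_measurable M"
    and nonneg: "\<And>x. 0 \<le> f x" "\<And>x. 0 \<le> g x" and st: "0 < s" "0 < t"
    and f: "(\<integral>\<^sup>+ x. ennreal (f x powr q) \<partial>M) \<le> ennreal (s powr q)"
    and g: "(\<integral>\<^sup>+ x. ennreal (g x powr q) \<partial>M) \<le> ennreal (t powr q)"
  shows "(\<integral>\<^sup>+ x. ennreal ((f x + g x) powr q) \<partial>M) \<le> ennreal ((s + t) powr q)"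
proof -
  let ?a = "(s + t) powr (q - 1) * s powr (1 - q)" and ?b = "(s + t) powr (q - 1) * t powr (1 - q)"
  have "(\<integral>\<^sup>+ x. ennreal ((f x + g x) powr q) \<partial>M)
      \<le> (\<integral>\<^sup>+ x. ennreal ?a * ennreal (f x powr q) + ennreal ?b * ennreal (g x powr q) \<partial>M)"
    using powr_convex_split[OF q nonneg(1) nonneg(2) st]
    by (intro nn_integral_mono) (simp add: algebra_simps flip: ennreal_mult ennreal_plus)
  also have "\<dots> = ennreal ?a * (\<integral>\<^sup>+ x. ennreal (f x powr q) \<partial>M) + ennreal ?b * (\<integral>\<^sup>+ x. ennreal (g x powr q) \<partial>M)"
    by (simp add: nn_integral_add nn_integral_cmult)
  also have "\<dots> \<le> ennreal ?a * ennreal (s powr q) + ennreal ?b * ennreal (t powr q)"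
    using f g by (intro add_mono mult_left_mono) auto
  also have "\<dots> = ennreal (?a * s powr q + ?b * t powr q)"
    by (simp flip: ennreal_mult ennreal_plus)
  also have "?a * s powr q + ?b * t powr q = (s + t) powr (q - 1) * (s powr (1 - q + q) + t powr (1 - q + q))"
    unfolding powr_add by (simp add: algebra_simps)
  also have "\<dots> = (s + t) powr q"
    using st by (simp add: powr_diff)
  finally show ?thesis .
qed

text \<open>Passes from squared cost to exponent q. With u = f^2 / s^2, Young's inequality is the
  tangent bound u^(q/2) \<le> 1 - q/2 + q/2 u, integrated against a probability measure.\<close>

lemma powr_nn_integral_le_square:
  assumes "prob_space M" and q: "0 < q" "q \<le> 2" and [measurable]: "f \<in> borel_measurable M"
    and nonneg: "\<And>x. 0 \<le> f x" and s: "0 < s"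
    and f: "(\<integral>\<^sup>+ x. ennreal ((f x)\<^sup>2) \<partial>M) \<le> ennreal (s\<^sup>2)"
  shows "(\<integral>\<^sup>+ x. ennreal (f x powr q) \<partial>M) \<le> ennreal (s powr q)"
proof -
  interpret prob_space M by fact
  let ?c = "1 - q / 2" and ?d = "q / 2 / s\<^sup>2"
  have *: "f x powr q \<le> s powr q * (?c + ?d * (f x)\<^sup>2)" for x
  proof -
    have "(1::real) powr ?c * ((f x)\<^sup>2 / s\<^sup>2) powr (q / 2) \<le> ?c * 1 + q / 2 * ((f x)\<^sup>2 / s\<^sup>2)"
    proof (cases "f x = 0")
      case True
      then show ?thesis using q by simp
    next
      case False
      then show ?thesis using q s by (intro Youngs_inequality_0) auto
    qed
    moreover have "((f x)\<^sup>2 / s\<^sup>2) powr (q / 2) = f x powr q / s powr q"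
      using nonneg[of x] s by (simp add: powr_divide powr_powr flip: powr_numeral)
    ultimately have "f x powr q / s powr q \<le> ?c + ?d * (f x)\<^sup>2" by simp
    then show ?thesis using s by (simp add: pos_divide_le_eq mult.commute)
  qed
  have "(\<integral>\<^sup>+ x. ennreal (f x powr q) \<partial>M)
      \<le> (\<integral>\<^sup>+ x. ennreal (s powr q * ?c) + ennreal (s powr q * ?d) * ennreal ((f x)\<^sup>2) \<partial>M)"
    using * q by (intro nn_integral_mono) (simp add: distrib_left mult.assoc flip: ennreal_mult ennreal_plus)
  also have "\<dots> = ennreal (s powr q * ?c) + ennreal (s powr q * ?d) * (\<integral>\<^sup>+ x. ennreal ((f x)\<^sup>2) \<partial>M)"
    by (simp add: nn_integral_add nn_integral_cmult emeasure_space_1)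
  also have "\<dots> \<le> ennreal (s powr q * ?c) + ennreal (s powr q * ?d) * ennreal (s\<^sup>2)"
    using f by (intro add_mono mult_left_mono) auto
  also have "\<dots> = ennreal (s powr q * ?c + s powr q * ?d * s\<^sup>2)"
    using q by (simp flip: ennreal_mult ennreal_plus)
  also have "s powr q * ?c + s powr q * ?d * s\<^sup>2 = s powr q"
    using s by (simp add: field_simps)
  finally show ?thesis .
qed

text \<open>A point is labelled by the first element of a countable dense set within \<epsilon> / 2
  of it; equal labels force distance below \<epsilon> through that element.\<close>

lemma fine_countable_partition:
  assumes "0 < \<epsilon>"
  obtains c :: "'a::{metric_space, second_countable_topology} \<Rightarrow> nat"
  where "c \<in> borel \<rightarrow>\<^sub>M count_space UNIV" "\<And>x y. c x = c y \<Longrightarrow> dist x y < \<epsilon>"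
proof -
  obtain D :: "'a set" where D: "countable D" "\<And>X. open X \<Longrightarrow> X \<noteq> {} \<Longrightarrow> \<exists>d\<in>D. d \<in> X"
    using countable_dense_setE by blast
  define c where "c x = (LEAST i. dist x (from_nat_into D i) < \<epsilon> / 2)" for x
  have c: "dist x (from_nat_into D (c x)) < \<epsilon> / 2" for x
  proof -
    obtain d where "d \<in> D" "d \<in> ball x (\<epsilon> / 2)" using D(2)[of "ball x (\<epsilon> / 2)"] assms by auto
    then have "dist x (from_nat_into D (to_nat_on D d)) < \<epsilon> / 2" using D(1) by simp
    then show ?thesis unfolding c_def by (rule LeastI)
  qed
  show thesis
  proof
    show "c \<in> borel \<rightarrow>\<^sub>M count_space UNIV" unfolding c_def by measurable
    show "dist x y < \<epsilon>" if "c x = c y" for x y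
      using dist_triangle_half_r[of "from_nat_into D (c x)" x \<epsilon> y] c[of x] c[of y] that
      by (simp add: dist_commute)
  qed
qed

text \<open>Approximate gluing: choose a cell of a fine partition with its \<open>\<nu>\<close>-probability and draw from
  both couplings independently, conditioned on the \<open>\<nu>\<close>-component lying in that cell. This avoids the
  disintegration of measures.\<close>

lemma approximate_gluing:
  fixes \<mu> \<nu> \<mu>' :: "'a::{metric_space, second_countable_topology} measure"
  assumes sets: "sets \<mu> = sets borel" "sets \<nu> = sets borel" "sets \<mu>' = sets borel"
    and prob: "prob_space \<mu>" "prob_space \<nu>" "prob_space \<mu>'"
    and Q: "Q \<in> couplings \<mu> \<nu>" and Q': "Q' \<in> couplings \<mu>' \<nu>"
    and q: "1 \<le> q" and st: "0 < s" "0 < t" and eps: "0 < \<epsilon>"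
    and s: "(\<integral>\<^sup>+ w. ennreal (dist (fst w) (snd w) powr q) \<partial>Q) \<le> ennreal (s powr q)"
    and t: "(\<integral>\<^sup>+ w. ennreal (dist (fst w) (snd w) powr q) \<partial>Q') \<le> ennreal (t powr q)"
  shows "\<exists>R\<in>couplings \<mu> \<mu>'. (\<integral>\<^sup>+ w. ennreal (dist (fst w) (snd w) powr q) \<partial>R) \<le> ennreal ((s + \<epsilon> + t) powr q)"
proof -
  interpret \<nu>: prob_space \<nu> by fact
  interpret Q: prob_space Q by (rule prob_space_coupling[OF Q sets(1,2) prob(1)])
  interpret Q': prob_space Q' by (rule prob_space_coupling[OF Q' sets(3,2) prob(3)])
  interpret QQ: pair_prob_space Q Q' ..
  note sQ [measurable_cong] = sets_coupling[OF Q sets(1,2)]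
    and sQ' [measurable_cong] = sets_coupling[OF Q' sets(3,2)]
    and [measurable_cong] = sets
  obtain c :: "'a \<Rightarrow> nat" where c [measurable]: "c \<in> borel \<rightarrow>\<^sub>M count_space UNIV"
    and dc: "\<And>x y. c x = c y \<Longrightarrow> dist x y < \<epsilon>"
    using fine_countable_partition[OF eps] by metis
  define W where "W k = emeasure \<nu> {y. c y = k}" for k
  have W: "W k \<noteq> \<infinity>" for k unfolding W_def using \<nu>.emeasure_finite by simp
  have cell [measurable]: "{y. c y = k} \<in> sets borel" for k
    using measurable_sets[OF c, of "{k}"] by (simp add: vimage_def)
  \<comment> \<open>The density, with respect to the product of the two couplings, of drawing both
    \<nu>-components from one cell. It is symmetric, so both marginals are checked by the same
    computation.\<close>
  define \<kappa> where "\<kappa> y y' = inverse (W (c y)) * indicator {y'. c y' = c y} y'" for y y'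
  have \<kappa>_sym: "\<kappa> y y' = \<kappa> y' y" for y y' by (auto simp: \<kappa>_def split: split_indicator)
  have [measurable]: "(\<lambda>w. \<kappa> (f w) (g w)) \<in> borel_measurable M"
    if [measurable]: "f \<in> borel_measurable M" "g \<in> borel_measurable M" for M and f g :: "_ \<Rightarrow> 'a"
  proof -
    have [measurable]: "(\<lambda>k. inverse (W k)) \<in> borel_measurable (count_space UNIV)" by simp
    have [measurable]: "(\<lambda>w. c (f w)) \<in> M \<rightarrow>\<^sub>M count_space UNIV" "(\<lambda>w. c (g w)) \<in> M \<rightarrow>\<^sub>M count_space UNIV"
      by (rule measurable_compose[OF _ c]; fact)+
    have [measurable]: "(\<lambda>w. inverse (W (c (f w)))) \<in> borel_measurable M"
      by (rule measurable_compose[of _ _ "count_space UNIV"]) measurable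
    have "Measurable.pred M (\<lambda>w. \<exists>k. c (g w) = k \<and> c (f w) = k)" by measurable
    then have [measurable]: "Measurable.pred M (\<lambda>w. c (g w) = c (f w))" by (simp add: eq_commute)
    have "(\<lambda>w. inverse (W (c (f w))) * (if c (g w) = c (f w) then 1 else 0)) \<in> borel_measurable M"
      by measurable
    then show ?thesis by (simp add: \<kappa>_def indicator_def)
  qed
  \<comment> \<open>The inverse of 0 is \<infinity> in \<open>ennreal\<close>, so the normalization
    of \<open>\<kappa>\<close> fails on cells of measure zero; there are countably many, so their
    union is null.\<close>
  have W0: "AE y in \<nu>. W (c y) \<noteq> 0"
  proof -
    have "AE y in \<nu>. \<forall>k. W k = 0 \<longrightarrow> c y \<noteq> k"
      unfolding AE_all_countable
    proof
      fix k
      show "AE y in \<nu>. W k = 0 \<longrightarrow> c y \<noteq> k"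
        by (cases "W k = 0") (auto intro!: AE_I[where N="{y. c y = k}"] simp: W_def sets)
    qed
    then show ?thesis by (rule eventually_mono) auto
  qed
  have \<kappa>_int: "AE y in \<nu>. (\<integral>\<^sup>+ y'. \<kappa> y y' \<partial>\<nu>) = 1"
  proof (rule eventually_mono[OF W0])
    fix y assume "W (c y) \<noteq> 0"
    moreover have "(\<integral>\<^sup>+ y'. \<kappa> y y' \<partial>\<nu>) = inverse (W (c y)) * W (c y)"
      unfolding \<kappa>_def by (subst nn_integral_cmult) (auto simp: W_def)
    ultimately show "(\<integral>\<^sup>+ y'. \<kappa> y y' \<partial>\<nu>) = 1"
      using ennreal_divide_self[of "W (c y)"] W[of "c y"]
      by (simp add: divide_ennreal_def mult.commute less_top)
  qed
  have \<kappa>_marginal: "(\<integral>\<^sup>+ w. g w * (\<integral>\<^sup>+ y'. \<kappa> (snd w) y' \<partial>\<nu>) \<partial>Q0) = (\<integral>\<^sup>+ w. g w \<partial>Q0)"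
    if Q0: "Q0 \<in> couplings \<mu>0 \<nu>" "sets \<mu>0 = sets borel" for Q0 \<mu>0 and g :: "_ \<Rightarrow> ennreal"
  proof (rule nn_integral_cong_AE)
    have "AE w in Q0. (\<integral>\<^sup>+ y'. \<kappa> (snd w) y' \<partial>\<nu>) = 1"
    proof (rule AE_distrD[OF measurable_coupling_snd[OF Q0 sets(2)]])
      show "AE y in distr Q0 \<nu> snd. (\<integral>\<^sup>+ y'. \<kappa> y y' \<partial>\<nu>) = 1"
        unfolding distr_coupling(2)[OF Q0 sets(2)] by (rule \<kappa>_int)
    qed
    then show "AE w in Q0. g w * (\<integral>\<^sup>+ y'. \<kappa> (snd w) y' \<partial>\<nu>) = g w"
      by (rule eventually_mono) simp
  qed
  define D where "D = density (Q \<Otimes>\<^sub>M Q') (\<lambda>v. \<kappa> (snd (fst v)) (snd (snd v)))"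
  have sD [measurable_cong]: "sets D = sets ((borel \<Otimes>\<^sub>M borel) \<Otimes>\<^sub>M (borel \<Otimes>\<^sub>M borel))"
    unfolding D_def using sets_pair_measure_cong[OF sQ sQ'] by simp
  have D: "(\<integral>\<^sup>+ v. \<phi> v \<partial>D) = (\<integral>\<^sup>+ v. \<kappa> (snd (fst v)) (snd (snd v)) * \<phi> v \<partial>(Q \<Otimes>\<^sub>M Q'))"
    if [measurable]: "\<phi> \<in> borel_measurable ((borel \<Otimes>\<^sub>M borel) \<Otimes>\<^sub>M (borel \<Otimes>\<^sub>M borel))" for \<phi>
    unfolding D_def by (rule nn_integral_density) measurable
  have D1: "(\<integral>\<^sup>+ v. g (fst v) \<partial>D) = (\<integral>\<^sup>+ w. g w \<partial>Q)"
    if [measurable]: "g \<in> borel_measurable (borel \<Otimes>\<^sub>M borel)" for g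
  proof -
    have "(\<integral>\<^sup>+ v. g (fst v) \<partial>D) = (\<integral>\<^sup>+ w. \<integral>\<^sup>+ w'. \<kappa> (snd w) (snd w') * g w \<partial>Q' \<partial>Q)"
      by (subst D, measurable, subst Q'.nn_integral_fst[symmetric]) auto
    also have "\<dots> = (\<integral>\<^sup>+ w. g w * (\<integral>\<^sup>+ w'. \<kappa> (snd w) (snd w') \<partial>Q') \<partial>Q)"
      by (intro nn_integral_cong, subst nn_integral_multc) (auto simp: mult.commute)
    also have "\<dots> = (\<integral>\<^sup>+ w. g w * (\<integral>\<^sup>+ y'. \<kappa> (snd w) y' \<partial>\<nu>) \<partial>Q)"
      by (intro nn_integral_cong, subst nn_integral_coupling_snd[OF Q' sets(3,2)]) auto
    also have "\<dots> = (\<integral>\<^sup>+ w. g w \<partial>Q)" by (rule \<kappa>_marginal[OF Q sets(1)])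
    finally show ?thesis .
  qed
  have D2: "(\<integral>\<^sup>+ v. g (snd v) \<partial>D) = (\<integral>\<^sup>+ w. g w \<partial>Q')"
    if [measurable]: "g \<in> borel_measurable (borel \<Otimes>\<^sub>M borel)" for g
  proof -
    have "(\<integral>\<^sup>+ v. g (snd v) \<partial>D) = (\<integral>\<^sup>+ w'. \<integral>\<^sup>+ w. \<kappa> (snd w') (snd w) * g w' \<partial>Q \<partial>Q')"
      by (subst D, measurable, subst QQ.nn_integral_snd[symmetric]) (auto simp: \<kappa>_sym)
    also have "\<dots> = (\<integral>\<^sup>+ w'. g w' * (\<integral>\<^sup>+ w. \<kappa> (snd w') (snd w) \<partial>Q) \<partial>Q')"
      by (intro nn_integral_cong, subst nn_integral_multc) (auto simp: mult.commute)
    also have "\<dots> = (\<integral>\<^sup>+ w'. g w' * (\<integral>\<^sup>+ y'. \<kappa> (snd w') y' \<partial>\<nu>) \<partial>Q')"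
      by (intro nn_integral_cong, subst nn_integral_coupling_snd[OF Q sets(1,2)]) auto
    also have "\<dots> = (\<integral>\<^sup>+ w. g w \<partial>Q')" by (rule \<kappa>_marginal[OF Q' sets(3)])
    finally show ?thesis .
  qed
  define R where "R = distr D (borel \<Otimes>\<^sub>M borel) (\<lambda>v. (fst (fst v), fst (snd v)))"
  have T: "(\<lambda>v. (fst (fst v), fst (snd v))) \<in> D \<rightarrow>\<^sub>M borel \<Otimes>\<^sub>M borel" by measurable
  have "R \<in> couplings \<mu> \<mu>'"
  proof (rule couplingsI[OF sets(1,3)])
    fix f :: "'a \<Rightarrow> ennreal" assume f [measurable]: "f \<in> borel_measurable borel"
    show "(\<integral>\<^sup>+ z. f (fst z) \<partial>R) = (\<integral>\<^sup>+ x. f x \<partial>\<mu>)"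
      unfolding R_def using D1[of "\<lambda>w. f (fst w)"] nn_integral_coupling_fst[OF Q sets(1,2) f]
      by (subst nn_integral_distr[OF T]) auto
    show "(\<integral>\<^sup>+ z. f (snd z) \<partial>R) = (\<integral>\<^sup>+ x. f x \<partial>\<mu>')"
      unfolding R_def using D2[of "\<lambda>w. f (fst w)"] nn_integral_coupling_fst[OF Q' sets(3,2) f]
      by (subst nn_integral_distr[OF T]) auto
  qed (simp add: R_def)
  moreover have "(\<integral>\<^sup>+ w. ennreal (dist (fst w) (snd w) powr q) \<partial>R) \<le> ennreal ((s + \<epsilon> + t) powr q)"
  proof -
    let ?d = "\<lambda>w. dist (fst w) (snd w) :: real"
    have "(\<integral>\<^sup>+ w. ennreal (?d w powr q) \<partial>R)
        = (\<integral>\<^sup>+ v. \<kappa> (snd (fst v)) (snd (snd v)) * ennreal (dist (fst (fst v)) (fst (snd v)) powr q) \<partial>(Q \<Otimes>\<^sub>M Q'))"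
      unfolding R_def by (subst nn_integral_distr[OF T], measurable, subst D, measurable)
    also have "\<dots> \<le> (\<integral>\<^sup>+ v. \<kappa> (snd (fst v)) (snd (snd v)) * ennreal ((?d (fst v) + \<epsilon> + ?d (snd v)) powr q) \<partial>(Q \<Otimes>\<^sub>M Q'))"
    proof (rule nn_integral_mono)
      fix v :: "('a \<times> 'a) \<times> ('a \<times> 'a)"
      obtain x y x' y' where v: "v = ((x, y), (x', y'))" by (metis surj_pair)
      show "\<kappa> (snd (fst v)) (snd (snd v)) * ennreal (dist (fst (fst v)) (fst (snd v)) powr q)
          \<le> \<kappa> (snd (fst v)) (snd (snd v)) * ennreal ((?d (fst v) + \<epsilon> + ?d (snd v)) powr q)"
      \<comment> \<open>Where the density is nonzero, y and y' share a cell, and crossing from one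
        to the other costs less than \<epsilon>.\<close>
      proof (cases "c y' = c y")
        case True
        have "dist x x' \<le> dist x y + dist y y' + dist x' y'"
          using dist_triangle[of x x' y] dist_triangle[of y x' y'] by (simp add: dist_commute)
        then have "dist x x' powr q \<le> (dist x y + \<epsilon> + dist x' y') powr q"
          using dc[of y y'] True q by (intro powr_mono2) auto
        then show ?thesis unfolding v by (intro mult_left_mono) (auto intro: ennreal_leI)
      next
        case False
        then show ?thesis by (simp add: v \<kappa>_def)
      qed
    qed
    also have "\<dots> = (\<integral>\<^sup>+ v. ennreal ((?d (fst v) + \<epsilon> + ?d (snd v)) powr q) \<partial>D)"
      by (subst D) auto
    also have "\<dots> \<le> ennreal ((s + \<epsilon> + t) powr q)"
    proof (intro Minkowski_nn_integral q)
      show "(\<integral>\<^sup>+ v. ennreal (?d (fst v) powr q) \<partial>D) \<le> ennreal (s powr q)"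
        using s by (subst D1[of "\<lambda>w. ennreal (?d w powr q)"]) auto
      show "(\<integral>\<^sup>+ v. ennreal (?d (snd v) powr q) \<partial>D) \<le> ennreal (t powr q)"
        using t by (subst D2[of "\<lambda>w. ennreal (?d w powr q)"]) auto
      show "(\<integral>\<^sup>+ v. ennreal (\<epsilon> powr q) \<partial>D) \<le> ennreal (\<epsilon> powr q)"
        using D1[of "\<lambda>_. ennreal (\<epsilon> powr q)"] by (simp add: Q.emeasure_space_1)
    qed (use st eps in auto)
    finally show ?thesis .
  qed
  ultimately show ?thesis by blast
qed

section \<open>Penalization\<close>

lemma ennreal_powr_ennreal: "0 \<le> x \<Longrightarrow> ennreal_powr (ennreal x) r = ennreal (x powr r)"
  by (simp add: ennreal_powr_def)

lemma ennreal_powr_mono: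
  assumes "x \<le> y" "0 \<le> r"
  shows "ennreal_powr x r \<le> ennreal_powr y r"
proof (cases "y = \<infinity>")
  case False
  then have "x \<noteq> \<infinity>" using assms(1) by (auto simp: top_unique)
  moreover have "enn2real x \<le> enn2real y" using assms(1) False by (intro enn2real_mono) (auto simp: less_top)
  ultimately show ?thesis using False assms by (auto simp: ennreal_powr_def intro!: ennreal_leI powr_mono2)
qed (simp add: ennreal_powr_def)

lemma ennreal_powr_powr_inverse:
  assumes "0 < q"
  shows "ennreal_powr (ennreal_powr x q) (1 / q) = x"
  using assms by (cases x) (simp_all add: ennreal_powr_def powr_powr)

lemma mu2_ennreal:
  assumes int: "integrable M (\<lambda>x. (nrm x)\<^sup>2)"
  shows "mu2 nrm M = ennreal (sqrt (\<integral>x. (nrm x)\<^sup>2 \<partial>M))"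
proof -
  have "(\<integral>\<^sup>+ x. ennreal ((nrm x)\<^sup>2) \<partial>M) = ennreal (\<integral>x. (nrm x)\<^sup>2 \<partial>M)"
    using int by (intro nn_integral_eq_integral) auto
  then show ?thesis by (simp add: mu2_def ennreal_powr_ennreal powr_half_sqrt)
qed

text \<open>Both couplings carry the intermediate measure \<nu> as second marginal, as
  \<open>approximate_gluing\<close> requires. With \<mu>' the target and \<nu> its penalized
  version, the last term has the orientation used in \<open>C_const\<close>.\<close>

lemma wasserstein_triangle_le:
  fixes \<mu> \<nu> \<mu>' :: "'a::{metric_space, second_countable_topology} measure"
  assumes sets: "sets \<mu> = sets borel" "sets \<nu> = sets borel" "sets \<mu>' = sets borel"
    and prob: "prob_space \<mu>" "prob_space \<nu>" "prob_space \<mu>'"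
    and q: "1 \<le> q" "q \<le> 2" and Q: "Q \<in> couplings \<mu> \<nu>" and V: "0 < V"
    and le: "(\<integral>\<^sup>+ w. ennreal ((dist (fst w) (snd w))\<^sup>2) \<partial>Q) \<le> ennreal V"
  shows "wasserstein dist q \<mu> \<mu>' \<le> ennreal (sqrt V) + wasserstein dist q \<mu>' \<nu>"
proof -
  interpret Q: prob_space Q by (rule prob_space_coupling[OF Q sets(1,2) prob(1)])
  note [measurable_cong] = sets_coupling[OF Q sets(1,2)]
  have Qq: "(\<integral>\<^sup>+ w. ennreal (dist (fst w) (snd w) powr q) \<partial>Q) \<le> ennreal (sqrt V powr q)"
    by (rule powr_nn_integral_le_square) (use q V le Q.prob_space_axioms in auto)
  have key: "wasserstein dist q \<mu> \<mu>' \<le> ennreal (sqrt V) +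
      ennreal_powr (\<integral>\<^sup>+ w. ennreal (dist (fst w) (snd w) powr q) \<partial>Q') (1 / q)"
    if Q': "Q' \<in> couplings \<mu>' \<nu>" for Q'
  proof (cases "(\<integral>\<^sup>+ w. ennreal (dist (fst w) (snd w) powr q) \<partial>Q') = \<infinity>")
    case True
    then show ?thesis by (simp add: ennreal_powr_def)
  next
    case False
    then obtain x where x: "0 \<le> x" "(\<integral>\<^sup>+ w. ennreal (dist (fst w) (snd w) powr q) \<partial>Q') = ennreal x"
      by (cases "\<integral>\<^sup>+ w. ennreal (dist (fst w) (snd w) powr q) \<partial>Q'") auto
    define t where "t = x powr (1 / q)"
    have t: "0 \<le> t" "t powr q = x" using q x(1) by (simp_all add: t_def powr_powr)
    have "wasserstein dist q \<mu> \<mu>' \<le> ennreal (sqrt V + t) + ennreal e" if e: "0 < e" for e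
    proof -
      \<comment> \<open>Gluing asks for strictly positive bounds while t may be 0, so half of e
        enlarges t; the other half is the mesh of the partition.\<close>
      have "x \<le> (t + e / 2) powr q" using t e q by (metis add_increasing2 half_gt_zero less_eq_real_def order_refl powr_mono2 zero_le_one order_trans)
      then have Q'q: "(\<integral>\<^sup>+ w. ennreal (dist (fst w) (snd w) powr q) \<partial>Q') \<le> ennreal ((t + e / 2) powr q)"
        unfolding x(2) by (rule ennreal_leI)
      obtain R where R: "R \<in> couplings \<mu> \<mu>'"
        "(\<integral>\<^sup>+ w. ennreal (dist (fst w) (snd w) powr q) \<partial>R) \<le> ennreal ((sqrt V + e / 2 + (t + e / 2)) powr q)"
        using approximate_gluing[OF sets prob Q Q' q(1) _ _ _ Qq Q'q, of "e / 2"] V t e by auto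
      have "wasserstein dist q \<mu> \<mu>' \<le> ennreal_powr (\<integral>\<^sup>+ w. ennreal (dist (fst w) (snd w) powr q) \<partial>R) (1 / q)"
        unfolding wasserstein_def using R(1) by (rule INF_lower)
      also have "\<dots> \<le> ennreal_powr (ennreal ((sqrt V + e / 2 + (t + e / 2)) powr q)) (1 / q)"
        using R(2) q by (intro ennreal_powr_mono) auto
      also have "\<dots> = ennreal (sqrt V + t + e)"
        using V t e q by (simp add: ennreal_powr_ennreal powr_powr)
      finally show ?thesis using V t e by (simp add: ennreal_plus[symmetric] del: ennreal_plus)
    qed
    then have "wasserstein dist q \<mu> \<mu>' \<le> ennreal (sqrt V + t)"
      by (rule ennreal_le_epsilon)
    then show ?thesis using V x by (simp add: t_def ennreal_powr_ennreal)
  qed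
  \<comment> \<open>Moving the finite term to the left leaves a bare infimum on the right.\<close>
  have "wasserstein dist q \<mu> \<mu>' - ennreal (sqrt V) \<le> wasserstein dist q \<mu>' \<nu>"
    unfolding wasserstein_def[of dist q \<mu>' \<nu>]
    by (rule INF_greatest) (use key in \<open>simp add: ennreal_minus_le_iff\<close>)
  then show ?thesis by (simp add: ennreal_minus_le_iff)
qed

text \<open>Let c be the mean of t = |x|^2 under \<open>gibbs f\<close> and w the tilt factor at t =
  c. Then (t - c) (exp (- \<alpha>/2 t) - w) \<le> 0 pointwise, and t - c integrates to 0 against
  exp (- f).\<close>

lemma integral_tilted_norm_sq_le:
  fixes f :: "real ^ 'n \<Rightarrow> real"
  assumes \<alpha>: "0 \<le> \<alpha>" and "integrable_potential f"
    and int: "integrable (gibbs f) (\<lambda>x. (norm x)\<^sup>2)"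
  defines "U \<equiv> \<lambda>x. f x + \<alpha> / 2 * (norm x)\<^sup>2"
  assumes "integrable_potential U"
  shows "(\<integral>x. (norm x)\<^sup>2 \<partial>gibbs U) \<le> (\<integral>x. (norm x)\<^sup>2 \<partial>gibbs f)"
proof -
  interpret F: integrable_potential f by fact
  interpret U: integrable_potential U by fact
  define c where "c = (\<integral>x. (norm x)\<^sup>2 \<partial>gibbs f)"
  have int_f: "integrable lborel (\<lambda>x. exp (- f x) * (norm x)\<^sup>2)"
    using int by (simp add: F.integrable_gibbs_iff)
  have le: "exp (- U x) \<le> exp (- f x)" for x using \<alpha> by (simp add: U_def)
  have int_U: "integrable lborel (\<lambda>x. exp (- U x) * (norm x)\<^sup>2)"
    by (rule Bochner_Integration.integrable_bound[OF int_f]) (auto intro!: mult_right_mono le)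
  have int_eq: "(\<integral>x. (norm x)\<^sup>2 \<partial>gibbs V) = (\<integral>x. exp (- V x) * (norm x)\<^sup>2 \<partial>lborel) / integrable_potential.Z V"
    if "integrable_potential V" for V :: "real ^ 'n \<Rightarrow> real"
  proof -
    interpret V: integrable_potential V by fact
    show ?thesis unfolding V.gibbs_eq using V.Z_pos by (subst integral_density) auto
  qed
  have c: "c * F.Z = (\<integral>x. exp (- f x) * (norm x)\<^sup>2 \<partial>lborel)"
    using int_eq[OF F.integrable_potential_axioms] F.Z_pos by (simp add: c_def)
  define w where "w = exp (- \<alpha> / 2 * c)"
  have "(\<integral>x. exp (- U x) * (norm x)\<^sup>2 - c * exp (- U x) \<partial>lborel)
      \<le> (\<integral>x. w * (exp (- f x) * (norm x)\<^sup>2 - c * exp (- f x)) \<partial>lborel)"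
  proof (rule integral_mono)
    fix x :: "real ^ 'n"
    define t where "t = (norm x)\<^sup>2"
    have U: "exp (- U x) = exp (- f x) * exp (- \<alpha> / 2 * t)"
      by (simp add: U_def t_def flip: exp_add)
    have "(t - c) * (exp (- \<alpha> / 2 * t) - w) \<le> 0"
    proof (cases "c \<le> t")
      case True
      then have "exp (- \<alpha> / 2 * t) \<le> w" unfolding w_def using \<alpha> by (auto intro!: mult_left_mono)
      then show ?thesis using True by (intro mult_nonneg_nonpos) auto
    next
      case False
      then have "w \<le> exp (- \<alpha> / 2 * t)" unfolding w_def using \<alpha> by (auto intro!: mult_left_mono)
      then show ?thesis using False by (intro mult_nonpos_nonneg) auto
    qed
    then have "exp (- f x) * ((t - c) * (exp (- \<alpha> / 2 * t) - w)) \<le> 0"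
      by (rule mult_nonneg_nonpos[rotated]) simp
    then show "exp (- U x) * (norm x)\<^sup>2 - c * exp (- U x) \<le> w * (exp (- f x) * (norm x)\<^sup>2 - c * exp (- f x))"
      unfolding U t_def[symmetric] by (simp add: algebra_simps)
  qed (use int_f int_U F.integrable_exp U.integrable_exp in auto)
  also have "\<dots> = w * ((\<integral>x. exp (- f x) * (norm x)\<^sup>2 \<partial>lborel) - c * F.Z)"
    using int_f F.integrable_exp by (simp add: F.Z_def)
  also have "\<dots> = 0" by (simp add: c)
  finally have "(\<integral>x. exp (- U x) * (norm x)\<^sup>2 \<partial>lborel) \<le> c * U.Z"
    using int_U U.integrable_exp by (simp add: U.Z_def)
  then show ?thesis
    using int_eq[OF U.integrable_potential_axioms] U.Z_pos by (simp add: c_def pos_divide_le_eq)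
qed

text \<open>The penalty supplies the fourth moment by itself: with u = \<alpha>/2 |x|^2, the bound
  u^2 \<le> 2 exp u gives |x|^4 exp (- U x) \<le> 8 / \<alpha>^2 exp (- f x).\<close>

lemma smooth_potential_tilt:
  fixes f :: "real ^ 'n \<Rightarrow> real"
  assumes conv: "convex_on UNIV f" and grad: "\<And>x. GDERIV f x :> g x"
    and lip: "\<And>x y. norm (g x - g y) \<le> M * norm (x - y)"
    and f: "integrable_potential f" and \<alpha>: "0 < \<alpha>"
  shows "smooth_potential (\<lambda>x. f x + \<alpha> / 2 * (norm x)\<^sup>2) (\<lambda>x. g x + \<alpha> *\<^sub>R x) (M + \<alpha>) \<alpha>"
proof -
  interpret F: integrable_potential f by (rule f)
  let ?U = "\<lambda>x. f x + \<alpha> / 2 * (norm x)\<^sup>2"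
  have bnd: "exp (- ?U x) \<le> exp (- f x)" for x using \<alpha> by simp
  show ?thesis
  proof
    show "?U \<in> borel_measurable borel" by measurable
    show "integrable lborel (\<lambda>x. exp (- ?U x))"
      by (rule Bochner_Integration.integrable_bound[OF F.integrable_exp]) (use bnd in auto)
    show "0 < \<alpha>" by (rule \<alpha>)
    fix x y :: "real ^ 'n"
    have "((\<lambda>x. x \<bullet> x) has_derivative (\<lambda>h. x \<bullet> h + h \<bullet> x)) (at x)"
      by (auto intro!: derivative_eq_intros)
    then have "((\<lambda>x. f x + \<alpha> / 2 * (x \<bullet> x)) has_derivative (\<lambda>h. h \<bullet> g x + \<alpha> / 2 * (x \<bullet> h + h \<bullet> x))) (at x)"
      using grad[of x] unfolding gderiv_def by (intro has_derivative_add has_derivative_mult_right) auto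
    moreover have "(\<lambda>h. h \<bullet> g x + \<alpha> / 2 * (x \<bullet> h + h \<bullet> x)) = (\<lambda>h. h \<bullet> (g x + \<alpha> *\<^sub>R x))"
      by (auto simp: inner_add_right inner_commute)
    ultimately show "GDERIV ?U x :> g x + \<alpha> *\<^sub>R x"
      unfolding gderiv_def power2_norm_eq_inner by simp
    have "norm ((g x + \<alpha> *\<^sub>R x) - (g y + \<alpha> *\<^sub>R y)) \<le> norm (g x - g y) + norm (\<alpha> *\<^sub>R (x - y))"
      using norm_triangle_ineq[of "g x - g y" "\<alpha> *\<^sub>R (x - y)"] by (simp add: algebra_simps)
    also have "\<dots> \<le> (M + \<alpha>) * norm (x - y)" using lip[of x y] \<alpha> by (simp add: distrib_right)
    finally show "norm ((g x + \<alpha> *\<^sub>R x) - (g y + \<alpha> *\<^sub>R y)) \<le> (M + \<alpha>) * norm (x - y)" .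
    have eq: "(norm y)\<^sup>2 = (norm x)\<^sup>2 + 2 * (x \<bullet> (y - x)) + (norm (y - x))\<^sup>2"
      unfolding power2_norm_eq_inner by (simp add: inner_diff_left inner_diff_right inner_commute)
    have "\<alpha> / 2 * (norm y)\<^sup>2 = \<alpha> / 2 * (norm x)\<^sup>2 + \<alpha> * (x \<bullet> (y - x)) + \<alpha> / 2 * (norm (y - x))\<^sup>2"
      unfolding eq by (simp add: distrib_left)
    then show "?U x + (g x + \<alpha> *\<^sub>R x) \<bullet> (y - x) + \<alpha> / 2 * (norm (y - x))\<^sup>2 \<le> ?U y"
      using convex_above_gradient[OF conv grad, of x y] unfolding inner_add_left inner_scaleR_left
      by linarith
  next
    show "integrable lborel (\<lambda>x. exp (- ?U x) * norm x ^ 4)"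
    proof (rule Bochner_Integration.integrable_bound)
      show "integrable lborel (\<lambda>x. 8 / \<alpha>\<^sup>2 * exp (- f x))" using F.integrable_exp by simp
      have "exp (- ?U x) * norm x ^ 4 \<le> 8 / \<alpha>\<^sup>2 * exp (- f x)" for x
      proof -
        define u where "u = \<alpha> / 2 * (norm x)\<^sup>2"
        have u: "0 \<le> u" using \<alpha> by (simp add: u_def)
        have "norm x ^ 4 = ((norm x)\<^sup>2)\<^sup>2" by (simp flip: power_mult)
        also have "\<dots> = (2 / \<alpha> * u)\<^sup>2" using \<alpha> by (simp add: u_def)
        also have "\<dots> = 4 / \<alpha>\<^sup>2 * u\<^sup>2" by (simp add: power_mult_distrib power_divide)
        also have "\<dots> \<le> 4 / \<alpha>\<^sup>2 * (2 * exp u)"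
          using exp_lower_Taylor_quadratic[OF u] u by (intro mult_left_mono) auto
        finally have "exp (- ?U x) * norm x ^ 4 \<le> exp (- ?U x) * (8 / \<alpha>\<^sup>2 * exp u)"
          by (intro mult_left_mono) auto
        also have "\<dots> = 8 / \<alpha>\<^sup>2 * exp (- ?U x + u)" unfolding exp_add by simp
        also have "- ?U x + u = - f x" by (simp add: u_def)
        finally show ?thesis .
      qed
      then show "AE x in lborel. norm (exp (- ?U x) * norm x ^ 4) \<le> norm (8 / \<alpha>\<^sup>2 * exp (- f x))"
        by (intro AE_I2) simp
    qed measurable
  qed
qed

text \<open>A coupling of A and B is pushed forward by T in both components at equal cost. This
  carries bounds from the coordinate spaces with \<open>dist_pow\<close> over to
  \<open>real ^ 'n\<close>.\<close>

lemma wasserstein_distr_le: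
  fixes T :: "'b \<Rightarrow> 'a::{metric_space, second_countable_topology}"
  assumes sets: "sets A = sets S" "sets B = sets S" and T: "T \<in> S \<rightarrow>\<^sub>M borel" and q: "0 < q"
    and d: "\<And>x y. x \<in> space S \<Longrightarrow> y \<in> space S \<Longrightarrow> dist (T x) (T y) = d x y"
  shows "wasserstein dist q (distr A borel T) (distr B borel T) \<le> wasserstein d q A B"
  unfolding wasserstein_def[of d]
proof (rule INF_greatest)
  fix Q assume "Q \<in> couplings A B"
  then have Q: "sets Q = sets (A \<Otimes>\<^sub>M B)" "distr Q A fst = A" "distr Q B snd = B"
    by (auto simp: couplings_def)
  have TA [measurable]: "T \<in> A \<rightarrow>\<^sub>M borel" and TB [measurable]: "T \<in> B \<rightarrow>\<^sub>M borel"
    using T measurable_cong_sets[OF sets(1) refl] measurable_cong_sets[OF sets(2) refl] by auto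
  note [measurable_cong] = Q(1)
  have space_Q: "space Q = space S \<times> space S"
    using sets_eq_imp_space_eq[OF Q(1)] sets_eq_imp_space_eq[OF sets(1)] sets_eq_imp_space_eq[OF sets(2)]
    by (simp add: space_pair_measure)
  have fstQ [measurable]: "fst \<in> Q \<rightarrow>\<^sub>M A" and sndQ [measurable]: "snd \<in> Q \<rightarrow>\<^sub>M B" by measurable
  define Q' where "Q' = distr Q (borel \<Otimes>\<^sub>M borel) (\<lambda>w. (T (fst w), T (snd w)))"
  have TT: "(\<lambda>w. (T (fst w), T (snd w))) \<in> Q \<rightarrow>\<^sub>M borel \<Otimes>\<^sub>M borel" by measurable
  have "Q' \<in> couplings (distr A borel T) (distr B borel T)"
  proof (rule couplingsI)
    fix f :: "'a \<Rightarrow> ennreal" assume f [measurable]: "f \<in> borel_measurable borel"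
    have "(\<integral>\<^sup>+ w. f (T (fst w)) \<partial>Q) = (\<integral>\<^sup>+ x. f (T x) \<partial>distr Q A fst)"
      by (subst nn_integral_distr) auto
    then show "(\<integral>\<^sup>+ w. f (fst w) \<partial>Q') = (\<integral>\<^sup>+ x. f x \<partial>distr A borel T)"
      unfolding Q'_def Q(2) by (simp add: nn_integral_distr[OF TT] nn_integral_distr[OF TA])
    have "(\<integral>\<^sup>+ w. f (T (snd w)) \<partial>Q) = (\<integral>\<^sup>+ x. f (T x) \<partial>distr Q B snd)"
      by (subst nn_integral_distr) auto
    then show "(\<integral>\<^sup>+ w. f (snd w) \<partial>Q') = (\<integral>\<^sup>+ x. f x \<partial>distr B borel T)"
      unfolding Q'_def Q(3) by (simp add: nn_integral_distr[OF TT] nn_integral_distr[OF TB])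
  qed (simp_all add: Q'_def)
  then have "wasserstein dist q (distr A borel T) (distr B borel T)
      \<le> ennreal_powr (\<integral>\<^sup>+ w. ennreal (dist (fst w) (snd w) powr q) \<partial>Q') (1 / q)"
    unfolding wasserstein_def by (rule INF_lower)
  also have "(\<integral>\<^sup>+ w. ennreal (dist (fst w) (snd w) powr q) \<partial>Q')
      = (\<integral>\<^sup>+ w. ennreal (dist (T (fst w)) (T (snd w)) powr q) \<partial>Q)"
    unfolding Q'_def by (simp add: nn_integral_distr[OF TT])
  also have "\<dots> = (\<integral>\<^sup>+ w. ennreal (d (fst w) (snd w) powr q) \<partial>Q)"
    by (rule nn_integral_cong) (auto simp: space_Q d)
  finally show "wasserstein dist q (distr A borel T) (distr B borel T)
      \<le> ennreal_powr (\<integral>\<^sup>+ z. ennreal (d (fst z) (snd z) powr q) \<partial>Q) (1 / q)" .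
qed

text \<open>An enumeration of the coordinates gives an isometry \<open>\<Phi>\<close> that maps
  Lebesgue measure to Lebesgue measure. An admissible C can then be applied to the density of
  \<open>gibbs f\<close> read on the coordinate space of dimension p.\<close>

lemma gibbs_tilt_wasserstein_le:
  fixes f :: "real ^ 'n \<Rightarrow> real"
  assumes conv: "convex_on UNIV f" and "integrable_potential f" and \<alpha>: "0 \<le> \<alpha>" and q: "0 < q"
  defines "U \<equiv> \<lambda>x. f x + \<alpha> / 2 * (norm x)\<^sup>2"
  assumes "integrable_potential U"
    and C: "\<forall>p g \<alpha>. 1 \<le> p \<longrightarrow> log_concave_density p g \<longrightarrow> 0 \<le> \<alpha> \<longrightarrow>
           (let \<pi> = density (lborel_pow p) (\<lambda>x. ennreal (g x));
                \<pi>\<^sub>\<alpha> = density (lborel_pow p) (\<lambda>x. ennreal (tilted_density p \<alpha> g x))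
            in ennreal_powr (wasserstein (dist_pow p) q \<pi> \<pi>\<^sub>\<alpha>) q
                 \<le> ennreal C * ennreal \<alpha> * ennreal_powr (mu2 (norm_pow p) \<pi>) (q + 2))"
  shows "ennreal_powr (wasserstein dist q (gibbs f) (gibbs U)) q
    \<le> ennreal C * ennreal \<alpha> * ennreal_powr (mu2 norm (gibbs f)) (q + 2)"
proof -
  interpret F: integrable_potential f by fact
  interpret U: integrable_potential U by fact
  define p where "p = CARD('n)"
  obtain e :: "'n \<Rightarrow> nat" where e: "bij_betw e UNIV {..<p}"
    using ex_bij_betw_finite_nat[of "UNIV :: 'n set"] by (auto simp: p_def atLeast0LessThan)
  define \<Phi> :: "(nat \<Rightarrow> real) \<Rightarrow> real ^ 'n" where "\<Phi> x = (\<chi> i. x (e i))" for x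
  have eI: "e i \<in> {..<p}" for i using e by (auto simp: bij_betw_def)
  have \<Phi> [measurable]: "\<Phi> \<in> lborel_pow p \<rightarrow>\<^sub>M borel"
    unfolding \<Phi>_def lborel_pow_def by (rule measurable_vec_lambda) (use eI in measurable)
  have lb: "distr (lborel_pow p) borel \<Phi> = lborel"
    unfolding \<Phi>_def lborel_pow_def using lborel_vec_eq[OF e] by simp
  have norm_\<Phi>: "norm (\<Phi> x) = norm_pow p x" for x
    unfolding norm_pow_def norm_vec_def L2_set_def
    by (simp add: \<Phi>_def sum.reindex_bij_betw[OF e, of "\<lambda>i. (x i)\<^sup>2"])
  have dist_\<Phi>: "dist (\<Phi> x) (\<Phi> y) = dist_pow p x y" for x y
  proof -
    have "\<Phi> x - \<Phi> y = \<Phi> (\<lambda>i. x i - y i)" by (simp add: \<Phi>_def vec_eq_iff)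
    then show ?thesis by (simp add: dist_norm norm_\<Phi> norm_pow_def dist_pow_def)
  qed
  define g where "g x = exp (- f (\<Phi> x)) / F.Z" for x
  have push: "distr (density (lborel_pow p) (\<lambda>x. ennreal (exp (- V (\<Phi> x)) / integrable_potential.Z V))) borel \<Phi> = gibbs V"
    if "integrable_potential V" for V :: "real ^ 'n \<Rightarrow> real"
  proof -
    interpret V: integrable_potential V by fact
    show ?thesis
      unfolding V.gibbs_eq lb[symmetric] by (subst density_distr) auto
  qed
  have tilt: "tilted_density p \<alpha> g x = exp (- U (\<Phi> x)) / U.Z" for x
  proof -
    \<comment> \<open>The density g already carries the factor 1 / F.Z, which cancels in the
      quotient defining \<open>tilted_density\<close>.\<close>
    have *: "g v * exp (- \<alpha> * (norm_pow p v)\<^sup>2 / 2) = exp (- U (\<Phi> v)) / F.Z" for v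
      by (simp add: g_def U_def norm_\<Phi> flip: exp_add)
    have "(\<integral> v. exp (- U (\<Phi> v)) / F.Z \<partial>lborel_pow p) = (\<integral> v. exp (- U v) / F.Z \<partial>lborel)"
      unfolding lb[symmetric] by (subst integral_distr) auto
    also have "\<dots> = U.Z / F.Z" by (simp add: U.Z_def)
    finally show ?thesis
      unfolding tilted_density_def * using F.Z_pos by simp
  qed
  have mass: "(\<integral>\<^sup>+ x. ennreal (g x) \<partial>lborel_pow p) = 1"
  proof -
    have "(\<integral>\<^sup>+ x. ennreal (g x) \<partial>lborel_pow p) = (\<integral>\<^sup>+ x. ennreal (exp (- f x) / F.Z) \<partial>lborel)"
      unfolding lb[symmetric] g_def by (subst nn_integral_distr) auto
    also have "\<dots> = (\<integral>\<^sup>+ x. 1 \<partial>gibbs f)" by (subst F.nn_integral_gibbs) auto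
    also have "\<dots> = 1" using prob_space.emeasure_space_1[OF F.prob_space_gibbs] by simp
    finally show ?thesis .
  qed
  have "log_concave_density p g"
    unfolding log_concave_density_def
  proof (intro conjI ballI)
    show "g \<in> borel_measurable (lborel_pow p)" unfolding g_def by measurable
    show "0 \<le> g x" for x using F.Z_pos by (simp add: g_def)
    fix x y :: "nat \<Rightarrow> real" and t :: real assume t: "t \<in> {0<..<1}"
    have "\<Phi> (\<lambda>i\<in>{..<p}. (1 - t) * x i + t * y i) = (1 - t) *\<^sub>R \<Phi> x + t *\<^sub>R \<Phi> y"
      using eI by (simp add: \<Phi>_def vec_eq_iff)
    then have "f (\<Phi> (\<lambda>i\<in>{..<p}. (1 - t) * x i + t * y i)) \<le> (1 - t) * f (\<Phi> x) + t * f (\<Phi> y)"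
      using convex_onD[OF conv, of t "\<Phi> x" "\<Phi> y"] t by simp
    then have "exp (- ((1 - t) * f (\<Phi> x) + t * f (\<Phi> y))) / F.Z \<le> g (\<lambda>i\<in>{..<p}. (1 - t) * x i + t * y i)"
      unfolding g_def using F.Z_pos by (intro divide_right_mono) auto
    moreover have "g x powr (1 - t) * g y powr t = exp (- ((1 - t) * f (\<Phi> x) + t * f (\<Phi> y))) / F.Z"
    proof -
      have "F.Z powr (1 - t) * F.Z powr t = F.Z" using F.Z_pos by (simp flip: powr_add)
      moreover have "exp (- f (\<Phi> x)) powr (1 - t) * exp (- f (\<Phi> y)) powr t
          = exp (- ((1 - t) * f (\<Phi> x) + t * f (\<Phi> y)))"
        by (simp add: powr_def algebra_simps flip: exp_add)
      ultimately show ?thesis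
        using F.Z_pos by (simp add: g_def powr_divide)
    qed
    ultimately show "g x powr (1 - t) * g y powr t \<le> g (\<lambda>i\<in>{..<p}. (1 - t) * x i + t * y i)" by simp
  qed (rule mass)
  moreover have "1 \<le> p" by (simp add: p_def Suc_le_eq)
  ultimately have main: "ennreal_powr (wasserstein (dist_pow p) q (density (lborel_pow p) (\<lambda>x. ennreal (g x)))
        (density (lborel_pow p) (\<lambda>x. ennreal (exp (- U (\<Phi> x)) / U.Z)))) q
      \<le> ennreal C * ennreal \<alpha> * ennreal_powr (mu2 (norm_pow p) (density (lborel_pow p) (\<lambda>x. ennreal (g x)))) (q + 2)"
    using C[rule_format, of p g \<alpha>, unfolded Let_def] \<alpha> by (simp only: tilt)
  have "wasserstein dist q (gibbs f) (gibbs U)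
      \<le> wasserstein (dist_pow p) q (density (lborel_pow p) (\<lambda>x. ennreal (g x)))
        (density (lborel_pow p) (\<lambda>x. ennreal (exp (- U (\<Phi> x)) / U.Z)))"
    unfolding push[OF F.integrable_potential_axioms, symmetric] push[OF U.integrable_potential_axioms, symmetric] g_def
    by (rule wasserstein_distr_le[where S="lborel_pow p"]) (auto simp: dist_\<Phi> q)
  then have "ennreal_powr (wasserstein dist q (gibbs f) (gibbs U)) q
      \<le> ennreal_powr (wasserstein (dist_pow p) q (density (lborel_pow p) (\<lambda>x. ennreal (g x)))
        (density (lborel_pow p) (\<lambda>x. ennreal (exp (- U (\<Phi> x)) / U.Z)))) q"
    using q by (intro ennreal_powr_mono) auto
  also note main
  also have "mu2 (norm_pow p) (density (lborel_pow p) (\<lambda>x. ennreal (g x))) = mu2 norm (gibbs f)"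
    unfolding mu2_def push[OF F.integrable_potential_axioms, symmetric] g_def
    by (subst nn_integral_distr) (auto simp: norm_\<Phi>)
  finally show ?thesis .
qed

text \<open>Dividing by a positive finite B moves it across the infimum. An empty S is included: the
  infimum is then \<infinity>, which is the case of an infinite \<open>C_const\<close>.\<close>

lemma ennreal_le_INF_mult:
  fixes B X :: ennreal
  assumes "B \<noteq> 0" "B \<noteq> \<infinity>" and "\<And>c. c \<in> S \<Longrightarrow> X \<le> h c * B"
  shows "X \<le> (INF c\<in>S. h c) * B"
proof -
  have "X / B \<le> (INF c\<in>S. h c)"
  proof (rule INF_greatest)
    fix c assume "c \<in> S"
    then have "X / B \<le> h c * B / B" using assms(3) by (intro divide_right_mono_ennreal) auto
    then show "X / B \<le> h c" using assms(1,2) by (simp add: mult_divide_eq_ennreal)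
  qed
  then have "X / B * B \<le> (INF c\<in>S. h c) * B" by (rule mult_right_mono) simp
  moreover have "X / B * B = X"
    using assms(1,2) ennreal_divide_self[of B] by (simp add: ennreal_times_divide[symmetric] ennreal_divide_times less_top)
  ultimately show ?thesis by simp
qed

text \<open>A law with a Lebesgue density cannot be concentrated at 0. Positivity keeps the factor
  of \<open>C_const\<close> nonzero, so that infimum and multiplication can be exchanged.\<close>

lemma gibbs_norm_sq_pos:
  fixes f :: "real ^ 'a \<Rightarrow> real"
  assumes "integrable_potential f" and int: "integrable (gibbs f) (\<lambda>x. (norm x)\<^sup>2)"
  shows "0 < (\<integral>x. (norm x)\<^sup>2 \<partial>gibbs f)"
proof -
  interpret F: integrable_potential f by fact
  have "(\<integral>x. (norm x)\<^sup>2 \<partial>gibbs f) \<noteq> 0"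
  proof
    assume "(\<integral>x. (norm x)\<^sup>2 \<partial>gibbs f) = 0"
    then have "AE x in gibbs f. (norm x)\<^sup>2 = 0"
      using int by (subst (asm) integral_nonneg_eq_0_iff_AE) auto
    then have "AE x in (lborel :: (real ^ 'a) measure). x = 0"
      unfolding F.gibbs_eq using F.Z_pos by (subst (asm) AE_density) auto
    moreover have "AE x in lborel. x \<noteq> (0 :: real ^ 'a)" by (rule AE_lborel_singleton)
    ultimately have "AE x in (lborel :: (real ^ 'a) measure). False" by eventually_elim simp
    then show False by (simp add: AE_iff_null null_sets_def emeasure_lborel_UNIV)
  qed
  moreover have "0 \<le> (\<integral>x. (norm x)\<^sup>2 \<partial>gibbs f)" by simp
  ultimately show ?thesis by linarith
qed

theorem theorem1:
  fixes f :: "real ^ 'n \<Rightarrow> real"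
    and grad_f :: "real ^ 'n \<Rightarrow> real ^ 'n"
    and M q \<alpha> h :: real
    and K :: nat
    and P :: "'w measure"
    and \<xi> :: "nat \<Rightarrow> 'w \<Rightarrow> real ^ 'n"
  assumes "convex_on UNIV f"
    and "\<And>\<theta>. GDERIV f \<theta> :> grad_f \<theta>"
    and "continuous_on UNIV grad_f"
    and "M > 0"
    and "\<And>\<theta> \<theta>'. norm (grad_f \<theta> - grad_f \<theta>') \<le> M * norm (\<theta> - \<theta>')"
    and "integrable lborel (\<lambda>\<theta>. exp (- f \<theta>))"
    and "1 \<le> q" "q \<le> 2"
    and "0 < \<alpha>" "\<alpha> \<le> M / 20"
    and "0 < h" "h \<le> 1 / (M + \<alpha>)"
    and "prob_space P"
    and "prob_space.indep_vars P (\<lambda>_. borel) \<xi> {1..}"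
    and "\<And>k. k \<ge> 1 \<Longrightarrow> distr P borel (\<xi> k) = std_gaussian"
  shows "wasserstein dist q (distr P borel (lmc grad_f \<alpha> h \<xi> K)) (gibbs f)
    \<le> mu2 norm (gibbs f) * ennreal ((1 - \<alpha> * h) powr (real K / 2))
      + ennreal ((2.1 * h * M * real CARD('n) / \<alpha>) powr (1 / 2))
      + ennreal_powr (C_const q * ennreal \<alpha> * ennreal_powr (mu2 norm (gibbs f)) (q + 2)) (1 / q)"
proof -
  note conv = assms(1) and grad = assms(2) and cont = assms(3) and M = assms(4) and lip = assms(5)
    and q = assms(7,8) and \<alpha> = assms(9,10) and h = assms(11,12)
    and P = assms(13) and ind = assms(14) and gauss = assms(15)
  have f: "integrable_potential f"
  proof
    show "f \<in> borel_measurable borel"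
      using grad by (intro borel_measurable_continuous_onI continuous_at_imp_continuous_on)
        (auto simp: gderiv_def intro: has_derivative_continuous)
    show "integrable lborel (\<lambda>x. exp (- f x))" by (rule assms(6))
  qed
  interpret F: integrable_potential f by (rule f)
  define U where "U = (\<lambda>x. f x + \<alpha> / 2 * (norm x)\<^sup>2)"
  define G where "G = (\<lambda>x. grad_f x + \<alpha> *\<^sub>R x)"
  interpret S: smooth_potential U G "M + \<alpha>" \<alpha>
    unfolding U_def G_def by (rule smooth_potential_tilt[OF conv grad lip f \<alpha>(1)])
  have hL: "h * (M + \<alpha>) \<le> 1" using h M \<alpha> by (simp add: pos_le_divide_eq)
  have ah: "0 < 1 - \<alpha> * h"
  proof -
    have "0 < h * M" using h M by simp
    then show ?thesis using hL by (simp add: algebra_simps)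
  qed
  have [measurable]: "grad_f \<in> borel_measurable borel"
    using cont by (rule borel_measurable_continuous_onI)
  interpret P: prob_space P by (rule P)
  define p where "p = real CARD('n)"
  define \<nu> where "\<nu> k = distr P borel (lmc grad_f \<alpha> h \<xi> k)" for k
  have T: "(\<lambda>x. (1 - \<alpha> * h) *\<^sub>R x - h *\<^sub>R grad_f x) = (\<lambda>x. x - h *\<^sub>R G x)"
    by (auto simp: G_def algebra_simps)
  have "lmc grad_f \<alpha> h \<xi> 0 = (\<lambda>_. 0)" by (rule ext) simp
  then have "\<nu> 0 = return borel 0" by (simp add: \<nu>_def)
  moreover have "\<nu> (Suc k) = gauss_conv (distr (\<nu> k) borel (\<lambda>x. x - h *\<^sub>R G x)) (sqrt (2 * h))" for k
    unfolding \<nu>_def T[symmetric] by (rule distr_lmc_Suc[OF _ P ind gauss]) simp_all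
  ultimately obtain Q where \<nu>: "prob_space (\<nu> K)" "sets (\<nu> K) = sets borel" "integrable (\<nu> K) (\<lambda>x. (norm x)\<^sup>2)"
    and Q: "Q \<in> couplings (\<nu> K) (gibbs U)"
      "sq_cost Q \<le> (1 - \<alpha> * h) ^ K * (\<integral>y. (norm y)\<^sup>2 \<partial>gibbs U) + 2 * (M + \<alpha>) * h * p / \<alpha>"
    using S.langevin_coupling[OF h(1) hL, of \<nu> K] unfolding p_def by blast
  show ?thesis
  \<comment> \<open>An infinite second moment makes the right side infinite, because the contraction
    factor multiplying it is strictly positive by \<open>ah\<close>.\<close>
  proof (cases "mu2 norm (gibbs f) = \<infinity>")
    case True
    then show ?thesis using ah by (simp add: ennreal_top_mult)
  next
    case False
    have "(\<integral>\<^sup>+ x. ennreal ((norm x)\<^sup>2) \<partial>gibbs f) \<noteq> \<infinity>"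
      using False by (auto simp: mu2_def ennreal_powr_def)
    then have int: "integrable (gibbs f) (\<lambda>x. (norm x)\<^sup>2)"
      by (intro integrableI_nonneg) (auto simp: less_top)
    define s where "s = (\<integral>x. (norm x)\<^sup>2 \<partial>gibbs f)"
    have s: "0 < s" unfolding s_def by (rule gibbs_norm_sq_pos[OF f int])
    have mu2: "mu2 norm (gibbs f) = ennreal (sqrt s)" unfolding s_def by (rule mu2_ennreal[OF int])
    have "(\<integral>y. (norm y)\<^sup>2 \<partial>gibbs U) \<le> s"
      unfolding s_def U_def
      by (rule integral_tilted_norm_sq_le) (use \<alpha> f int S.integrable_potential_axioms in \<open>simp_all add: U_def\<close>)
    then have "(1 - \<alpha> * h) ^ K * (\<integral>y. (norm y)\<^sup>2 \<partial>gibbs U) \<le> (1 - \<alpha> * h) ^ K * s"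
      using ah by (intro mult_left_mono) auto
    moreover have "2 * (M + \<alpha>) * h * p / \<alpha> \<le> 2.1 * h * M * p / \<alpha>"
    proof (rule divide_right_mono)
      have "(2 * (M + \<alpha>)) * (h * p) \<le> (2.1 * M) * (h * p)"
        using \<alpha> h by (intro mult_right_mono) (auto simp: p_def)
      then show "2 * (M + \<alpha>) * h * p \<le> 2.1 * h * M * p" by (simp add: mult_ac)
    qed (use \<alpha> in simp)
    ultimately have cost: "sq_cost Q \<le> (1 - \<alpha> * h) ^ K * s + 2.1 * h * M * p / \<alpha>"
      using Q(2) by linarith
    define V where "V = (1 - \<alpha> * h) ^ K * s + 2.1 * h * M * p / \<alpha>"
    have V: "0 < V" unfolding V_def using ah s h M \<alpha> by (intro add_pos_nonneg) (auto simp: p_def)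
    have "integrable Q (\<lambda>w. (dist (fst w) (snd w))\<^sup>2)"
      by (rule integrable_sq_cost[OF Q(1) \<nu>(2) S.sets_gibbs \<nu>(3) S.gibbs_norm_sq])
    then have "(\<integral>\<^sup>+ w. ennreal ((dist (fst w) (snd w))\<^sup>2) \<partial>Q) = ennreal (sq_cost Q)"
      unfolding sq_cost_def by (intro nn_integral_eq_integral) auto
    also have "\<dots> \<le> ennreal V" using cost unfolding V_def by (rule ennreal_leI)
    finally have le: "(\<integral>\<^sup>+ w. ennreal ((dist (fst w) (snd w))\<^sup>2) \<partial>Q) \<le> ennreal V" .
    have tri: "wasserstein dist q (\<nu> K) (gibbs f) \<le> ennreal (sqrt V) + wasserstein dist q (gibbs f) (gibbs U)"
      by (rule wasserstein_triangle_le[OF \<nu>(2) S.sets_gibbs F.sets_gibbs \<nu>(1) S.prob_space_gibbs F.prob_space_gibbs q Q(1) V le])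
    have "ennreal (sqrt V) \<le> ennreal (sqrt s * (1 - \<alpha> * h) powr (real K / 2) + (2.1 * h * M * p / \<alpha>) powr (1 / 2))"
    proof (rule ennreal_leI)
      have "sqrt V \<le> sqrt ((1 - \<alpha> * h) ^ K * s) + sqrt (2.1 * h * M * p / \<alpha>)"
        unfolding V_def using ah s h M \<alpha> by (intro sqrt_add_le_add_sqrt) (auto simp: p_def)
      also have "sqrt ((1 - \<alpha> * h) ^ K * s) = sqrt s * (1 - \<alpha> * h) powr (real K / 2)"
      proof -
        have "(1 - \<alpha> * h) powr (real K / 2) = ((1 - \<alpha> * h) powr real K) powr (1 / 2)"
          by (simp add: powr_powr)
        also have "\<dots> = sqrt ((1 - \<alpha> * h) ^ K)" using ah by (simp add: powr_realpow powr_half_sqrt)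
        finally show ?thesis by (simp add: real_sqrt_mult)
      qed
      also have "sqrt (2.1 * h * M * p / \<alpha>) = (2.1 * h * M * p / \<alpha>) powr (1 / 2)"
        using h M \<alpha> by (subst powr_half_sqrt) (auto simp: p_def)
      finally show "sqrt V \<le> sqrt s * (1 - \<alpha> * h) powr (real K / 2) + (2.1 * h * M * p / \<alpha>) powr (1 / 2)" .
    qed
    also have "\<dots> = mu2 norm (gibbs f) * ennreal ((1 - \<alpha> * h) powr (real K / 2)) + ennreal ((2.1 * h * M * p / \<alpha>) powr (1 / 2))"
      unfolding mu2 using s by (simp add: ennreal_mult)
    finally have lmc_error: "ennreal (sqrt V) \<le> mu2 norm (gibbs f) * ennreal ((1 - \<alpha> * h) powr (real K / 2))
        + ennreal ((2.1 * h * M * p / \<alpha>) powr (1 / 2))" .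
    have penalty: "wasserstein dist q (gibbs f) (gibbs U)
        \<le> ennreal_powr (C_const q * ennreal \<alpha> * ennreal_powr (mu2 norm (gibbs f)) (q + 2)) (1 / q)"
    proof -
      define B where "B = ennreal \<alpha> * ennreal_powr (mu2 norm (gibbs f)) (q + 2)"
      have B: "B = ennreal (\<alpha> * sqrt s powr (q + 2))"
        unfolding B_def mu2 using s \<alpha> by (simp add: ennreal_powr_ennreal ennreal_mult)
      have "ennreal_powr (wasserstein dist q (gibbs f) (gibbs U)) q \<le> C_const q * B"
        unfolding C_const_def
      \<comment> \<open>Every admissible C yields the bound with the same factor B; since \<alpha>
        and s are positive and finite, it passes to the infimum.\<close>
      proof (rule ennreal_le_INF_mult)
        have "0 < \<alpha> * sqrt s powr (q + 2)" using s \<alpha> by (intro mult_pos_pos) auto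
        then show "B \<noteq> 0" "B \<noteq> \<infinity>" unfolding B by (simp_all add: ennreal_eq_0_iff)
      qed (use gibbs_tilt_wasserstein_le[OF conv f, of \<alpha> q] \<alpha> q S.integrable_potential_axioms in
            \<open>auto simp: U_def B_def mult.assoc\<close>)
      then have "ennreal_powr (ennreal_powr (wasserstein dist q (gibbs f) (gibbs U)) q) (1 / q)
          \<le> ennreal_powr (C_const q * B) (1 / q)"
        using q by (intro ennreal_powr_mono) auto
      then show ?thesis using q by (simp add: ennreal_powr_powr_inverse B_def mult.assoc)
    qed
    show ?thesis
      using order_trans[OF tri add_mono[OF lmc_error penalty]] unfolding \<nu>_def p_def .
  qed
qed

end
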